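(* Assume that the flow $\phi$ of $\partial_t u=A_0u+A_1(u)$ and the flows $\phi_0$ of $\partial_t u=A_0u$ and $\phi_1$ of $\partial_t u=A_1(u)$ are compatible with a sequence $\{\mathsf H_k\}_{k\ge 0}$ of Hilbert spaces with $\mathsf H_0=\mathsf H$ and $\mathsf H_{k+1}\hookrightarrow\mathsf H_k$. Let $n\in\mathbb N$, $q=2n$, and let $\gamma=(\gamma_1,\dots,\gamma_s)\in\mathbb R^s$ satisfy $$\sum_{m=1}^s\gamma_m=\tfrac12,\qquad \sum_{m=1}^s m^{-2k}\gamma_m=0\quad\text{for }1\le k\le n-1 .$$ Let $\Phi(h)=\sum_{m=1}^s\gamma_m\big(\Phi_m^{+}(h/m)+\Phi_m^{-}(h/m)\big)$. Then for every $u\in\mathsf H_q$, $$\frac{\partial^k\Phi}{\partial h^k}(0,u)=\frac{\partial^k\phi}{\partial h^k}(0,u),\qquad k=0,\dots,q.$$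
   Context: $\mathsf H$ is a Hilbert space, $A_0$ is a closed densely defined linear operator on $D(A_0)\subset\mathsf H$ generating a quasicontraction semigroup ($\|e^{tA_0}u\|\le e^{\kappa_0t}\|u\|$), and $A_1:\mathsf H\to\mathsf H$ is a smooth map with $A_1(0)=0$. Flows are solution maps $(t,u_0)\mapsto u(t)$ in the usual (mild) sense; a flow $\varphi$ satisfies $\varphi(0)=I$ and $\varphi(t+t')=\varphi(t)\circ\varphi(t')$. In particular $\phi_0(t)=e^{tA_0}$. Notation: $\varphi(h)=\varphi(h,\cdot)$. Define $\Phi^+(h)=\phi_1(h)\circ\phi_0(h)$, $\Phi^-(h)=\phi_0(h)\circ\phi_1(h)$, $\Phi_1^\pm=\Phi^\pm$ and $\Phi_m^\pm(h)=\Phi^\pm(h)\circ\Phi_{m-1}^\pm(h)$ for $m\ge2$. Compatibility: $\varphi\in C([0,h_* )\times\mathsf H_0,\mathsf H_0)$ is compatible with $\{\mathsf H_k\}_{k\ge0}$ if for all $k,l\ge0$, $\varphi\in C^{k,\infty}([0,h_* )\times\mathsf H_{k+l},\mathsf H_l)$, i.e. the restriction of $\varphi$ to $[0,h_* )\times\mathsf H_{k+l}$ takes values in $\mathsf H_l$ and is $k$ times continuously differentiable in $h$ and infinitely differentiable in $u$: all mixed derivatives $\partial_h^jD_u^i\varphi(h,u)[v_1,\dots,v_i]$ ($0\le j\le k$, $i\ge0$) exist in $\mathsf H_l$ and are jointly continuous in $(h,u,v_1,\dots,v_i)\in[0,h_* )\times\mathsf H_{k+l}^{1+i}$. Derivatives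 at $h=0$ are one-sided. *)

theory Defs
  imports "HOL-Analysis.Analysis"
begin

text \<open>
  Real scalars are used throughout. A complex Hilbert space is covered by restricting scalars and
  taking the real part of its inner product.
\<close>

text \<open>
  A Hilbert space embedded in the type \<open>'a\<close> is a carrier \<open>V\<close> together with an inner product \<open>ip\<close>,
  of which only the values on \<open>V\<close> matter. The value 0 of \<open>hdist\<close> off \<open>V\<close> makes it a metric in the
  sense of the locale \<open>Metric_space\<close>, which asks for symmetry and nonnegativity on the whole type.
\<close>

definition hnorm :: "('a \<Rightarrow> 'a \<Rightarrow> real) \<Rightarrow> 'a \<Rightarrow> real" where
  "hnorm ip x = sqrt (ip x x)"

definition hdist :: "'a::real_vector set \<Rightarrow> ('a \<Rightarrow> 'a \<Rightarrow> real) \<Rightarrow> 'a \<Rightarrow> 'a \<Rightarrow> real" where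
  "hdist V ip x y = (if x \<in> V \<and> y \<in> V then hnorm ip (x - y) else 0)"

definition htop :: "'a::real_vector set \<Rightarrow> ('a \<Rightarrow> 'a \<Rightarrow> real) \<Rightarrow> 'a topology" where
  "htop V ip = Metric_space.mtopology V (hdist V ip)"

definition hilbert_on :: "'a::real_vector set \<Rightarrow> ('a \<Rightarrow> 'a \<Rightarrow> real) \<Rightarrow> bool" where
  "hilbert_on V ip \<longleftrightarrow>
     subspace V \<and>
     (\<forall>x\<in>V. \<forall>y\<in>V. ip x y = ip y x) \<and>
     (\<forall>x\<in>V. \<forall>y\<in>V. \<forall>z\<in>V. ip (x + y) z = ip x z + ip y z) \<and>
     (\<forall>r. \<forall>x\<in>V. \<forall>y\<in>V. ip (r *\<^sub>R x) y = r * ip x y) \<and>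
     (\<forall>x\<in>V. 0 \<le> ip x x) \<and>
     (\<forall>x\<in>V. ip x x = 0 \<longrightarrow> x = 0) \<and>
     Metric_space.mcomplete V (hdist V ip)"

definition hilbert_sequence ::
    "(nat \<Rightarrow> 'a::{real_inner, complete_space} set) \<Rightarrow> (nat \<Rightarrow> 'a \<Rightarrow> 'a \<Rightarrow> real) \<Rightarrow> bool" where
  "hilbert_sequence H ip \<longleftrightarrow>
     H 0 = UNIV \<and> ip 0 = inner \<and>
     (\<forall>k. hilbert_on (H k) (ip k)) \<and>
     (\<forall>k. H (Suc k) \<subseteq> H k \<and>
          (\<exists>C. \<forall>u\<in>H (Suc k). hnorm (ip k) u \<le> C * hnorm (ip (Suc k)) u))"

text \<open>
  \<open>d j i h u v\<close> is the mixed derivative \<open>\<partial>\<^sub>h\<^sup>j D\<^sub>u\<^sup>i f(h,u)[v\<^sub>0,\<dots>,v\<^sub>i\<^sub>-\<^sub>1]\<close>, where the tuple of directions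
  is an extensional function on \<open>{..<i}\<close>. The derivatives in \<open>u\<close> are iterated directional
  derivatives. With the joint continuity, they are multilinear and symmetric in the directions.
\<close>

definition C_k_infty :: "nat \<Rightarrow> real \<Rightarrow> 'a::real_vector topology \<Rightarrow> 'a topology
    \<Rightarrow> (real \<Rightarrow> 'a \<Rightarrow> 'a) \<Rightarrow> bool" where
  "C_k_infty k T X Y f \<longleftrightarrow>
     (\<exists>d :: nat \<Rightarrow> nat \<Rightarrow> real \<Rightarrow> 'a \<Rightarrow> (nat \<Rightarrow> 'a) \<Rightarrow> 'a.
        (\<forall>h\<in>{0..<T}. \<forall>u\<in>topspace X. \<forall>v\<in>{..<0} \<rightarrow>\<^sub>E topspace X. d 0 0 h u v = f h u) \<and>
        (\<forall>i. \<forall>h\<in>{0..<T}. \<forall>u\<in>topspace X. \<forall>v\<in>{..<Suc i} \<rightarrow>\<^sub>E topspace X.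
           limitin Y
             (\<lambda>e. (1 / e) *\<^sub>R (d 0 i h (u + e *\<^sub>R v i) (restrict v {..<i})
                             - d 0 i h u (restrict v {..<i})))
             (d 0 (Suc i) h u v) (at 0)) \<and>
        (\<forall>j<k. \<forall>i. \<forall>h\<in>{0..<T}. \<forall>u\<in>topspace X. \<forall>v\<in>{..<i} \<rightarrow>\<^sub>E topspace X.
           limitin Y (\<lambda>h'. (1 / (h' - h)) *\<^sub>R (d j i h' u v - d j i h u v))
             (d (Suc j) i h u v) (at h within {0..<T})) \<and>
        (\<forall>j\<le>k. \<forall>i.
           continuous_map
             (prod_topology (top_of_set {0..<T})
                (prod_topology X (product_topology (\<lambda>_. X) {..<i})))
             Y (\<lambda>(h, u, v). d j i h u v)))"

definition compatible :: "real \<Rightarrow> (nat \<Rightarrow> 'a::real_vector set) \<Rightarrow> (nat \<Rightarrow> 'a \<Rightarrow> 'a \<Rightarrow> real)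
    \<Rightarrow> (real \<Rightarrow> 'a \<Rightarrow> 'a) \<Rightarrow> bool" where
  "compatible T H ip f \<longleftrightarrow>
     (\<forall>k l. C_k_infty k T (htop (H (k + l)) (ip (k + l))) (htop (H l) (ip l)) f)"

definition c0_semigroup :: "(real \<Rightarrow> 'a::real_normed_vector \<Rightarrow> 'a) \<Rightarrow> bool" where
  "c0_semigroup S \<longleftrightarrow>
     (\<forall>t\<ge>0. bounded_linear (S t)) \<and>
     (\<forall>u. S 0 u = u) \<and>
     (\<forall>s\<ge>0. \<forall>t\<ge>0. \<forall>u. S (s + t) u = S s (S t u)) \<and>
     (\<forall>u. ((\<lambda>t. S t u) \<longlongrightarrow> u) (at_right 0))"

text \<open>An unbounded operator is a domain \<open>D\<close> with a function, of which only the values on \<open>D\<close> matter.\<close>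

definition closed_densely_defined_linear ::
    "'a::real_normed_vector set \<Rightarrow> ('a \<Rightarrow> 'a) \<Rightarrow> bool" where
  "closed_densely_defined_linear D A \<longleftrightarrow>
     subspace D \<and> closure D = UNIV \<and>
     (\<forall>u\<in>D. \<forall>v\<in>D. A (u + v) = A u + A v) \<and>
     (\<forall>r. \<forall>u\<in>D. A (r *\<^sub>R u) = r *\<^sub>R A u) \<and>
     closed {(u, A u) |u. u \<in> D}"

definition generates ::
    "'a::real_normed_vector set \<Rightarrow> ('a \<Rightarrow> 'a) \<Rightarrow> (real \<Rightarrow> 'a \<Rightarrow> 'a) \<Rightarrow> bool" where
  "generates D A S \<longleftrightarrow>
     c0_semigroup S \<and>
     (\<forall>u v. u \<in> D \<and> A u = v \<longleftrightarrow> ((\<lambda>t. (1 / t) *\<^sub>R (S t u - u)) \<longlongrightarrow> v) (at_right 0))"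

text \<open>
  Infinite Frechet differentiability. \<open>D u [v\<^sub>1,\<dots>,v\<^sub>n]\<close> is the \<open>n\<close>-th derivative at \<open>u\<close>, a bounded
  multilinear map, and the map sending \<open>u\<close> to it is Frechet differentiable in the norm of bounded
  multilinear maps.
\<close>

definition smooth_map :: "('a::real_normed_vector \<Rightarrow> 'b::real_normed_vector) \<Rightarrow> bool" where
  "smooth_map f \<longleftrightarrow>
     (\<exists>D :: 'a \<Rightarrow> 'a list \<Rightarrow> 'b.
        (\<forall>u. D u [] = f u) \<and>
        (\<forall>u xs ys. linear (\<lambda>v. D u (xs @ v # ys))) \<and>
        (\<forall>u n. \<exists>C. \<forall>vs. length vs = n \<longrightarrow> norm (D u vs) \<le> C * prod_list (map norm vs)) \<and>
        (\<forall>u n. \<forall>e>0. \<exists>\<delta>>0. \<forall>w vs. norm w < \<delta> \<longrightarrow> length vs = n \<longrightarrow>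
           norm (D (u + w) vs - D u vs - D u (w # vs)) \<le> e * norm w * prod_list (map norm vs)))"

text \<open>
  \<open>f\<close> is the flow, on the time interval \<open>[0,T)\<close>, of mild solutions of \<open>\<partial>\<^sub>t u = A u + F u\<close>, where \<open>A\<close>
  generates the semigroup \<open>S\<close>.
\<close>

definition mild_flow :: "real \<Rightarrow> (real \<Rightarrow> 'a::real_normed_vector \<Rightarrow> 'a) \<Rightarrow> ('a \<Rightarrow> 'a)
    \<Rightarrow> (real \<Rightarrow> 'a \<Rightarrow> 'a) \<Rightarrow> bool" where
  "mild_flow T S F f \<longleftrightarrow>
     (\<forall>u. f 0 u = u) \<and>
     (\<forall>t t' u. 0 \<le> t \<longrightarrow> 0 \<le> t' \<longrightarrow> t + t' < T \<longrightarrow> f (t + t') u = f t (f t' u)) \<and>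
     (\<forall>u. continuous_on {0..<T} (\<lambda>t. f t u)) \<and>
     (\<forall>u. \<forall>t\<in>{0..<T}. ((\<lambda>s. S (t - s) (F (f s u))) has_integral (f t u - S t u)) {0..t})"

definition lie_plus :: "(real \<Rightarrow> 'a \<Rightarrow> 'a) \<Rightarrow> (real \<Rightarrow> 'a \<Rightarrow> 'a) \<Rightarrow> real \<Rightarrow> 'a \<Rightarrow> 'a" where
  "lie_plus \<phi>0 \<phi>1 h = \<phi>1 h \<circ> \<phi>0 h"

definition lie_minus :: "(real \<Rightarrow> 'a \<Rightarrow> 'a) \<Rightarrow> (real \<Rightarrow> 'a \<Rightarrow> 'a) \<Rightarrow> real \<Rightarrow> 'a \<Rightarrow> 'a" where
  "lie_minus \<phi>0 \<phi>1 h = \<phi>0 h \<circ> \<phi>1 h"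

definition affine_integrator :: "nat \<Rightarrow> (nat \<Rightarrow> real) \<Rightarrow> (real \<Rightarrow> 'a::real_vector \<Rightarrow> 'a)
    \<Rightarrow> (real \<Rightarrow> 'a \<Rightarrow> 'a) \<Rightarrow> real \<Rightarrow> 'a \<Rightarrow> 'a" where
  "affine_integrator s \<gamma> \<phi>0 \<phi>1 h u =
     (\<Sum>m=1..s. \<gamma> m *\<^sub>R ((lie_plus \<phi>0 \<phi>1 (h / real m) ^^ m) u
                        + (lie_minus \<phi>0 \<phi>1 (h / real m) ^^ m) u))"

text \<open>Iterated derivatives on a set of reals; one-sided at its end points.\<close>

primrec nth_deriv ::
    "real set \<Rightarrow> nat \<Rightarrow> (real \<Rightarrow> 'a::real_normed_vector) \<Rightarrow> real \<Rightarrow> 'a" where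
  "nth_deriv I 0 f = f"
| "nth_deriv I (Suc k) f = (\<lambda>h. vector_derivative (nth_deriv I k f) (at h within I))"

definition times_differentiable_on ::
    "nat \<Rightarrow> (real \<Rightarrow> 'a::real_normed_vector) \<Rightarrow> real set \<Rightarrow> bool" where
  "times_differentiable_on k f I \<longleftrightarrow>
     (\<forall>j<k. \<forall>h\<in>I. nth_deriv I j f differentiable (at h within I))"

end

theory Submission
  imports Defs "HOL-Computational_Algebra.Polynomial"
begin

text \<open>
  Composition with the two flows acts on functions on the scale as \<open>exp (h L\<^sub>0)\<close> and \<open>exp (h L\<^sub>1)\<close>, where
  \<open>L\<^sub>0\<close> and \<open>L\<^sub>1\<close> are the Lie derivatives along the two vector fields, and each Lie derivative costs one
  level of the scale. Hence the Taylor coefficients of the methods are governed by the words in \<open>L\<^sub>0\<close>,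
  \<open>L\<^sub>1\<close>, and the statement reduces to an identity for formal series in two noncommuting letters:
  \<open>\<Sum>\<^sub>m \<gamma>\<^sub>m ((e\<^bsup>X/m\<^esup> e\<^bsup>Y/m\<^esup>)\<^sup>m + (e\<^bsup>Y/m\<^esup> e\<^bsup>X/m\<^esup>)\<^sup>m)\<close> agrees with \<open>e\<^bsup>X+Y\<^esup>\<close> up to words of length
  \<open>2 n\<close>. By the binomial series, the coefficient of a word \<open>w\<close> in \<open>(e\<^bsup>X\<^esup> e\<^bsup>Y\<^esup>)\<^sup>m\<close> is a polynomial in \<open>m\<close> of
  degree \<open>length w\<close> with leading coefficient \<open>1 / (length w)!\<close>, so in the rescaled product it is a
  polynomial in \<open>1/m\<close>. As \<open>e\<^bsup>Y\<^esup> e\<^bsup>X\<^esup>\<close> is the inverse of \<open>e\<^bsup>-X\<^esup> e\<^bsup>-Y\<^esup>\<close>, the reversed product has the same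
  polynomial at \<open>-1/m\<close>. The odd powers of \<open>1/m\<close> cancel in the sum, and the order conditions remove the
  even ones except for the constant term.
\<close>

section \<open>Derivatives in a scale of Hilbert spaces\<close>

text \<open>Compatibility supplies derivatives in \<open>u\<close> only as iterated directional
  limits, with a separate family for each pair of levels and no Frechet estimate. Agreement of the
  families, linearity in the directions and the exchange of time and space derivatives are therefore
  recovered from joint continuity, by a mean value inequality. A derivative takes more arguments
  than the map it comes from; infinite tuples of arguments keep the type fixed, so that a single
  class of maps can be closed under differentiation. The vector fields of \<open>\<phi>\<close>,
  \<open>\<phi>0\<close> and \<open>\<phi>1\<close> are linked by the mild formula, which speaks of
  the norm of \<open>H 0\<close>; uniqueness of limits carries the link to the stronger norms in
  which the Lie derivatives are taken. An asymptotic expansion of the integrator does not produce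
  derivatives, so its differentiability on \<open>H q\<close> is obtained separately and
  coefficients are compared afterwards. Words of length \<open>2 * n\<close> are reached although
  the conditions stop at \<open>k = n - 1\<close>, because the remaining even power
  \<open>2 * n\<close> of 1/m comes with the constant coefficient of the polynomial in m, which
  vanishes for nonempty words.\<close>

lemmas hilbert_onD =
  hilbert_on_def[THEN iffD1, THEN conjunct1]
  hilbert_on_def[THEN iffD1, THEN conjunct2, THEN conjunct1]
  hilbert_on_def[THEN iffD1, THEN conjunct2, THEN conjunct2, THEN conjunct1]
  hilbert_on_def[THEN iffD1, THEN conjunct2, THEN conjunct2, THEN conjunct2, THEN conjunct1]
  hilbert_on_def[THEN iffD1, THEN conjunct2, THEN conjunct2, THEN conjunct2, THEN conjunct2, THEN conjunct1]
  hilbert_on_def[THEN iffD1, THEN conjunct2, THEN conjunct2, THEN conjunct2, THEN conjunct2, THEN conjunct2, THEN conjunct1]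

text \<open>The inner product is a parameter with meaning on \<open>V\<close> only, so the
  discriminant argument is carried out on the carrier: the square of the norm of r x + y is a
  nonnegative quadratic in r, evaluated at its minimiser \<open>- ip x y / ip x x\<close>.\<close>

lemma hilbert_on_Cauchy_Schwarz:
  assumes "hilbert_on V ip" "x \<in> V" "y \<in> V"
  shows "\<bar>ip x y\<bar> \<le> hnorm ip x * hnorm ip y"
proof -
  note sp = hilbert_onD[OF assms(1)]
  note V = sp(1) and sym = bspec[OF bspec[OF sp(2)]]
    and add = bspec[OF bspec[OF bspec[OF sp(3)]]] and scale = bspec[OF bspec[OF spec[OF sp(4)]]]
    and pos = bspec[OF sp(5)] and zero = mp[OF bspec[OF sp(6)]]
  have quad: "0 \<le> r\<^sup>2 * ip x x + 2 * r * ip x y + ip y y" for r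
  proof -
    have m: "r *\<^sub>R x + y \<in> V" "r *\<^sub>R x \<in> V"
      using V assms by (auto intro: subspace_add subspace_scale)
    have e: "ip (r *\<^sub>R x + y) z = r * ip x z + ip y z" if "z \<in> V" for z
      by (simp only: add[OF m(2) assms(3) that] scale[OF assms(2) that])
    have "ip (r *\<^sub>R x + y) (r *\<^sub>R x + y) = r * ip (r *\<^sub>R x + y) x + ip (r *\<^sub>R x + y) y"
      by (simp only: e[OF m(1)] sym[OF assms(2) m(1)] sym[OF assms(3) m(1)])
    also have "\<dots> = r * (r * ip x x + ip x y) + (r * ip x y + ip y y)"
      by (simp only: e[OF assms(2)] e[OF assms(3)] sym[OF assms(3,2)])
    also have "\<dots> = r\<^sup>2 * ip x x + 2 * r * ip x y + ip y y"
      by (simp add: algebra_simps power2_eq_square)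
    finally show ?thesis
      using pos[OF m(1)] by simp
  qed
  have "(ip x y)\<^sup>2 \<le> ip x x * ip y y"
  proof (cases "ip x x = 0")
    case True
    then have "x = 0" using zero assms by blast
    moreover have "ip (0 *\<^sub>R x) y = 0 * ip x y" by (rule scale[OF assms(2,3)])
    ultimately show ?thesis using True by simp
  next
    case False
    then have p: "ip x x > 0" using pos[OF assms(2)] by simp
    have r: "0 \<le> c - b\<^sup>2 / a" if "0 \<le> (- b / a)\<^sup>2 * a + 2 * (- b / a) * b + c" "a > 0" for a b c :: real
      using that by (simp add: power2_eq_square)
    have "(ip x y)\<^sup>2 / ip x x \<le> ip y y"
      using r[OF quad[of "- ip x y / ip x x"] p] by simp
    then show ?thesis using p by (simp add: pos_divide_le_eq mult.commute)
  qed
  then have "\<bar>ip x y\<bar> \<le> sqrt (ip x x * ip y y)"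
    by (metis real_sqrt_abs real_sqrt_le_mono)
  then show ?thesis by (simp only: hnorm_def real_sqrt_mult)
qed

section \<open>Subspaces, norms and convergence on the levels of the scale\<close>

locale hilbert_scale =
  fixes H :: "nat \<Rightarrow> 'a::{real_inner, complete_space} set"
    and ip :: "nat \<Rightarrow> 'a \<Rightarrow> 'a \<Rightarrow> real"
  assumes spaces: "hilbert_sequence H ip"
begin

abbreviation N :: "nat \<Rightarrow> 'a \<Rightarrow> real" where "N k \<equiv> hnorm (ip k)"

lemma hilbert: "hilbert_on (H k) (ip k)"
  using hilbert_sequence_def[THEN iffD1, OF spaces, THEN conjunct2, THEN conjunct2, THEN conjunct1] ..

lemma embed: "\<forall>k. H (Suc k) \<subseteq> H k \<and>
    (\<exists>C. \<forall>u\<in>H (Suc k). N k u \<le> C * N (Suc k) u)"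
  by (rule hilbert_sequence_def[THEN iffD1, OF spaces, THEN conjunct2, THEN conjunct2, THEN conjunct2])

lemma H0 [simp]: "H 0 = UNIV" and ip0: "ip 0 = inner"
  by (rule hilbert_sequence_def[THEN iffD1, OF spaces, THEN conjunct1]
      hilbert_sequence_def[THEN iffD1, OF spaces, THEN conjunct2, THEN conjunct1])+

lemma N0 [simp]: "N 0 = norm"
  by (rule ext) (simp only: hnorm_def ip0 norm_eq_sqrt_inner)

lemma subspace_H: "subspace (H k)"
  by (rule hilbert_onD(1)[OF hilbert])

lemma H_zero [simp, intro]: "0 \<in> H k"
  and H_add [simp, intro]: "x \<in> H k \<Longrightarrow> y \<in> H k \<Longrightarrow> x + y \<in> H k"
  and H_diff [simp, intro]: "x \<in> H k \<Longrightarrow> y \<in> H k \<Longrightarrow> x - y \<in> H k"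
  and H_scale [simp, intro]: "x \<in> H k \<Longrightarrow> r *\<^sub>R x \<in> H k"
  using subspace_H subspace_0 subspace_add subspace_diff subspace_scale by blast+

lemma H_antimono: "k \<le> l \<Longrightarrow> x \<in> H l \<Longrightarrow> x \<in> H k"
proof (induction l rule: dec_induct)
  case (step l)
  have "H (Suc l) \<subseteq> H l"
    using embed by blast
  with step show ?case by blast
qed

lemmas ip_sym = bspec[OF bspec[OF hilbert_onD(2)[OF hilbert]]]
  and ip_add = bspec[OF bspec[OF bspec[OF hilbert_onD(3)[OF hilbert]]]]
  and ip_scale = bspec[OF bspec[OF spec[OF hilbert_onD(4)[OF hilbert]]]]
  and ip_pos = bspec[OF hilbert_onD(5)[OF hilbert]]
  and ip_zero = mp[OF bspec[OF hilbert_onD(6)[OF hilbert]]]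

lemma ip_diff: "x \<in> H k \<Longrightarrow> y \<in> H k \<Longrightarrow> z \<in> H k \<Longrightarrow> ip k (x - y) z = ip k x z - ip k y z"
  using ip_add[of "x - y" k y z] H_diff by simp

lemma N_nonneg [simp]: "x \<in> H k \<Longrightarrow> 0 \<le> N k x"
  by (simp add: hnorm_def ip_pos)

lemma N_square: "x \<in> H k \<Longrightarrow> (N k x)\<^sup>2 = ip k x x"
  by (simp add: hnorm_def ip_pos)

lemma N_zero [simp]: "N k 0 = 0"
  using ip_scale[of 0 k 0 0] by (simp add: hnorm_def)

lemma N_eq_zero: "x \<in> H k \<Longrightarrow> N k x = 0 \<Longrightarrow> x = 0"
  by (simp add: hnorm_def ip_zero)

lemma N_scale: "x \<in> H k \<Longrightarrow> N k (r *\<^sub>R x) = \<bar>r\<bar> * N k x"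
proof -
  assume x: "x \<in> H k"
  have "ip k (r *\<^sub>R x) (r *\<^sub>R x) = r * (r * ip k x x)"
    using x H_scale[OF x, of r] ip_sym[OF x H_scale[OF x, of r]] by (simp add: ip_scale)
  then show ?thesis by (simp add: hnorm_def real_sqrt_mult)
qed

lemma N_minus: "x \<in> H k \<Longrightarrow> y \<in> H k \<Longrightarrow> N k (x - y) = N k (y - x)"
  using N_scale[of "x - y" k "-1"] by (simp add: H_diff)

lemma ip_le: "x \<in> H k \<Longrightarrow> y \<in> H k \<Longrightarrow> \<bar>ip k x y\<bar> \<le> N k x * N k y"
  by (rule hilbert_on_Cauchy_Schwarz[OF hilbert])

lemma N_triangle: "x \<in> H k \<Longrightarrow> y \<in> H k \<Longrightarrow> N k (x + y) \<le> N k x + N k y"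
proof -
  assume x: "x \<in> H k" and y: "y \<in> H k"
  have xy: "x + y \<in> H k" using x y by blast
  have "(N k (x + y))\<^sup>2 = ip k x x + 2 * ip k x y + ip k y y"
    unfolding N_square[OF xy] using x y xy ip_sym[OF x xy] ip_sym[OF y xy] ip_sym[OF y x] by (simp add: ip_add)
  also have "\<dots> \<le> (N k x + N k y)\<^sup>2"
    using ip_le[OF x y] x y by (simp add: N_square[symmetric] power2_sum)
  finally show ?thesis
    using x y by (meson N_nonneg add_nonneg_nonneg power2_le_imp_le)
qed

lemma N_le_embed: "\<exists>C\<ge>0. \<forall>u\<in>H (k + l). N k u \<le> C * N (k + l) u"
proof (induction l)
  case 0
  show ?case by (rule exI[of _ 1]) simp
next
  case (Suc l)
  then obtain C where C: "C \<ge> 0" "\<And>u. u \<in> H (k + l) \<Longrightarrow> N k u \<le> C * N (k + l) u" by blast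
  obtain D where D: "\<And>u. u \<in> H (Suc (k + l)) \<Longrightarrow> N (k + l) u \<le> D * N (Suc (k + l)) u"
    using embed by blast
  show ?case
  \<comment> \<open>The embedding constant \<open>D\<close> comes without a sign; its absolute value
    keeps the product of the constants nonnegative.\<close>
  proof (intro exI[of _ "C * \<bar>D\<bar>"] conjI ballI)
    show "0 \<le> C * \<bar>D\<bar>" using C by simp
    fix u assume u: "u \<in> H (k + Suc l)"
    then have u': "u \<in> H (k + l)" by (rule H_antimono[rotated]) simp
    have "N k u \<le> C * N (k + l) u" using C u' by blast
    also have "\<dots> \<le> C * (\<bar>D\<bar> * N (k + Suc l) u)"
    proof -
      have "N (k + l) u \<le> D * N (k + Suc l) u" using D[of u] u by simp
      also have "\<dots> \<le> \<bar>D\<bar> * N (k + Suc l) u"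
        by (intro mult_right_mono) (use u in auto)
      finally show ?thesis using C by (intro mult_left_mono) auto
    qed
    finally show "N k u \<le> C * \<bar>D\<bar> * N (k + Suc l) u" by (simp add: mult.assoc)
  qed
qed

text \<open>Continuity is expressed by sequences, so that intermediate points from the mean value theorem
  can be chosen along the sequence.\<close>

definition cv :: "nat \<Rightarrow> (nat \<Rightarrow> 'a) \<Rightarrow> 'a \<Rightarrow> bool" where
  "cv k X x \<longleftrightarrow> (\<forall>n. X n \<in> H k) \<and> x \<in> H k \<and> (\<lambda>n. N k (X n - x)) \<longlonglongrightarrow> 0"

lemma cvI: "(\<And>n. X n \<in> H k) \<Longrightarrow> x \<in> H k \<Longrightarrow> (\<lambda>n. N k (X n - x)) \<longlonglongrightarrow> 0 \<Longrightarrow> cv k X x"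
  by (simp add: cv_def)

lemma cv_in: "cv k X x \<Longrightarrow> X n \<in> H k" "cv k X x \<Longrightarrow> x \<in> H k"
  by (simp_all add: cv_def)

lemma cv_const [simp]: "cv k (\<lambda>n. x) x \<longleftrightarrow> x \<in> H k"
  by (simp add: cv_def)

lemma cv_0: "cv 0 X x \<longleftrightarrow> X \<longlonglongrightarrow> x"
  by (simp add: cv_def tendsto_norm_zero_iff LIM_zero_iff)

lemma cv_bound:
  assumes "\<And>n. X n \<in> H k" "x \<in> H k" "\<And>n. N k (X n - x) \<le> f n" "f \<longlonglongrightarrow> 0"
  shows "cv k X x"
proof (rule cvI)
  show "(\<lambda>n. N k (X n - x)) \<longlonglongrightarrow> 0"
    by (rule tendsto_sandwich[OF _ _ tendsto_const assms(4)]) (use assms in \<open>auto intro!: always_eventually\<close>)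
qed (use assms in auto)

lemma cv_add: 
  assumes "cv k X x" "cv k Y y" shows "cv k (\<lambda>n. X n + Y n) (x + y)"
proof (rule cv_bound)
  show "(\<lambda>n. N k (X n - x) + N k (Y n - y)) \<longlonglongrightarrow> 0"
    using assms by (auto simp: cv_def intro: tendsto_add_zero)
  fix n
  have "X n + Y n - (x + y) = (X n - x) + (Y n - y)" by simp
  then show "N k (X n + Y n - (x + y)) \<le> N k (X n - x) + N k (Y n - y)"
    using assms N_triangle[of "X n - x" k "Y n - y"] by (simp add: cv_def algebra_simps)
qed (use assms in \<open>auto simp: cv_def\<close>)

lemma cv_scale:
  assumes "cv k X x" "r \<longlonglongrightarrow> s" shows "cv k (\<lambda>n. r n *\<^sub>R X n) (s *\<^sub>R x)"
proof (rule cv_bound)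
  have *: "(\<lambda>n. N k (X n - x)) \<longlonglongrightarrow> 0" using assms by (simp add: cv_def)
  have "(\<lambda>n. \<bar>r n\<bar> * N k (X n - x) + \<bar>r n - s\<bar> * N k x) \<longlonglongrightarrow> \<bar>s\<bar> * 0 + \<bar>s - s\<bar> * N k x"
    by (intro tendsto_intros * assms(2))
  then show "(\<lambda>n. \<bar>r n\<bar> * N k (X n - x) + \<bar>r n - s\<bar> * N k x) \<longlonglongrightarrow> 0" by simp
  fix n
  have m: "X n \<in> H k" "x \<in> H k" using assms by (auto simp: cv_def)
  have "r n *\<^sub>R X n - s *\<^sub>R x = r n *\<^sub>R (X n - x) + (r n - s) *\<^sub>R x"
    by (simp add: algebra_simps)
  then show "N k (r n *\<^sub>R X n - s *\<^sub>R x) \<le> \<bar>r n\<bar> * N k (X n - x) + \<bar>r n - s\<bar> * N k x"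
    using N_triangle[of "r n *\<^sub>R (X n - x)" k "(r n - s) *\<^sub>R x"] m
    by (simp add: N_scale H_diff H_scale)
qed (use assms in \<open>auto simp: cv_def\<close>)

lemma cv_scaleR: "cv k X x \<Longrightarrow> cv k (\<lambda>n. r *\<^sub>R X n) (r *\<^sub>R x)"
  by (rule cv_scale) auto

lemma cv_diff:
  assumes "cv k X x" "cv k Y y" shows "cv k (\<lambda>n. X n - Y n) (x - y)"
  using cv_add[OF assms(1) cv_scaleR[OF assms(2), of "-1"]] by simp

lemma cv_unique: 
  assumes "cv k X x" "cv k X y" shows "x = y"
proof -
  have "cv k (\<lambda>n. 0) (x - y)" using cv_diff[OF assms] by simp
  then have "N k (0 - (x - y)) = 0"
    unfolding cv_def using LIMSEQ_unique tendsto_const by blast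
  then have "N k (y - x) = 0" by simp
  then show ?thesis using N_eq_zero[of "y - x" k] assms by (simp add: cv_def H_diff)
qed

lemma cv_lower: 
  assumes "k \<le> l" "cv l X x" shows "cv k X x"
proof -
  obtain C where C: "\<And>u. u \<in> H l \<Longrightarrow> N k u \<le> C * N l u"
    using N_le_embed[of k "l - k"] assms(1) by auto
  show ?thesis
  proof (rule cv_bound)
    show "X n \<in> H k" "x \<in> H k" for n using assms by (auto simp: cv_def intro: H_antimono)
    show "N k (X n - x) \<le> C * N l (X n - x)" for n using assms by (auto simp: cv_def intro!: C)
    show "(\<lambda>n. C * N l (X n - x)) \<longlonglongrightarrow> 0" using assms by (auto simp: cv_def intro: tendsto_mult_right_zero)
  qed
qed

section \<open>Topological limits on a level, expressed by its norm\<close>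

lemma htop_topspace: "topspace (htop (H k) (ip k)) = H k"
  and htop_limitin_iff:
    "limitin (htop (H k) (ip k)) f l F \<longleftrightarrow>
       l \<in> H k \<and> eventually (\<lambda>x. f x \<in> H k) F \<and> ((\<lambda>x. N k (f x - l)) \<longlongrightarrow> 0) F"
proof -
  have M: "Metric_space (H k) (hdist (H k) (ip k))"
  proof
    fix x y
    show "0 \<le> hdist (H k) (ip k) x y" by (simp add: hdist_def H_diff)
    show "hdist (H k) (ip k) x y = hdist (H k) (ip k) y x" by (simp add: hdist_def N_minus)
  next
    fix x y assume "x \<in> H k" "y \<in> H k"
    then show "hdist (H k) (ip k) x y = 0 \<longleftrightarrow> x = y"
      using N_eq_zero[of "x - y" k] by (auto simp: hdist_def H_diff)
  next
    fix x y z assume xyz: "x \<in> H k" "y \<in> H k" "z \<in> H k"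
    have "N k ((x - y) + (y - z)) \<le> N k (x - y) + N k (y - z)"
      by (intro N_triangle H_diff xyz)
    then show "hdist (H k) (ip k) x z \<le> hdist (H k) (ip k) x y + hdist (H k) (ip k) y z"
      using xyz by (simp add: hdist_def)
  qed
  show "topspace (htop (H k) (ip k)) = H k"
    by (simp add: htop_def Metric_space.topspace_mtopology[OF M])
  show "limitin (htop (H k) (ip k)) f l F \<longleftrightarrow>
       l \<in> H k \<and> eventually (\<lambda>x. f x \<in> H k) F \<and> ((\<lambda>x. N k (f x - l)) \<longlongrightarrow> 0) F" (is "?L \<longleftrightarrow> ?R")
  proof
    assume ?L
    then have l: "l \<in> H k" and e: "\<And>e. e > 0 \<Longrightarrow> eventually (\<lambda>x. f x \<in> H k \<and> hdist (H k) (ip k) (f x) l < e) F"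
      by (simp_all add: htop_def Metric_space.limitin_metric[OF M])
    have "eventually (\<lambda>x. dist (N k (f x - l)) 0 < e) F" if "e > 0" for e
      using e[OF that] by eventually_elim (auto simp: hdist_def l)
    moreover have "eventually (\<lambda>x. f x \<in> H k) F"
      using e[of 1] by (auto elim: eventually_mono)
    ultimately show ?R using l by (simp add: tendsto_iff)
  next
    assume R: ?R
    have "eventually (\<lambda>x. f x \<in> H k \<and> hdist (H k) (ip k) (f x) l < e) F" if "e > 0" for e
    proof -
      have "eventually (\<lambda>x. dist (N k (f x - l)) 0 < e) F" using R that by (simp add: tendsto_iff)
      moreover have "eventually (\<lambda>x. f x \<in> H k) F" using R by simp
      ultimately show ?thesis by eventually_elim (use R in \<open>simp add: hdist_def\<close>)
    qed
    then show ?L using R by (simp add: htop_def Metric_space.limitin_metric[OF M])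
  qed
qed

lemma htop_limitin_sequentially:
  "(\<And>n. X n \<in> H k) \<Longrightarrow> limitin (htop (H k) (ip k)) X x sequentially \<longleftrightarrow> cv k X x"
  by (auto simp: htop_limitin_iff cv_def)

text \<open>The level is a parameter because one curve is differentiated in several norms. The whole
  curve must lie in \<open>H k\<close>, so that difference quotients belong to the level along every
  sequence. At an isolated point of \<open>S\<close> every vector of \<open>H k\<close> qualifies,
  whence the limit point condition in the uniqueness statement.\<close>

definition der :: "nat \<Rightarrow> real set \<Rightarrow> (real \<Rightarrow> 'a) \<Rightarrow> real \<Rightarrow> 'a \<Rightarrow> bool" where
  "der k S f t y \<longleftrightarrow> (\<forall>s\<in>S. f s \<in> H k) \<and> t \<in> S \<and> y \<in> H k \<and>
     (\<forall>\<sigma>. (\<forall>n. \<sigma> n \<in> S - {t}) \<longrightarrow> \<sigma> \<longlonglongrightarrow> t \<longrightarrow> cv k (\<lambda>n. (1 / (\<sigma> n - t)) *\<^sub>R (f (\<sigma> n) - f t)) y)"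

lemma derI:
  assumes "\<And>s. s \<in> S \<Longrightarrow> f s \<in> H k" "t \<in> S" "y \<in> H k"
    "\<And>\<sigma>. (\<And>n. \<sigma> n \<in> S) \<Longrightarrow> (\<And>n. \<sigma> n \<noteq> t) \<Longrightarrow> \<sigma> \<longlonglongrightarrow> t \<Longrightarrow> cv k (\<lambda>n. (1 / (\<sigma> n - t)) *\<^sub>R (f (\<sigma> n) - f t)) y"
  shows "der k S f t y"
  using assms by (auto simp: der_def)

lemma derD:
  assumes "der k S f t y"
  shows "\<And>s. s \<in> S \<Longrightarrow> f s \<in> H k" "t \<in> S" "y \<in> H k"
    "\<And>\<sigma>. (\<And>n. \<sigma> n \<in> S) \<Longrightarrow> (\<And>n. \<sigma> n \<noteq> t) \<Longrightarrow> \<sigma> \<longlonglongrightarrow> t \<Longrightarrow> cv k (\<lambda>n. (1 / (\<sigma> n - t)) *\<^sub>R (f (\<sigma> n) - f t)) y"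
  using assms by (auto simp: der_def)

lemma der_iff_tendsto:
  "der k S f t y \<longleftrightarrow> (\<forall>s\<in>S. f s \<in> H k) \<and> t \<in> S \<and> y \<in> H k \<and>
     ((\<lambda>s. N k ((1 / (s - t)) *\<^sub>R (f s - f t) - y)) \<longlongrightarrow> 0) (at t within S)" (is "_ \<longleftrightarrow> ?m \<and> _ \<and> _ \<and> ?lim")
proof -
  have "?lim \<longleftrightarrow> (\<forall>\<sigma>. (\<forall>n. \<sigma> n \<in> S - {t}) \<longrightarrow> \<sigma> \<longlonglongrightarrow> t \<longrightarrow>
      (\<lambda>n. N k ((1 / (\<sigma> n - t)) *\<^sub>R (f (\<sigma> n) - f t) - y)) \<longlonglongrightarrow> 0)"
    by (simp only: tendsto_at_iff_sequentially comp_def)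
  also have "\<dots> \<longleftrightarrow> (\<forall>\<sigma>. (\<forall>n. \<sigma> n \<in> S - {t}) \<longrightarrow> \<sigma> \<longlonglongrightarrow> t \<longrightarrow>
      cv k (\<lambda>n. (1 / (\<sigma> n - t)) *\<^sub>R (f (\<sigma> n) - f t)) y)" if "\<forall>s\<in>S. f s \<in> H k" "t \<in> S" "y \<in> H k"
  proof (intro all_cong1 imp_cong refl)
    fix \<sigma> :: "nat \<Rightarrow> real" assume "\<forall>n. \<sigma> n \<in> S - {t}"
    with that have "(1 / (\<sigma> n - t)) *\<^sub>R (f (\<sigma> n) - f t) \<in> H k" for n by (intro H_scale H_diff) auto
    with that show "((\<lambda>n. N k ((1 / (\<sigma> n - t)) *\<^sub>R (f (\<sigma> n) - f t) - y)) \<longlonglongrightarrow> 0) =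
        cv k (\<lambda>n. (1 / (\<sigma> n - t)) *\<^sub>R (f (\<sigma> n) - f t)) y"
      by (simp only: cv_def simp_thms)
  qed
  finally show ?thesis
    unfolding der_def by blast
qed

lemma der_0_iff:
  assumes "t \<in> S"
  shows "der 0 S f t y \<longleftrightarrow> (f has_vector_derivative y) (at t within S)"
proof -
  have "((\<lambda>s. norm ((1 / (s - t)) *\<^sub>R (f s - f t) - y)) \<longlongrightarrow> 0) (at t within S)
     \<longleftrightarrow> ((\<lambda>s. norm (f s - f t - (s - t) *\<^sub>R y) / norm (s - t)) \<longlongrightarrow> 0) (at t within S)"
  proof (rule tendsto_cong)
    have "norm ((1 / (s - t)) *\<^sub>R (f s - f t) - y) = norm (f s - f t - (s - t) *\<^sub>R y) / norm (s - t)"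
      if "s \<noteq> t" for s
    proof -
      have "(1 / (s - t)) *\<^sub>R (f s - f t) - y = (1 / (s - t)) *\<^sub>R (f s - f t - (s - t) *\<^sub>R y)"
        using that by (simp add: scaleR_diff_right)
      then show ?thesis by simp
    qed
    then show "\<forall>\<^sub>F s in at t within S. norm ((1 / (s - t)) *\<^sub>R (f s - f t) - y)
        = norm (f s - f t - (s - t) *\<^sub>R y) / norm (s - t)"
      by (auto simp: eventually_at_filter)
  qed
  then show ?thesis
    using assms unfolding der_iff_tendsto has_vector_derivative_def has_derivative_iff_norm
    by (simp add: bounded_linear_scaleR_left)
qed

section \<open>Rules of differentiation in a level\<close>

lemma der_const: "y \<in> H k \<Longrightarrow> t \<in> S \<Longrightarrow> der k S (\<lambda>_. y) t 0"
  by (rule derI) auto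

lemma der_add:
  assumes "der k S f t y" "der k S g t z"
  shows "der k S (\<lambda>s. f s + g s) t (y + z)"
proof (rule derI)
  fix \<sigma> assume "\<And>n. \<sigma> n \<in> S" "\<And>n. \<sigma> n \<noteq> t" "\<sigma> \<longlonglongrightarrow> t"
  then have "cv k (\<lambda>n. (1 / (\<sigma> n - t)) *\<^sub>R (f (\<sigma> n) - f t) + (1 / (\<sigma> n - t)) *\<^sub>R (g (\<sigma> n) - g t)) (y + z)"
    by (intro cv_add derD(4)[OF assms(1)] derD(4)[OF assms(2)])
  then show "cv k (\<lambda>n. (1 / (\<sigma> n - t)) *\<^sub>R (f (\<sigma> n) + g (\<sigma> n) - (f t + g t))) (y + z)"
    by (simp add: scaleR_add_right[symmetric] add_diff_add)
qed (use assms derD in auto)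

lemma der_scaleR:
  assumes "der k S f t y"
  shows "der k S (\<lambda>s. c *\<^sub>R f s) t (c *\<^sub>R y)"
proof (rule derI)
  fix \<sigma> assume "\<And>n. \<sigma> n \<in> S" "\<And>n. \<sigma> n \<noteq> t" "\<sigma> \<longlonglongrightarrow> t"
  then have "cv k (\<lambda>n. c *\<^sub>R (1 / (\<sigma> n - t)) *\<^sub>R (f (\<sigma> n) - f t)) (c *\<^sub>R y)"
    by (intro cv_scaleR derD(4)[OF assms(1)])
  then show "cv k (\<lambda>n. (1 / (\<sigma> n - t)) *\<^sub>R (c *\<^sub>R f (\<sigma> n) - c *\<^sub>R f t)) (c *\<^sub>R y)"
    by (simp add: scaleR_diff_right[symmetric] mult.commute)
qed (use assms derD in auto)

lemma der_diff:
  assumes "der k S f t y" "der k S g t z"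
  shows "der k S (\<lambda>s. f s - g s) t (y - z)"
  using der_add[OF assms(1) der_scaleR[OF assms(2), of "-1"]] by simp

lemma der_subset: "der k S f t y \<Longrightarrow> R \<subseteq> S \<Longrightarrow> t \<in> R \<Longrightarrow> der k R f t y"
  by (rule derI) (auto dest: derD)

lemma der_cong:
  assumes "der k S f t y" "\<And>s. s \<in> S \<Longrightarrow> f s = g s"
  shows "der k S g t y"
proof (rule derI)
  fix \<sigma> assume *: "\<And>n. \<sigma> n \<in> S" "\<And>n. \<sigma> n \<noteq> t" "\<sigma> \<longlonglongrightarrow> t"
  show "cv k (\<lambda>n. (1 / (\<sigma> n - t)) *\<^sub>R (g (\<sigma> n) - g t)) y"
    using derD(4)[OF assms(1) *] assms(2)[OF *(1)] assms(2)[OF derD(2)[OF assms(1)]] by simp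
qed (use assms derD in metis)+

lemma der_lower: "k \<le> l \<Longrightarrow> der l S f t y \<Longrightarrow> der k S f t y"
  by (rule derI) (auto dest: derD intro: H_antimono cv_lower)

text \<open>Both limits are also limits in \<open>H 0\<close>, so the levels \<open>k\<close> and
  \<open>l\<close> may differ. A derivative that exists in a strong norm can thus be identified by a
  computation in a weak one.\<close>

lemma der_unique:
  assumes "der k S f t y" "der l S f t z" "t islimpt S"
  shows "y = z"
proof -
  obtain \<sigma> where \<sigma>: "\<And>n. \<sigma> n \<in> S" "\<And>n. \<sigma> n \<noteq> t" "\<sigma> \<longlonglongrightarrow> t"
    using assms(3) unfolding islimpt_sequential by blast
  show ?thesis
    by (rule cv_unique[of 0])
      (rule derD(4)[OF der_lower[OF _ assms(1)] \<sigma>] derD(4)[OF der_lower[OF _ assms(2)] \<sigma>]; simp)+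
qed

text \<open>The mean value theorem for \<open>t \<mapsto> \<langle>f t - t V, W\<rangle>\<close>, where \<open>W\<close> is the vector to be estimated.\<close>

lemma mean_value:
  assumes S: "closed_segment a b \<subseteq> S"
    and d: "\<And>t. t \<in> closed_segment a b \<Longrightarrow> der k S f t (f' t)" and V: "V \<in> H k"
  shows "\<exists>\<xi>\<in>closed_segment a b. N k (f b - f a - (b - a) *\<^sub>R V) \<le> \<bar>b - a\<bar> * N k (f' \<xi> - V)"
proof -
  have main: "\<exists>\<xi>\<in>{a..b}. N k (f b - f a - (b - a) *\<^sub>R V) \<le> \<bar>b - a\<bar> * N k (f' \<xi> - V)"
    if ab: "a \<le> b" and d: "\<And>t. t \<in> {a..b} \<Longrightarrow> der k {a..b} f t (f' t)" for a b
  proof -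
    define W where "W = f b - f a - (b - a) *\<^sub>R V"
    have m: "\<And>t. t \<in> {a..b} \<Longrightarrow> f t \<in> H k" "\<And>t. t \<in> {a..b} \<Longrightarrow> f' t \<in> H k"
      using d derD by blast+
    have W: "W \<in> H k" using m ab V by (auto simp: W_def)
    have "\<exists>\<xi>\<in>{a..b}. ip k (f b - b *\<^sub>R V) W - ip k (f a - a *\<^sub>R V) W = ip k (f' \<xi> - V) W * (b - a)"
    proof (rule mvt_very_simple[OF ab])
      fix t assume "a \<le> t" "t \<le> b"
      then have t: "t \<in> {a..b}" by simp
      have lim: "((\<lambda>s. N k ((1 / (s - t)) *\<^sub>R (f s - f t) - f' t)) \<longlongrightarrow> 0) (at t within {a..b})"
        using d[OF t] by (simp add: der_iff_tendsto)
      have "((\<lambda>s. ip k (f s - s *\<^sub>R V) W) has_field_derivative ip k (f' t - V) W) (at t within {a..b})"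
        unfolding has_field_derivative_iff
      proof (rule LIM_zero_cancel)
        show "((\<lambda>s. (ip k (f s - s *\<^sub>R V) W - ip k (f t - t *\<^sub>R V) W) / (s - t) - ip k (f' t - V) W) \<longlongrightarrow> 0) (at t within {a..b})"
        proof (rule tendsto_rabs_zero_cancel, rule tendsto_sandwich[OF _ _ tendsto_const])
          show "((\<lambda>s. N k ((1 / (s - t)) *\<^sub>R (f s - f t) - f' t) * N k W) \<longlongrightarrow> 0) (at t within {a..b})"
            using tendsto_mult_left_zero[OF lim] .
          have "\<bar>(ip k (f s - s *\<^sub>R V) W - ip k (f t - t *\<^sub>R V) W) / (s - t) - ip k (f' t - V) W\<bar>
              \<le> N k ((1 / (s - t)) *\<^sub>R (f s - f t) - f' t) * N k W" if s: "s \<in> {a..b}" "s \<noteq> t" for s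
          proof -
            have "(ip k (f s - s *\<^sub>R V) W - ip k (f t - t *\<^sub>R V) W) / (s - t) - ip k (f' t - V) W
                = ip k ((1 / (s - t)) *\<^sub>R (f s - f t) - f' t) W"
            proof -
              have e: "ip k (f r - r *\<^sub>R V) W = ip k (f r) W - r * ip k V W" if "r \<in> {a..b}" for r
                using m that V W by (simp add: ip_diff ip_scale)
              have e1: "ip k ((1 / (s - t)) *\<^sub>R (f s - f t) - f' t) W
                  = 1 / (s - t) * (ip k (f s) W - ip k (f t) W) - ip k (f' t) W"
                using s m t W by (simp add: ip_diff ip_scale)
              have e2: "ip k (f' t - V) W = ip k (f' t) W - ip k V W"
                using m t V W by (simp add: ip_diff)
              show ?thesis
                unfolding e[OF s(1)] e[OF t] e1 e2 using s(2) by (simp add: field_simps)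
            qed
            then show ?thesis
              using ip_le[of "(1 / (s - t)) *\<^sub>R (f s - f t) - f' t" k W] s m t W by simp
          qed
          then show "\<forall>\<^sub>F s in at t within {a..b}. \<bar>(ip k (f s - s *\<^sub>R V) W - ip k (f t - t *\<^sub>R V) W) / (s - t) - ip k (f' t - V) W\<bar>
              \<le> N k ((1 / (s - t)) *\<^sub>R (f s - f t) - f' t) * N k W"
            by (auto simp: eventually_at_filter)
        qed simp
      qed
      then show "((\<lambda>s. ip k (f s - s *\<^sub>R V) W) has_derivative (*) (ip k (f' t - V) W)) (at t within {a..b})"
        by (simp only: has_field_derivative_def)
    qed
    then obtain \<xi> where \<xi>: "\<xi> \<in> {a..b}"
      and eq: "ip k (f b - b *\<^sub>R V) W - ip k (f a - a *\<^sub>R V) W = ip k (f' \<xi> - V) W * (b - a)" by blast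
    have "W = (f b - b *\<^sub>R V) - (f a - a *\<^sub>R V)" by (simp add: W_def algebra_simps)
    then have "ip k W W = ip k (f b - b *\<^sub>R V) W - ip k (f a - a *\<^sub>R V) W"
      using ip_diff[of "f b - b *\<^sub>R V" k "f a - a *\<^sub>R V" W] m(1)[of a] m(1)[of b] ab V W by simp
    then have "(N k W)\<^sup>2 = (b - a) * ip k (f' \<xi> - V) W" using eq W by (simp add: N_square)
    also have "\<dots> \<le> (b - a) * (N k (f' \<xi> - V) * N k W)"
      using ip_le[of "f' \<xi> - V" k W] m \<xi> V W ab by (intro mult_left_mono) auto
    finally have "N k W * N k W \<le> (\<bar>b - a\<bar> * N k (f' \<xi> - V)) * N k W"
      using ab by (simp add: power2_eq_square mult.assoc)
    moreover have "0 \<le> N k W" "0 \<le> \<bar>b - a\<bar> * N k (f' \<xi> - V)" using W m \<xi> V by auto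
    ultimately have "N k W \<le> \<bar>b - a\<bar> * N k (f' \<xi> - V)"
      by (cases "N k W = 0") (auto dest: mult_right_le_imp_le)
    then show ?thesis using \<xi> by (auto simp: W_def)
  qed
  show ?thesis
  proof (cases "a \<le> b")
    case True
    then have seg: "closed_segment a b = {a..b}" by (simp add: closed_segment_eq_real_ivl)
    have "der k {a..b} f t (f' t)" if "t \<in> {a..b}" for t
      using that S by (intro der_subset[OF d]) (auto simp: seg)
    from main[OF True this] show ?thesis unfolding seg .
  next
    case False
    then have ba: "b \<le> a" and seg: "closed_segment a b = {b..a}" by (simp_all add: closed_segment_eq_real_ivl)
    have d': "der k {b..a} f t (f' t)" if "t \<in> {b..a}" for t
      using that S by (intro der_subset[OF d]) (auto simp: seg)
    obtain \<xi> where \<xi>: "\<xi> \<in> {b..a}" and le: "N k (f a - f b - (a - b) *\<^sub>R V) \<le> \<bar>a - b\<bar> * N k (f' \<xi> - V)"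
      using main[OF ba d'] by blast
    have "f a \<in> H k" "f b \<in> H k" using derD(1)[OF d', of a] derD(1)[OF d', of b] ba by auto
    then have "N k (f a - f b - (a - b) *\<^sub>R V) = N k ((a - b) *\<^sub>R V - (f a - f b))"
      using V by (intro N_minus) auto
    also have "(a - b) *\<^sub>R V - (f a - f b) = f b - f a - (b - a) *\<^sub>R V"
      by (simp add: algebra_simps)
    finally show ?thesis using \<xi> le seg by (auto simp: abs_minus_commute)
  qed
qed

text \<open>This is the form in which \<open>mean_value\<close> is consumed: dividing its estimate
  by the increment bounds the error of the difference quotient by that of the intermediate
  derivatives \<open>Z n\<close>.\<close>

lemma cv_quotient:
  assumes "\<And>n. A n \<in> H k" "cv k Z V" "\<And>n. \<sigma> n \<noteq> 0"
    "\<And>n. N k (A n - \<sigma> n *\<^sub>R V) \<le> \<bar>\<sigma> n\<bar> * N k (Z n - V)"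
  shows "cv k (\<lambda>n. (1 / \<sigma> n) *\<^sub>R A n) V"
proof (rule cv_bound)
  show "(\<lambda>n. N k (Z n - V)) \<longlonglongrightarrow> 0" "V \<in> H k" using assms(2) by (simp_all add: cv_def)
  fix n
  show "(1 / \<sigma> n) *\<^sub>R A n \<in> H k" using assms(1) by simp
  have "(1 / \<sigma> n) *\<^sub>R A n - V = (1 / \<sigma> n) *\<^sub>R (A n - \<sigma> n *\<^sub>R V)"
    using assms(3)[of n] by (simp add: scaleR_diff_right)
  then have "N k ((1 / \<sigma> n) *\<^sub>R A n - V) = \<bar>1 / \<sigma> n\<bar> * N k (A n - \<sigma> n *\<^sub>R V)"
    using N_scale[of "A n - \<sigma> n *\<^sub>R V" k "1 / \<sigma> n"] assms(1)[of n] \<open>V \<in> H k\<close> by simp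
  also have "\<dots> \<le> \<bar>1 / \<sigma> n\<bar> * (\<bar>\<sigma> n\<bar> * N k (Z n - V))"
    by (intro mult_left_mono assms(4)) simp
  also have "\<dots> = N k (Z n - V)" using assms(3)[of n] by simp
  finally show "N k ((1 / \<sigma> n) *\<^sub>R A n - V) \<le> N k (Z n - V)" .
qed

lemma der_shift: "der k UNIV (\<lambda>e. g (a + e)) 0 y \<longleftrightarrow> der k UNIV g a y"
proof
  assume d: "der k UNIV (\<lambda>e. g (a + e)) 0 y"
  show "der k UNIV g a y"
  proof (rule derI)
    fix \<sigma> :: "nat \<Rightarrow> real" assume \<sigma>: "\<And>n. \<sigma> n \<noteq> a" "\<sigma> \<longlonglongrightarrow> a"
    have "cv k (\<lambda>n. (1 / ((\<sigma> n - a) - 0)) *\<^sub>R (g (a + (\<sigma> n - a)) - g (a + 0))) y"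
      by (rule derD(4)[OF d]) (use \<sigma> in \<open>auto simp: LIM_zero\<close>)
    then show "cv k (\<lambda>n. (1 / (\<sigma> n - a)) *\<^sub>R (g (\<sigma> n) - g a)) y" by simp
  next
    show "g s \<in> H k" for s using derD(1)[OF d, of "s - a"] by simp
  qed (use derD(3)[OF d] in auto)
next
  assume d: "der k UNIV g a y"
  show "der k UNIV (\<lambda>e. g (a + e)) 0 y"
  proof (rule derI)
    fix \<sigma> :: "nat \<Rightarrow> real" assume \<sigma>: "\<And>n. \<sigma> n \<noteq> 0" "\<sigma> \<longlonglongrightarrow> 0"
    have "(\<lambda>n. a + \<sigma> n) \<longlonglongrightarrow> a + 0" using \<sigma> by (intro tendsto_intros)
    then have "cv k (\<lambda>n. (1 / ((a + \<sigma> n) - a)) *\<^sub>R (g (a + \<sigma> n) - g a)) y"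
      by (intro derD(4)[OF d]) (use \<sigma> in auto)
    then show "cv k (\<lambda>n. (1 / (\<sigma> n - 0)) *\<^sub>R (g (a + \<sigma> n) - g (a + 0))) y" by simp
  qed (use derD(1,3)[OF d] in auto)
qed

lemma der_time_scale:
  assumes "der k S f (c * t) y" "t \<in> R" "\<And>s. s \<in> R \<Longrightarrow> c * s \<in> S"
  shows "der k R (\<lambda>s. f (c * s)) t (c *\<^sub>R y)"
\<comment> \<open>With \<open>c = 0\<close> the curve is constant. The case matters because maps are
  later frozen at time 0 by rescaling time with the factor 0.\<close>
proof (cases "c = 0")
  case True
  then show ?thesis using assms derD[OF assms(1)] der_const[of "f 0" k t R] by auto
next
  case False
  show ?thesis
  proof (rule derI)
    fix \<sigma> :: "nat \<Rightarrow> real" assume \<sigma>: "\<And>n. \<sigma> n \<in> R" "\<And>n. \<sigma> n \<noteq> t" "\<sigma> \<longlonglongrightarrow> t"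
    have "(\<lambda>n. c * \<sigma> n) \<longlonglongrightarrow> c * t" using \<sigma> by (intro tendsto_intros)
    then have "cv k (\<lambda>n. (1 / (c * \<sigma> n - c * t)) *\<^sub>R (f (c * \<sigma> n) - f (c * t))) y"
      by (intro derD(4)[OF assms(1)]) (use \<sigma> False assms in auto)
    then have "cv k (\<lambda>n. c *\<^sub>R (1 / (c * \<sigma> n - c * t)) *\<^sub>R (f (c * \<sigma> n) - f (c * t))) (c *\<^sub>R y)"
      by (rule cv_scaleR)
    moreover have "c * (1 / (c * \<sigma> n - c * t)) = 1 / (\<sigma> n - t)" for n
      using False \<sigma>(2)[of n] by (simp add: field_simps)
    ultimately show "cv k (\<lambda>n. (1 / (\<sigma> n - t)) *\<^sub>R (f (c * \<sigma> n) - f (c * t))) (c *\<^sub>R y)" by simp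
  qed (use assms derD[OF assms(1)] in auto)
qed

text \<open>The increment is split at \<open>G e 0\<close>. The second variable is handled by the
  mean value inequality and the joint continuity of \<open>dG\<close>; for the first, a derivative
  along \<open>t = 0\<close> at the single point \<open>e = 0\<close> is enough. This asymmetry
  permits setting the entries of a tuple in motion one after another.\<close>

lemma der_diagonal:
  assumes d2: "\<And>e t. der k UNIV (G e) t (dG e t)"
    and c2: "\<And>e t. e \<longlonglongrightarrow> 0 \<Longrightarrow> t \<longlonglongrightarrow> 0 \<Longrightarrow> cv k (\<lambda>n. dG (e n) (t n)) (dG 0 0)"
    and d1: "der k UNIV (\<lambda>e. G e 0) 0 p"
  shows "der k UNIV (\<lambda>e. G e e) 0 (p + dG 0 0)"
proof (rule derI)
  show "G s s \<in> H k" for s using derD(1)[OF d2] by simp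
  show "p + dG 0 0 \<in> H k" using derD(3)[OF d1] derD(3)[OF d2] by auto
  fix \<sigma> :: "nat \<Rightarrow> real" assume \<sigma>: "\<And>n. \<sigma> n \<noteq> 0" "\<sigma> \<longlonglongrightarrow> 0"
  have V: "dG 0 0 \<in> H k" by (rule derD(3)[OF d2])
  have "\<exists>\<xi>\<in>closed_segment 0 (\<sigma> n). N k (G (\<sigma> n) (\<sigma> n) - G (\<sigma> n) 0 - (\<sigma> n - 0) *\<^sub>R dG 0 0)
      \<le> \<bar>\<sigma> n - 0\<bar> * N k (dG (\<sigma> n) \<xi> - dG 0 0)" for n
    by (rule mean_value[OF _ d2 V]) simp
  then obtain \<xi> where \<xi>: "\<And>n. \<xi> n \<in> closed_segment 0 (\<sigma> n)"
    "\<And>n. N k (G (\<sigma> n) (\<sigma> n) - G (\<sigma> n) 0 - \<sigma> n *\<^sub>R dG 0 0) \<le> \<bar>\<sigma> n\<bar> * N k (dG (\<sigma> n) (\<xi> n) - dG 0 0)"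
    unfolding diff_0_right by metis
  have "norm (\<xi> n) \<le> \<bar>\<sigma> n\<bar>" for n
    using \<xi>(1)[of n] by (auto simp: closed_segment_eq_real_ivl split: if_splits)
  then have "\<xi> \<longlonglongrightarrow> 0"
    by (intro Lim_null_comparison[OF _ tendsto_rabs_zero[OF \<sigma>(2)]] always_eventually allI)
  then have "cv k (\<lambda>n. (1 / \<sigma> n) *\<^sub>R (G (\<sigma> n) (\<sigma> n) - G (\<sigma> n) 0)) (dG 0 0)"
    by (intro cv_quotient[OF _ c2[OF \<sigma>(2)] \<sigma>(1) \<xi>(2)]) (use derD(1)[OF d2] in auto)
  moreover have "cv k (\<lambda>n. (1 / \<sigma> n) *\<^sub>R (G (\<sigma> n) 0 - G 0 0)) p"
    using derD(4)[OF d1 _ \<sigma>] by simp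
  ultimately have "cv k (\<lambda>n. (1 / \<sigma> n) *\<^sub>R (G (\<sigma> n) 0 - G 0 0) + (1 / \<sigma> n) *\<^sub>R (G (\<sigma> n) (\<sigma> n) - G (\<sigma> n) 0)) (p + dG 0 0)"
    by (intro cv_add)
  then show "cv k (\<lambda>n. (1 / (\<sigma> n - 0)) *\<^sub>R (G (\<sigma> n) (\<sigma> n) - G 0 0)) (p + dG 0 0)"
    by (simp add: scaleR_add_right[symmetric])
qed simp

end

section \<open>Mixed derivatives of a compatible flow\<close>

text \<open>The body of \<open>C_k_infty\<close> with its witness left free, so that a family of
  derivatives can be selected by choice.\<close>

definition mixed_derivatives where
  "mixed_derivatives k T X Y f = (\<lambda>d.
        (\<forall>h\<in>{0..<T}. \<forall>u\<in>topspace X. \<forall>v\<in>{..<0::nat} \<rightarrow>\<^sub>E topspace X. d 0 0 h u v = f h u) \<and>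
        (\<forall>i. \<forall>h\<in>{0..<T}. \<forall>u\<in>topspace X. \<forall>v\<in>{..<Suc i} \<rightarrow>\<^sub>E topspace X.
           limitin Y
             (\<lambda>e. (1 / e) *\<^sub>R (d 0 i h (u + e *\<^sub>R v i) (restrict v {..<i})
                             - d 0 i h u (restrict v {..<i})))
             (d 0 (Suc i) h u v) (at 0)) \<and>
        (\<forall>j<k. \<forall>i. \<forall>h\<in>{0..<T}. \<forall>u\<in>topspace X. \<forall>v\<in>{..<i} \<rightarrow>\<^sub>E topspace X.
           limitin Y (\<lambda>h'. (1 / (h' - h)) *\<^sub>R (d j i h' u v - d j i h u v))
             (d (Suc j) i h u v) (at h within {0..<T})) \<and>
        (\<forall>j\<le>k. \<forall>i.
           continuous_map
             (prod_topology (top_of_set {0..<T})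
                (prod_topology X (product_topology (\<lambda>_. X) {..<i})))
             Y (\<lambda>(h, u, v). d j i h u v)))"

lemma C_k_infty_iff: "C_k_infty k T X Y f \<longleftrightarrow> (\<exists>d. mixed_derivatives k T X Y f d)"
  unfolding C_k_infty_def mixed_derivatives_def ..

locale hilbert_scale_time = hilbert_scale H ip
  for H :: "nat \<Rightarrow> 'a::{real_inner, complete_space} set" and ip +
  fixes T :: real
  assumes T: "0 < T"
begin

abbreviation I :: "real set" where "I \<equiv> {0..<T}"

lemma islimpt_I: "h \<in> I \<Longrightarrow> h islimpt I"
proof (rule connected_imp_perfect)
  have "0 \<in> I" "T / 2 \<in> I" "0 \<noteq> T / 2" using T by auto
  then show "I \<noteq> {x}" for x by (metis singletonD)
qed auto

text \<open>One witness is selected for each pair of levels; nothing in the definition of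
  compatibility relates the selections to each other.\<close>

definition sd :: "(real \<Rightarrow> 'a \<Rightarrow> 'a) \<Rightarrow> nat \<Rightarrow> nat \<Rightarrow> nat \<Rightarrow> nat \<Rightarrow> real \<Rightarrow> 'a \<Rightarrow> (nat \<Rightarrow> 'a) \<Rightarrow> 'a" where
  "sd f k l = (SOME d. mixed_derivatives k T (htop (H (k + l)) (ip (k + l))) (htop (H l) (ip l)) f d)"

text \<open>Point and directions share one tuple: entry 0 is the point and entry
  \<open>Suc r\<close> is direction \<open>r\<close>. The restriction restores the extensional
  tuples over which \<open>C_k_infty\<close> quantifies.\<close>

definition md :: "(real \<Rightarrow> 'a \<Rightarrow> 'a) \<Rightarrow> nat \<Rightarrow> nat \<Rightarrow> nat \<Rightarrow> nat \<Rightarrow> real \<Rightarrow> (nat \<Rightarrow> 'a) \<Rightarrow> 'a" where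
  "md f k l j i h x = sd f k l j i h (x 0) (restrict (\<lambda>r. x (Suc r)) {..<i})"

lemma md_cong: 
  assumes "\<And>r. r \<le> i \<Longrightarrow> x r = y r"
  shows "md f k l j i h x = md f k l j i h y"
proof -
  have "restrict (\<lambda>r. x (Suc r)) {..<i} = restrict (\<lambda>r. y (Suc r)) {..<i}"
    by (rule restrict_ext) (simp add: assms)
  then show ?thesis by (simp add: md_def assms)
qed

context
  fixes f :: "real \<Rightarrow> 'a \<Rightarrow> 'a"
  assumes compat: "compatible T H ip f"
begin

lemma mixed_derivatives_sd:
  "mixed_derivatives k T (htop (H (k + l)) (ip (k + l))) (htop (H l) (ip l)) f (sd f k l)"
  unfolding sd_def
  using compat C_k_infty_iff compatible_def
  by (intro someI_ex[of "mixed_derivatives k T (htop (H (k + l)) (ip (k + l))) (htop (H l) (ip l)) f"]) blast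

lemmas md_facts = mixed_derivatives_sd[unfolded mixed_derivatives_def htop_topspace]

lemma md_flow: 
  assumes "h \<in> I" "x 0 \<in> H (k + l)"
  shows "md f k l 0 0 h x = f h (x 0)"
  unfolding md_def
  by (rule md_facts[THEN conjunct1, rule_format, OF assms]) (auto simp: restrict_def)

lemma md_cont:
  assumes j: "j \<le> k" and h: "\<And>n. h n \<in> I" "h0 \<in> I" "h \<longlonglongrightarrow> h0"
    and X: "\<And>r. r \<le> i \<Longrightarrow> cv (k + l) (\<lambda>n. X n r) (x r)"
  shows "cv l (\<lambda>n. md f k l j i (h n) (X n)) (md f k l j i h0 x)"
proof -
  let ?X = "htop (H (k + l)) (ip (k + l))"
  let ?r = "\<lambda>x. restrict (\<lambda>r. x (Suc r)) {..<i}"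
  note c = md_facts[THEN conjunct2, THEN conjunct2, THEN conjunct2, rule_format, OF j, of l i]
  have r: "limitin (product_topology (\<lambda>_. ?X) {..<i}) (\<lambda>n. ?r (X n)) (?r x) sequentially"
    unfolding limitin_componentwise
    using X cv_in[OF X] by (auto simp: htop_topspace htop_limitin_sequentially intro!: always_eventually)
  have u: "limitin ?X (\<lambda>n. X n 0) (x 0) sequentially"
    using X[of 0] cv_in[OF X[of 0]] by (simp add: htop_limitin_sequentially)
  have t: "limitin (top_of_set I) h h0 sequentially"
    using h by (simp add: limitin_subtopology always_eventually)
  have "limitin (htop (H l) (ip l)) ((\<lambda>(h, u, v). sd f k l j i h u v) \<circ>
      (\<lambda>n. (h n, X n 0, ?r (X n)))) ((\<lambda>(h, u, v). sd f k l j i h u v) (h0, x 0, ?r x)) sequentially"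
    by (rule continuous_map_limit[OF c]) (use r u t in \<open>simp add: limitin_pairwise o_def\<close>)
  then have lim: "limitin (htop (H l) (ip l)) (\<lambda>n. md f k l j i (h n) (X n)) (md f k l j i h0 x) sequentially"
    by (simp add: o_def md_def)
  have "md f k l j i (h n) (X n) \<in> H l" for n
  proof -
    have "(h n, X n 0, ?r (X n)) \<in> topspace (prod_topology (top_of_set I) (prod_topology ?X (product_topology (\<lambda>_. ?X) {..<i})))"
      using h(1)[of n] cv_in[OF X] by (auto simp: htop_topspace)
    then have "(\<lambda>(h, u, v). sd f k l j i h u v) (h n, X n 0, ?r (X n)) \<in> topspace (htop (H l) (ip l))"
      using continuous_map_image_subset_topspace[OF c] by blast
    then show ?thesis by (simp add: htop_topspace md_def)
  qed
  then show ?thesis using lim by (simp add: htop_limitin_sequentially)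
qed

lemma md_in: "j \<le> k \<Longrightarrow> h \<in> I \<Longrightarrow> (\<And>r. r \<le> i \<Longrightarrow> x r \<in> H (k + l)) \<Longrightarrow> md f k l j i h x \<in> H l"
  using md_cont[of j k "\<lambda>_. h" h i l "\<lambda>_. x" x] by simp

lemma md_time:
  assumes j: "j < k" and h: "h \<in> I" and x: "\<And>r. r \<le> i \<Longrightarrow> x r \<in> H (k + l)"
  shows "der l I (\<lambda>h. md f k l j i h x) h (md f k l (Suc j) i h x)"
  using md_facts[THEN conjunct2, THEN conjunct2, THEN conjunct1, rule_format, OF j h, of "x 0" l "restrict (\<lambda>r. x (Suc r)) {..<i}" i]
    x h md_in[of j k _ i x l] j
  by (auto simp: der_iff_tendsto htop_limitin_iff md_def)

lemma md_space_0:
  assumes h: "h \<in> I" and x: "\<And>r. r \<le> Suc i \<Longrightarrow> x r \<in> H (k + l)"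
  shows "der l UNIV (\<lambda>e. md f k l 0 i h (x(0 := x 0 + e *\<^sub>R x (Suc i)))) 0 (md f k l 0 (Suc i) h x)"
proof -
  let ?v = "restrict (\<lambda>r. x (Suc r)) {..<Suc i}"
  have "restrict ?v {..<i} = restrict (\<lambda>r. x (Suc r)) {..<i}" by (auto simp: restrict_def)
  moreover have "?v i = x (Suc i)" by simp
  moreover have "\<And>e. md f k l 0 i h (x(0 := x 0 + e *\<^sub>R x (Suc i))) \<in> H l"
    using x h by (intro md_in) auto
  ultimately show ?thesis
    using md_facts[THEN conjunct2, THEN conjunct1, rule_format, OF h, of "x 0" k l ?v i] x
    by (auto simp: der_iff_tendsto htop_limitin_iff md_def)
qed

text \<open>All the families start from the flow, and each further member is a limit of difference
  quotients of an earlier one. Limits are unique even across levels, so induction on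
  \<open>i\<close> settles the case without time derivatives and induction on \<open>j\<close> the
  rest.\<close>

lemma md_consistent:
  assumes "j \<le> k" "j \<le> k'" "h \<in> I" "\<And>r. r \<le> i \<Longrightarrow> x r \<in> H (k + l)" "\<And>r. r \<le> i \<Longrightarrow> x r \<in> H (k' + l')"
  shows "md f k l j i h x = md f k' l' j i h x"
  using assms
proof (induction j arbitrary: h)
  case 0
  then show ?case
  proof (induction i arbitrary: x)
    case 0
    then show ?case by (simp add: md_flow)
  next
    case (Suc i)
    have "md f k l 0 i h (x(0 := x 0 + e *\<^sub>R x (Suc i))) = md f k' l' 0 i h (x(0 := x 0 + e *\<^sub>R x (Suc i)))" for e
      by (rule Suc.IH) (use Suc.prems in auto)
    then have "der l' UNIV (\<lambda>e. md f k l 0 i h (x(0 := x 0 + e *\<^sub>R x (Suc i)))) 0 (md f k' l' 0 (Suc i) h x)"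
      using md_space_0[of h i x k' l'] Suc.prems by simp
    then show ?case
      using md_space_0[of h i x k l] Suc.prems by (intro der_unique[of l UNIV _ 0 _ l']) (auto simp: islimpt_UNIV)
  qed
next
  case (Suc j)
  have "der l' I (\<lambda>h. md f k l j i h x) h (md f k' l' (Suc j) i h x)"
    by (rule der_cong[OF md_time]) (use Suc in auto)
  moreover have "der l I (\<lambda>h. md f k l j i h x) h (md f k l (Suc j) i h x)"
    by (rule md_time) (use Suc in auto)
  ultimately show ?case using islimpt_I[OF Suc.prems(3)] der_unique by blast
qed

end

text \<open>\<open>td f j i h x\<close> is \<open>\<partial>\<^sub>h\<^sup>j D\<^sub>u\<^sup>i f(h, x 0)[x 1, \<dots>, x i]\<close>; tuples are total functions, of which only
  the first entries matter.\<close>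

definition td :: "(real \<Rightarrow> 'a \<Rightarrow> 'a) \<Rightarrow> nat \<Rightarrow> nat \<Rightarrow> real \<Rightarrow> (nat \<Rightarrow> 'a) \<Rightarrow> 'a" where
  "td f j i = md f j 0 j i"

lemma td_cong: "(\<And>r. r \<le> i \<Longrightarrow> x r = y r) \<Longrightarrow> td f j i h x = td f j i h y"
  unfolding td_def by (rule md_cong)

context
  fixes f :: "real \<Rightarrow> 'a \<Rightarrow> 'a"
  assumes compat: "compatible T H ip f"
begin

text \<open>By consistency \<open>td\<close>, selected with target level 0, may be replaced by the
  selection for any \<open>k \<ge> j\<close> and any \<open>l\<close>. It thereby inherits values
  and continuity in \<open>H K\<close> from \<open>md f j K\<close>, at a cost of exactly
  \<open>j\<close> levels.\<close>

lemma td_md: "j \<le> k \<Longrightarrow> h \<in> I \<Longrightarrow> (\<And>r. r \<le> i \<Longrightarrow> x r \<in> H (k + l)) \<Longrightarrow> td f j i h x = md f k l j i h x"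
  unfolding td_def
  by (rule md_consistent[OF compat]) (auto intro: H_antimono[of j "k + l"])

lemma td_flow: "h \<in> I \<Longrightarrow> td f 0 0 h x = f h (x 0)"
  by (simp add: td_def md_flow[OF compat])

lemma td_cont:
  assumes h: "\<And>n. h n \<in> I" "h0 \<in> I" "h \<longlonglongrightarrow> h0"
    and X: "\<And>r. r \<le> i \<Longrightarrow> cv (K + j) (\<lambda>n. X n r) (x r)"
  shows "cv K (\<lambda>n. td f j i (h n) (X n)) (td f j i h0 x)"
proof -
  have X': "cv (j + K) (\<lambda>n. X n r) (x r)" if "r \<le> i" for r using X[OF that] by (simp add: add.commute)
  have "td f j i (h n) (X n) = md f j K j i (h n) (X n)" for n
    by (rule td_md) (use h cv_in[OF X'] in auto)
  moreover have "td f j i h0 x = md f j K j i h0 x"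
    by (rule td_md) (use h cv_in[OF X'] in auto)
  ultimately show ?thesis using md_cont[OF compat _ h X', of j] by simp
qed

lemma td_in: "h \<in> I \<Longrightarrow> (\<And>r. r \<le> i \<Longrightarrow> x r \<in> H (K + j)) \<Longrightarrow> td f j i h x \<in> H K"
  using td_cont[of "\<lambda>_. h" h i K j "\<lambda>_. x" x] by simp

lemma td_time:
  assumes h: "h \<in> I" and x: "\<And>r. r \<le> i \<Longrightarrow> x r \<in> H (K + Suc j)"
  shows "der K I (\<lambda>h. td f j i h x) h (td f (Suc j) i h x)"
proof -
  have x': "x r \<in> H (Suc j + K)" if "r \<le> i" for r using x[OF that] by (simp add: add.commute)
  have "td f (Suc j) i h x = md f (Suc j) K (Suc j) i h x"
    by (rule td_md) (use h x' in auto)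
  moreover have "der K I (\<lambda>h. td f j i h x) h (md f (Suc j) K (Suc j) i h x)"
    by (rule der_cong[OF md_time[OF compat]], use h x' in auto) (rule td_md[symmetric]; use x' in auto)
  ultimately show ?thesis by simp
qed

text \<open>Interchange of the derivatives in time and space: two applications of the mean value theorem
  bound the mixed second difference.\<close>

lemma td_space:
  assumes h: "h \<in> I" and x: "\<And>r. r \<le> Suc i \<Longrightarrow> x r \<in> H (K + j)"
  shows "der K UNIV (\<lambda>e. td f j i h (x(0 := x 0 + e *\<^sub>R x (Suc i)))) 0 (td f j (Suc i) h x)"
  using assms
proof (induction j arbitrary: h x)
  case 0
  then have x': "x r \<in> H (0 + K)" if "r \<le> Suc i" for r using that by simp
  have "td f 0 (Suc i) h x = md f 0 K 0 (Suc i) h x"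
    by (rule td_md) (use 0 x' in auto)
  moreover have "der K UNIV (\<lambda>e. td f 0 i h (x(0 := x 0 + e *\<^sub>R x (Suc i)))) 0 (md f 0 K 0 (Suc i) h x)"
    by (rule der_cong[OF md_space_0[OF compat]], use 0 x' in auto) (rule td_md[symmetric]; use 0 x' in auto)
  ultimately show ?case by (simp only:)
next
  case (Suc j)
  define w where "w e = x(0 := x 0 + e *\<^sub>R x (Suc i))" for e
  have w: "w e r \<in> H (K + Suc j)" if "r \<le> Suc i" for e r using that Suc.prems by (auto simp: w_def)
  then have w': "w e r \<in> H (K + j)" if "r \<le> Suc i" for e r
    using that H_antimono[of "K + j" "K + Suc j"] by simp
  define R where "R = td f (Suc j) (Suc i) h x"
  have w0: "w 0 = x" by (auto simp: w_def)
  have R: "R \<in> H K" unfolding R_def using Suc.prems by (intro td_in) auto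
  have dw: "der K UNIV (\<lambda>e. td f j i h' (w e)) e (td f j (Suc i) h' (w e))" if "h' \<in> I" for h' e
  proof -
    have eq: "(w e)(0 := w e 0 + e' *\<^sub>R w e (Suc i)) = w (e + e')" for e'
      by (auto simp: w_def scaleR_add_left add.assoc)
    then show ?thesis
      using Suc.IH[of h' "w e", OF that w'] by (simp only: eq der_shift[of K "\<lambda>e. td f j i h' (w e)"])
  qed
  have inner: "\<exists>\<xi> \<eta>. \<bar>\<xi>\<bar> \<le> \<bar>e\<bar> \<and> \<eta> \<in> closed_segment h h' \<and>
      N K ((td f j i h' (w e) - td f j i h (w e)) - (td f j i h' (w 0) - td f j i h (w 0)) - (e * (h' - h)) *\<^sub>R R)
      \<le> \<bar>e * (h' - h)\<bar> * N K (td f (Suc j) (Suc i) \<eta> (w \<xi>) - R)" if h': "h' \<in> I" for e h'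
  proof -
    have "\<exists>\<xi>\<in>closed_segment 0 e. N K ((td f j i h' (w e) - td f j i h (w e)) - (td f j i h' (w 0) - td f j i h (w 0)) - (e - 0) *\<^sub>R ((h' - h) *\<^sub>R R))
      \<le> \<bar>e - 0\<bar> * N K ((td f j (Suc i) h' (w \<xi>) - td f j (Suc i) h (w \<xi>)) - (h' - h) *\<^sub>R R)"
      by (rule mean_value[of 0 e UNIV]) (use R h' Suc.prems(1) in \<open>auto intro!: der_diff dw\<close>)
    then obtain \<xi> where \<xi>: "\<xi> \<in> closed_segment 0 e"
      "N K ((td f j i h' (w e) - td f j i h (w e)) - (td f j i h' (w 0) - td f j i h (w 0)) - (e * (h' - h)) *\<^sub>R R)
      \<le> \<bar>e\<bar> * N K ((td f j (Suc i) h' (w \<xi>) - td f j (Suc i) h (w \<xi>)) - (h' - h) *\<^sub>R R)"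
      by auto
    have seg: "closed_segment h h' \<subseteq> I"
      using h' Suc.prems(1) by (auto simp: closed_segment_eq_real_ivl split: if_splits)
    have "\<exists>\<eta>\<in>closed_segment h h'. N K (td f j (Suc i) h' (w \<xi>) - td f j (Suc i) h (w \<xi>) - (h' - h) *\<^sub>R R)
      \<le> \<bar>h' - h\<bar> * N K (td f (Suc j) (Suc i) \<eta> (w \<xi>) - R)"
      by (rule mean_value[OF seg]) (use R seg w in \<open>auto intro!: td_time\<close>)
    then obtain \<eta> where \<eta>: "\<eta> \<in> closed_segment h h'" 
      "N K (td f j (Suc i) h' (w \<xi>) - td f j (Suc i) h (w \<xi>) - (h' - h) *\<^sub>R R)
      \<le> \<bar>h' - h\<bar> * N K (td f (Suc j) (Suc i) \<eta> (w \<xi>) - R)" by blast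
    have "\<bar>\<xi>\<bar> \<le> \<bar>e\<bar>" using \<xi>(1) by (auto simp: closed_segment_eq_real_ivl split: if_splits)
    moreover have "\<bar>e\<bar> * N K ((td f j (Suc i) h' (w \<xi>) - td f j (Suc i) h (w \<xi>)) - (h' - h) *\<^sub>R R)
        \<le> \<bar>e * (h' - h)\<bar> * N K (td f (Suc j) (Suc i) \<eta> (w \<xi>) - R)"
      using mult_left_mono[OF \<eta>(2), of "\<bar>e\<bar>"] by (simp add: abs_mult mult.assoc)
    ultimately show ?thesis using \<xi>(2) \<eta>(1) by (meson order_trans)
  qed
  define P where "P e = td f (Suc j) i h (w e)" for e
  have dP: "der K I (\<lambda>h. td f j i h (w e)) h (P e)" for e
    unfolding P_def by (rule td_time) (use Suc.prems w in auto)
  have P: "P e \<in> H K" for e using derD(3)[OF dP] .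
  have "der K UNIV P 0 R"
  proof (rule derI)
    fix \<sigma> :: "nat \<Rightarrow> real" assume \<sigma>: "\<And>n. \<sigma> n \<noteq> 0" "\<sigma> \<longlonglongrightarrow> 0"
    let ?Q = "\<lambda>n h'. (1 / (h' - h)) *\<^sub>R ((td f j i h' (w (\<sigma> n)) - td f j i h' (w 0)) - (td f j i h (w (\<sigma> n)) - td f j i h (w 0)))"
    \<comment> \<open>For each increment \<open>\<sigma> n\<close> the time \<open>h'\<close> is
      chosen so near \<open>h\<close> that replacing the time derivative by its difference quotient
      costs less than \<open>\<bar>\<sigma> n\<bar>\<close> divided by \<open>Suc n\<close>. The
      error then remains null after the division by \<open>\<sigma> n\<close>.\<close>
    have "\<exists>h'. h' \<in> I \<and> h' \<noteq> h \<and> \<bar>h' - h\<bar> < inverse (real (Suc n)) \<and>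
        N K (?Q n h' - (P (\<sigma> n) - P 0)) < \<bar>\<sigma> n\<bar> * inverse (real (Suc n))" for n
    proof -
      have "der K I (\<lambda>h. td f j i h (w (\<sigma> n)) - td f j i h (w 0)) h (P (\<sigma> n) - P 0)"
        by (intro der_diff dP)
      moreover obtain \<tau> where \<tau>: "\<And>m. \<tau> m \<in> I" "\<And>m. \<tau> m \<noteq> h" "\<tau> \<longlonglongrightarrow> h"
        using islimpt_I[OF Suc.prems(1)] unfolding islimpt_sequential by blast
      ultimately have "cv K (\<lambda>m. ?Q n (\<tau> m)) (P (\<sigma> n) - P 0)" by (rule derD(4))
      then have "(\<lambda>m. N K (?Q n (\<tau> m) - (P (\<sigma> n) - P 0))) \<longlonglongrightarrow> 0" by (simp add: cv_def)
      then have "eventually (\<lambda>m. N K (?Q n (\<tau> m) - (P (\<sigma> n) - P 0)) < \<bar>\<sigma> n\<bar> * inverse (real (Suc n))) sequentially"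
        by (rule order_tendstoD) (use \<sigma>(1)[of n] in auto)
      moreover have "eventually (\<lambda>m. dist (\<tau> m) h < inverse (real (Suc n))) sequentially"
        using \<tau>(3) by (rule tendstoD) simp
      ultimately have "eventually (\<lambda>m. \<bar>\<tau> m - h\<bar> < inverse (real (Suc n)) \<and> N K (?Q n (\<tau> m) - (P (\<sigma> n) - P 0)) < \<bar>\<sigma> n\<bar> * inverse (real (Suc n))) sequentially"
        by eventually_elim (simp add: dist_real_def)
      then obtain m where "\<bar>\<tau> m - h\<bar> < inverse (real (Suc n)) \<and> N K (?Q n (\<tau> m) - (P (\<sigma> n) - P 0)) < \<bar>\<sigma> n\<bar> * inverse (real (Suc n))"
        by (auto dest: eventually_happens)
      then show ?thesis using \<tau>(1,2)[of m] by blast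
    qed
    then obtain hh where hh: "\<And>n. hh n \<in> I" "\<And>n. hh n \<noteq> h" "\<And>n. \<bar>hh n - h\<bar> < inverse (real (Suc n))"
      "\<And>n. N K (?Q n (hh n) - (P (\<sigma> n) - P 0)) < \<bar>\<sigma> n\<bar> * inverse (real (Suc n))" by metis
    have "\<exists>\<xi> \<eta>. \<bar>\<xi>\<bar> \<le> \<bar>\<sigma> n\<bar> \<and> \<eta> \<in> closed_segment h (hh n) \<and>
      N K ((td f j i (hh n) (w (\<sigma> n)) - td f j i h (w (\<sigma> n))) - (td f j i (hh n) (w 0) - td f j i h (w 0)) - (\<sigma> n * (hh n - h)) *\<^sub>R R)
      \<le> \<bar>\<sigma> n * (hh n - h)\<bar> * N K (td f (Suc j) (Suc i) \<eta> (w \<xi>) - R)" for n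
      by (rule inner[OF hh(1)])
    then obtain \<xi> \<eta> where \<xi>: "\<And>n. \<bar>\<xi> n\<bar> \<le> \<bar>\<sigma> n\<bar>" and \<eta>: "\<And>n. \<eta> n \<in> closed_segment h (hh n)"
      and le: "\<And>n. N K ((td f j i (hh n) (w (\<sigma> n)) - td f j i h (w (\<sigma> n))) - (td f j i (hh n) (w 0) - td f j i h (w 0)) - (\<sigma> n * (hh n - h)) *\<^sub>R R)
      \<le> \<bar>\<sigma> n * (hh n - h)\<bar> * N K (td f (Suc j) (Suc i) (\<eta> n) (w (\<xi> n)) - R)" by metis
    have \<xi>0: "\<xi> \<longlonglongrightarrow> 0"
      by (rule Lim_null_comparison[OF _ tendsto_rabs_zero[OF \<sigma>(2)]]) (simp add: \<xi>)
    have "\<bar>\<eta> n - h\<bar> \<le> inverse (real (Suc n))" for n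
      using \<eta>[of n] hh(3)[of n] by (auto simp: closed_segment_eq_real_ivl split: if_splits)
    then have "(\<lambda>n. \<eta> n - h) \<longlonglongrightarrow> 0"
      by (intro Lim_null_comparison[OF _ LIMSEQ_inverse_real_of_nat]) simp
    then have \<eta>0: "\<eta> \<longlonglongrightarrow> h" by (rule LIM_zero_cancel)
    have \<eta>I: "\<eta> n \<in> I" for n
      using \<eta>[of n] hh(1)[of n] Suc.prems(1) by (auto simp: closed_segment_eq_real_ivl split: if_splits)
    have cw: "cv (K + Suc j) (\<lambda>n. w (\<xi> n) r) (x r)" if "r \<le> Suc i" for r
    proof (cases "r = 0")
      case True
      have "cv (K + Suc j) (\<lambda>n. x 0 + \<xi> n *\<^sub>R x (Suc i)) (x 0 + 0 *\<^sub>R x (Suc i))"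
        using Suc.prems(2)[of 0] Suc.prems(2)[of "Suc i"] by (intro cv_add cv_scale[OF _ \<xi>0]) auto
      then show ?thesis using True by (simp add: w_def)
    next
      case False
      then show ?thesis using Suc.prems(2)[OF that] by (simp add: w_def)
    qed
    have lim: "cv K (\<lambda>n. td f (Suc j) (Suc i) (\<eta> n) (w (\<xi> n))) R"
      unfolding R_def by (rule td_cont[OF \<eta>I Suc.prems(1) \<eta>0 cw])
    show "cv K (\<lambda>n. (1 / (\<sigma> n - 0)) *\<^sub>R (P (\<sigma> n) - P 0)) R"
    proof (rule cv_bound[OF _ R])
      show "(1 / (\<sigma> n - 0)) *\<^sub>R (P (\<sigma> n) - P 0) \<in> H K" for n using P by auto
      have "(\<lambda>n. N K (td f (Suc j) (Suc i) (\<eta> n) (w (\<xi> n)) - R)) \<longlonglongrightarrow> 0"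
        using lim by (simp add: cv_def)
      then show "(\<lambda>n. inverse (real (Suc n)) + N K (td f (Suc j) (Suc i) (\<eta> n) (w (\<xi> n)) - R)) \<longlonglongrightarrow> 0"
        using tendsto_add[OF LIMSEQ_inverse_real_of_nat] by force
      fix n
      let ?D = "(td f j i (hh n) (w (\<sigma> n)) - td f j i h (w (\<sigma> n))) - (td f j i (hh n) (w 0) - td f j i h (w 0))"
      let ?p = "P (\<sigma> n) - P 0" and ?Z = "td f (Suc j) (Suc i) (\<eta> n) (w (\<xi> n))"
      have D: "?D \<in> H K" using td_in[OF _ w'] hh(1) Suc.prems(1) by (intro H_diff) auto
      have p: "?p \<in> H K" using P by auto
      have Q: "?Q n (hh n) = (1 / (hh n - h)) *\<^sub>R ?D" by (simp add: algebra_simps)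
      have q: "N K (?Q n (hh n) - \<sigma> n *\<^sub>R R) \<le> \<bar>\<sigma> n\<bar> * N K (?Z - R)"
      proof -
        have "?Q n (hh n) - \<sigma> n *\<^sub>R R = (1 / (hh n - h)) *\<^sub>R (?D - (\<sigma> n * (hh n - h)) *\<^sub>R R)"
          unfolding Q scaleR_diff_right using hh(2)[of n] by simp
        then have "N K (?Q n (hh n) - \<sigma> n *\<^sub>R R) = \<bar>1 / (hh n - h)\<bar> * N K (?D - (\<sigma> n * (hh n - h)) *\<^sub>R R)"
          using N_scale[of "?D - (\<sigma> n * (hh n - h)) *\<^sub>R R" K "1 / (hh n - h)"] D R by simp
        also have "\<dots> \<le> \<bar>1 / (hh n - h)\<bar> * (\<bar>\<sigma> n * (hh n - h)\<bar> * N K (?Z - R))"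
          by (intro mult_left_mono le) simp
        also have "\<dots> = \<bar>\<sigma> n\<bar> * N K (?Z - R)" using hh(2)[of n] by (simp add: abs_mult)
        finally show ?thesis .
      qed
      have Qm: "?Q n (hh n) \<in> H K" unfolding Q using D by blast
      have "N K (?p - \<sigma> n *\<^sub>R R) \<le> N K (?p - ?Q n (hh n)) + N K (?Q n (hh n) - \<sigma> n *\<^sub>R R)"
        using N_triangle[of "?p - ?Q n (hh n)" K "?Q n (hh n) - \<sigma> n *\<^sub>R R"] p Qm R by simp
      also have "N K (?p - ?Q n (hh n)) = N K (?Q n (hh n) - ?p)" by (rule N_minus[OF p Qm])
      finally have b: "N K (?p - \<sigma> n *\<^sub>R R) \<le> \<bar>\<sigma> n\<bar> * (inverse (real (Suc n)) + N K (?Z - R))"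
        using hh(4)[of n] q unfolding distrib_left by linarith
      have "(1 / (\<sigma> n - 0)) *\<^sub>R ?p - R = (1 / \<sigma> n) *\<^sub>R (?p - \<sigma> n *\<^sub>R R)"
        using \<sigma>(1)[of n] by (simp add: scaleR_diff_right)
      then have "N K ((1 / (\<sigma> n - 0)) *\<^sub>R ?p - R) = \<bar>1 / \<sigma> n\<bar> * N K (?p - \<sigma> n *\<^sub>R R)"
        using N_scale[of "?p - \<sigma> n *\<^sub>R R" K "1 / \<sigma> n"] p R by simp
      also have "\<dots> \<le> \<bar>1 / \<sigma> n\<bar> * (\<bar>\<sigma> n\<bar> * (inverse (real (Suc n)) + N K (?Z - R)))"
        by (intro mult_left_mono b) simp
      also have "\<dots> = inverse (real (Suc n)) + N K (?Z - R)" using \<sigma>(1)[of n] by simp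
      finally show "N K ((1 / (\<sigma> n - 0)) *\<^sub>R ?p - R) \<le> inverse (real (Suc n)) + N K (?Z - R)" .
    qed
  qed (use P R in auto)
  then show ?case unfolding P_def[abs_def] w_def R_def .
qed

end

lemma mean_value_sequence:
  assumes d: "\<And>n t. der k UNIV (f n) t (f' n t)" and V: "V \<in> H k" and \<tau>: "\<tau> \<longlonglongrightarrow> 0"
  obtains \<xi> where "\<xi> \<longlonglongrightarrow> 0"
    "\<And>n. N k (f n (\<tau> n) - f n 0 - \<tau> n *\<^sub>R V) \<le> \<bar>\<tau> n\<bar> * N k (f' n (\<xi> n) - V)"
proof -
  have "\<exists>\<xi>. \<xi> \<in> closed_segment 0 (\<tau> n) \<and>
      N k (f n (\<tau> n) - f n 0 - \<tau> n *\<^sub>R V) \<le> \<bar>\<tau> n\<bar> * N k (f' n \<xi> - V)" for n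
    using mean_value[of 0 "\<tau> n" UNIV k "f n" "f' n" V, OF subset_UNIV d V]
    unfolding diff_0_right Bex_def .
  then obtain \<xi> where \<xi>: "\<And>n. \<xi> n \<in> closed_segment 0 (\<tau> n)"
    "\<And>n. N k (f n (\<tau> n) - f n 0 - \<tau> n *\<^sub>R V) \<le> \<bar>\<tau> n\<bar> * N k (f' n (\<xi> n) - V)"
    by metis
  have "norm (\<xi> n) \<le> \<bar>\<tau> n\<bar>" for n
    using \<xi>(1)[of n] by (auto simp: closed_segment_eq_real_ivl split: if_splits)
  then have "\<xi> \<longlonglongrightarrow> 0"
    by (intro Lim_null_comparison[OF _ tendsto_rabs_zero[OF \<tau>]] always_eventually allI)
  then show ?thesis using \<xi>(2) that by blast
qed

lemma der_affine: "p \<in> H k \<Longrightarrow> q \<in> H k \<Longrightarrow> der k UNIV (\<lambda>t. p + t *\<^sub>R q) t q"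
  by (rule derI) (auto simp: scaleR_diff_left[symmetric])

section \<open>Multilinearity and the derivative in all entries of a tuple\<close>

context
  fixes f :: "real \<Rightarrow> 'a \<Rightarrow> 'a"
  assumes compat: "compatible T H ip f"
begin

text \<open>For an earlier slot, linearity passes through the limit that defines the last
  derivative. For the last slot it comes from the continuity of the directional derivative in the
  point: the derivative along the combined direction is computed by moving along its two summands
  simultaneously. The identity holds between vectors, so the norm of \<open>H 0\<close> suffices to
  prove it.\<close>

lemma td_linear_0:
  assumes h: "h \<in> I" and r: "r < i"
  shows "td f 0 i h (x(Suc r := a + c *\<^sub>R b)) = td f 0 i h (x(Suc r := a)) + c *\<^sub>R td f 0 i h (x(Suc r := b))"
  using r
proof (induction i arbitrary: x)
  case 0
  then show ?case by simp
next
  case (Suc i)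
  show ?case
  proof (cases "r < i")
    case True
    define y where "y e = x(0 := x 0 + e *\<^sub>R x (Suc i))" for e
    have D: "der 0 UNIV (\<lambda>e. td f 0 i h ((y e)(Suc r := q))) 0 (td f 0 (Suc i) h (x(Suc r := q)))" for q
    proof -
      have eq: "(x(Suc r := q))(0 := (x(Suc r := q)) 0 + e *\<^sub>R (x(Suc r := q)) (Suc i)) = (y e)(Suc r := q)" for e
        using True by (auto simp: y_def)
      show ?thesis
        using td_space[OF compat h, of i "x(Suc r := q)" 0 0] unfolding eq by simp
    qed
    have "der 0 UNIV (\<lambda>e. td f 0 i h ((y e)(Suc r := a + c *\<^sub>R b))) 0
        (td f 0 (Suc i) h (x(Suc r := a)) + c *\<^sub>R td f 0 (Suc i) h (x(Suc r := b)))"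
      by (rule der_cong[OF der_add[OF D der_scaleR[OF D]]]) (rule Suc.IH[OF True, symmetric])
    with D show ?thesis by (rule der_unique) (simp add: islimpt_UNIV)
  next
    case False
    with Suc.prems have r: "r = i" by simp
    define g where "g u = td f 0 i h (x(0 := u))" for u
    define \<delta> where "\<delta> u q = td f 0 (Suc i) h (x(0 := u, Suc i := q))" for u q
    have D: "der 0 UNIV (\<lambda>e. g (u + e *\<^sub>R q)) 0 (\<delta> u q)" for u q
    proof (rule der_cong)
      show "der 0 UNIV (\<lambda>e. td f 0 i h ((x(0 := u, Suc i := q))(0 := (x(0 := u, Suc i := q)) 0
          + e *\<^sub>R (x(0 := u, Suc i := q)) (Suc i)))) 0 (\<delta> u q)"
        unfolding \<delta>_def by (rule td_space[OF compat h]) simp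
    qed (auto simp: g_def intro!: td_cong)
    have D': "der 0 UNIV (\<lambda>t. g (u + (c * t) *\<^sub>R q)) t (c *\<^sub>R \<delta> (u + (c * t) *\<^sub>R q) q)" for u q t
    proof (rule der_time_scale)
      have eq: "u + (c * t) *\<^sub>R q + e *\<^sub>R q = u + (c * t + e) *\<^sub>R q" for e
        by (simp add: algebra_simps)
      show "der 0 UNIV (\<lambda>t. g (u + t *\<^sub>R q)) (c * t) (\<delta> (u + (c * t) *\<^sub>R q) q)"
        using D[of "u + (c * t) *\<^sub>R q" q] unfolding eq der_shift[of 0 "\<lambda>t. g (u + t *\<^sub>R q)" "c * t"] .
    qed auto
    have "der 0 UNIV (\<lambda>e. g (x 0 + e *\<^sub>R a + (c * e) *\<^sub>R b)) 0 (\<delta> (x 0) a + c *\<^sub>R \<delta> (x 0 + 0 *\<^sub>R a + (c * 0) *\<^sub>R b) b)"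
    proof (rule der_diagonal[where G = "\<lambda>e t. g (x 0 + e *\<^sub>R a + (c * t) *\<^sub>R b)"
          and dG = "\<lambda>e t. c *\<^sub>R \<delta> (x 0 + e *\<^sub>R a + (c * t) *\<^sub>R b) b", OF D'])
      fix e t :: "nat \<Rightarrow> real" assume et: "e \<longlonglongrightarrow> 0" "t \<longlonglongrightarrow> 0"
      have u: "(\<lambda>n. x 0 + e n *\<^sub>R a + (c * t n) *\<^sub>R b) \<longlonglongrightarrow> x 0 + 0 *\<^sub>R a + (c * 0) *\<^sub>R b"
        by (intro tendsto_intros et)
      show "cv 0 (\<lambda>n. c *\<^sub>R \<delta> (x 0 + e n *\<^sub>R a + (c * t n) *\<^sub>R b) b) (c *\<^sub>R \<delta> (x 0 + 0 *\<^sub>R a + (c * 0) *\<^sub>R b) b)"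
        unfolding \<delta>_def
      proof (intro cv_scaleR td_cont[OF compat])
        fix q show "cv (0 + 0) (\<lambda>n. (x(0 := x 0 + e n *\<^sub>R a + (c * t n) *\<^sub>R b, Suc i := b)) q)
            ((x(0 := x 0 + 0 *\<^sub>R a + (c * 0) *\<^sub>R b, Suc i := b)) q)"
          using u by (cases "q = 0") (auto simp: cv_0)
      qed (use h in auto)
    next
      show "der 0 UNIV (\<lambda>e. g (x 0 + e *\<^sub>R a + (c * 0) *\<^sub>R b)) 0 (\<delta> (x 0) a)"
        using D[of "x 0" a] by simp
    qed
    moreover have "x 0 + e *\<^sub>R a + (c * e) *\<^sub>R b = x 0 + e *\<^sub>R (a + c *\<^sub>R b)" for e
      by (simp add: algebra_simps)
    ultimately have "der 0 UNIV (\<lambda>e. g (x 0 + e *\<^sub>R (a + c *\<^sub>R b))) 0 (\<delta> (x 0) a + c *\<^sub>R \<delta> (x 0) b)"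
      by simp
    with D have "\<delta> (x 0) (a + c *\<^sub>R b) = \<delta> (x 0) a + c *\<^sub>R \<delta> (x 0) b"
      by (rule der_unique) (simp add: islimpt_UNIV)
    then show ?thesis unfolding \<delta>_def r fun_upd_triv .
  qed
qed

text \<open>Differentiating the identity in time raises \<open>j\<close>; the two sides are again
  compared in \<open>H 0\<close>, so the entries are required in \<open>H j\<close> and no
  higher.\<close>

lemma td_linear:
  assumes "h \<in> I" "r < i" "\<And>q. q \<le> i \<Longrightarrow> x q \<in> H j" "a \<in> H j" "b \<in> H j"
  shows "td f j i h (x(Suc r := a + c *\<^sub>R b)) = td f j i h (x(Suc r := a)) + c *\<^sub>R td f j i h (x(Suc r := b))"
  using assms
proof (induction j arbitrary: h)
  case 0
  show ?case by (rule td_linear_0[OF 0(1,2)])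
next
  case (Suc j)
  have D: "der 0 I (\<lambda>h. td f j i h (x(Suc r := q))) h (td f (Suc j) i h (x(Suc r := q)))" if "q \<in> H (Suc j)" for q
    using that Suc.prems by (intro td_time[OF compat]) auto
  have m: "\<And>q. q \<le> i \<Longrightarrow> x q \<in> H j" "a \<in> H j" "b \<in> H j"
    using Suc.prems by (auto intro: H_antimono[of j "Suc j"])
  have "der 0 I (\<lambda>h. td f j i h (x(Suc r := a + c *\<^sub>R b))) h
      (td f (Suc j) i h (x(Suc r := a)) + c *\<^sub>R td f (Suc j) i h (x(Suc r := b)))"
  proof (rule der_cong[OF der_add[OF D[OF Suc.prems(4)] der_scaleR[OF D[OF Suc.prems(5)]]]])
    fix s assume "s \<in> I"
    then show "td f j i s (x(Suc r := a)) + c *\<^sub>R td f j i s (x(Suc r := b)) = td f j i s (x(Suc r := a + c *\<^sub>R b))"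
      by (rule Suc.IH[symmetric]) (use Suc.prems m in auto)
  qed
  moreover have "der 0 I (\<lambda>h. td f j i h (x(Suc r := a + c *\<^sub>R b))) h (td f (Suc j) i h (x(Suc r := a + c *\<^sub>R b)))"
    by (rule D) (use Suc.prems in auto)
  ultimately show ?case using der_unique[OF _ _ islimpt_I[OF Suc.prems(1)]] by metis
qed

text \<open>The entries are set in motion one at a time with \<open>der_diagonal\<close>. Moving the
  point contributes a further derivative whose new direction \<open>y 0\<close> stands in entry
  \<open>Suc i\<close>; moving a direction contributes, by linearity, the same derivative with that
  direction replaced.\<close>

lemma td_total_aux:
  assumes h: "h \<in> I" and x: "\<And>r. r \<le> i \<Longrightarrow> x r \<in> H (K + j)" and y: "\<And>r. r \<le> i \<Longrightarrow> y r \<in> H (K + j)"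
    and n: "n \<le> i"
  shows "der K UNIV (\<lambda>e. td f j i h (\<lambda>r. if r \<le> n then x r + e *\<^sub>R y r else x r)) 0
    (td f j (Suc i) h (\<lambda>r. if r \<le> i then x r else y 0) + (\<Sum>r<n. td f j i h (x(Suc r := y (Suc r)))))"
  using n
proof (induction n)
  case 0
  have "der K UNIV (\<lambda>e. td f j i h (\<lambda>r. if r \<le> 0 then x r + e *\<^sub>R y r else x r)) 0
      (td f j (Suc i) h (\<lambda>r. if r \<le> i then x r else y 0))"
  proof (rule der_cong)
    show "der K UNIV (\<lambda>e. td f j i h ((\<lambda>r. if r \<le> i then x r else y 0)(0 := (if 0 \<le> i then x 0 else y 0)
        + e *\<^sub>R (if Suc i \<le> i then x (Suc i) else y 0)))) 0 (td f j (Suc i) h (\<lambda>r. if r \<le> i then x r else y 0))"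
      by (rule td_space[OF compat h]) (use x y in auto)
  qed (auto intro!: td_cong)
  then show ?case by simp
next
  case (Suc n)
  let ?z = "\<lambda>e r. if r \<le> n then x r + e *\<^sub>R y r else x r"
  let ?G = "\<lambda>e t. td f j i h ((?z e)(Suc n := x (Suc n) + t *\<^sub>R y (Suc n)))"
  let ?dG = "\<lambda>e (t::real). td f j i h ((?z e)(Suc n := y (Suc n)))"
  have z: "?z e r \<in> H (K + j)" if "r \<le> i" for e r using x y that by auto
  then have zj: "?z e r \<in> H j" if "r \<le> i" for e r using that H_antimono[of j "K + j"] by simp
  have xj: "x (Suc n) \<in> H j" "y (Suc n) \<in> H j"
    using x y Suc.prems H_antimono[of j "K + j"] by auto
  have "der K UNIV (\<lambda>e. ?G e e) 0
     ((td f j (Suc i) h (\<lambda>r. if r \<le> i then x r else y 0) + (\<Sum>r<n. td f j i h (x(Suc r := y (Suc r))))) + ?dG 0 0)"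
  proof (rule der_diagonal[where G = ?G and dG = ?dG])
    fix e t
    have "der K UNIV (\<lambda>t. td f j i h ((?z e)(Suc n := x (Suc n))) + t *\<^sub>R ?dG e t) t (?dG e t)"
      by (intro der_affine td_in[OF compat h]) (use z x y Suc.prems in auto)
    then show "der K UNIV (?G e) t (?dG e t)"
    proof (rule der_cong)
      fix s show "td f j i h ((?z e)(Suc n := x (Suc n))) + s *\<^sub>R td f j i h ((?z e)(Suc n := y (Suc n))) = ?G e s"
        by (rule td_linear[symmetric]) (use h zj xj Suc.prems in auto)
    qed
  next
    fix e t :: "nat \<Rightarrow> real" assume e: "e \<longlonglongrightarrow> 0"
    show "cv K (\<lambda>m. ?dG (e m) (t m)) (?dG 0 0)"
    proof (rule td_cont[OF compat])
      fix r assume r: "r \<le> i"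
      have "cv (K + j) (\<lambda>m. x r + e m *\<^sub>R y r) (x r + 0 *\<^sub>R y r)"
        using x[OF r] y[OF r] by (intro cv_add cv_scale[OF _ e]) auto
      then show "cv (K + j) (\<lambda>m. ((?z (e m))(Suc n := y (Suc n))) r) (((?z 0)(Suc n := y (Suc n))) r)"
        using x[OF r] y[OF r] by auto
    qed (use h in auto)
  next
    have z0: "((?z e)(Suc n := x (Suc n) + 0 *\<^sub>R y (Suc n))) = ?z e" for e by auto
    show "der K UNIV (\<lambda>e. ?G e 0) 0 (td f j (Suc i) h (\<lambda>r. if r \<le> i then x r else y 0) + (\<Sum>r<n. td f j i h (x(Suc r := y (Suc r)))))"
      unfolding z0 by (rule Suc.IH) (use Suc.prems in simp)
  qed
  moreover have "(?z e)(Suc n := x (Suc n) + e *\<^sub>R y (Suc n)) = (\<lambda>r. if r \<le> Suc n then x r + e *\<^sub>R y r else x r)" for e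
    by (auto simp: le_Suc_eq)
  moreover have "(?z 0)(Suc n := y (Suc n)) = x(Suc n := y (Suc n))" by auto
  ultimately show ?case by (simp only: sum.lessThan_Suc add.assoc)
qed

lemma td_total:
  assumes h: "h \<in> I" and x: "\<And>r. r \<le> i \<Longrightarrow> x r \<in> H (K + j)" and y: "\<And>r. r \<le> i \<Longrightarrow> y r \<in> H (K + j)"
  shows "der K UNIV (\<lambda>e. td f j i h (\<lambda>r. x r + e *\<^sub>R y r)) 0
    (td f j (Suc i) h (\<lambda>r. if r \<le> i then x r else y 0) + (\<Sum>r<i. td f j i h (x(Suc r := y (Suc r)))))"
  by (rule der_cong[OF td_total_aux[OF assms order_refl]]) (auto intro!: td_cong)

end

section \<open>Calculus for maps of infinite tuples\<close>

definition mix :: "(nat \<Rightarrow> 'a) \<Rightarrow> (nat \<Rightarrow> 'a) \<Rightarrow> nat \<Rightarrow> 'a" where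
  "mix x y = (\<lambda>i. if even i then x (i div 2) else y (i div 2))"

lemma mix_simps [simp]: "mix x y (2 * i) = x i" "mix x y (Suc (2 * i)) = y i"
  by (simp_all add: mix_def)

text \<open>Convergence is required entry by entry, without uniformity in the index, and for all
  target levels \<open>K\<close> of one and the same map; \<open>l\<close> is the number of levels
  that the map loses.\<close>

definition seq_cont :: "nat \<Rightarrow> (real \<Rightarrow> (nat \<Rightarrow> 'a) \<Rightarrow> 'a) \<Rightarrow> bool" where
  "seq_cont l G \<longleftrightarrow> (\<forall>K h h0 X x. (\<forall>n. h n \<in> I) \<longrightarrow> h0 \<in> I \<longrightarrow> h \<longlonglongrightarrow> h0 \<longrightarrow>
     (\<forall>i. cv (K + l) (\<lambda>n. X n i) (x i)) \<longrightarrow> cv K (\<lambda>n. G (h n) (X n)) (G h0 x))"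

definition space_der :: "nat \<Rightarrow> (real \<Rightarrow> (nat \<Rightarrow> 'a) \<Rightarrow> 'a) \<Rightarrow> (real \<Rightarrow> (nat \<Rightarrow> 'a) \<Rightarrow> 'a) \<Rightarrow> bool" where
  "space_der l G G' \<longleftrightarrow> (\<forall>K h x y. h \<in> I \<longrightarrow> (\<forall>i. x i \<in> H (K + l)) \<longrightarrow> (\<forall>i. y i \<in> H (K + l)) \<longrightarrow>
     der K UNIV (\<lambda>e. G h (\<lambda>i. x i + e *\<^sub>R y i)) 0 (G' h (mix x y)))"

definition time_der :: "nat \<Rightarrow> (real \<Rightarrow> (nat \<Rightarrow> 'a) \<Rightarrow> 'a) \<Rightarrow> (real \<Rightarrow> (nat \<Rightarrow> 'a) \<Rightarrow> 'a) \<Rightarrow> bool" where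
  "time_der l G G' \<longleftrightarrow> (\<forall>K h x. h \<in> I \<longrightarrow> (\<forall>i. x i \<in> H (K + Suc l)) \<longrightarrow> der K I (\<lambda>h. G h x) h (G' h x))"

lemma seq_contD:
  "seq_cont l G \<Longrightarrow> (\<And>n. h n \<in> I) \<Longrightarrow> h0 \<in> I \<Longrightarrow> h \<longlonglongrightarrow> h0 \<Longrightarrow>
     (\<And>i. cv (K + l) (\<lambda>n. X n i) (x i)) \<Longrightarrow> cv K (\<lambda>n. G (h n) (X n)) (G h0 x)"
  unfolding seq_cont_def by blast

lemma seq_cont_in: "seq_cont l G \<Longrightarrow> h \<in> I \<Longrightarrow> (\<And>i. x i \<in> H (K + l)) \<Longrightarrow> G h x \<in> H K"
  using seq_contD[of l G "\<lambda>_. h" h K "\<lambda>_. x" x] by simp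

lemma space_derD:
  "space_der l G G' \<Longrightarrow> h \<in> I \<Longrightarrow> (\<And>i. x i \<in> H (K + l)) \<Longrightarrow> (\<And>i. y i \<in> H (K + l)) \<Longrightarrow>
     der K UNIV (\<lambda>e. G h (\<lambda>i. x i + e *\<^sub>R y i)) 0 (G' h (mix x y))"
  unfolding space_der_def by blast

lemma time_derD:
  "time_der l G G' \<Longrightarrow> h \<in> I \<Longrightarrow> (\<And>i. x i \<in> H (K + Suc l)) \<Longrightarrow> der K I (\<lambda>h. G h x) h (G' h x)"
  unfolding time_der_def by blast

lemma space_der_line:
  assumes "space_der l G G'" "h \<in> I" "\<And>i. x i \<in> H (K + l)" "\<And>i. y i \<in> H (K + l)"
  shows "der K UNIV (\<lambda>e. G h (\<lambda>i. x i + e *\<^sub>R y i)) e (G' h (mix (\<lambda>i. x i + e *\<^sub>R y i) y))"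
proof -
  have "der K UNIV (\<lambda>e'. G h (\<lambda>i. (x i + e *\<^sub>R y i) + e' *\<^sub>R y i)) 0 (G' h (mix (\<lambda>i. x i + e *\<^sub>R y i) y))"
    by (rule space_derD) (use assms in auto)
  moreover have "x i + e *\<^sub>R y i + e' *\<^sub>R y i = x i + (e + e') *\<^sub>R y i" for e' i
    by (simp add: scaleR_add_left)
  ultimately show ?thesis
    unfolding der_shift[of K "\<lambda>e. G h (\<lambda>i. x i + e *\<^sub>R y i)" e, symmetric] by simp
qed

text \<open>The increment splits into a change of time at the fixed tuple \<open>X t\<close>,
  covered by \<open>Z\<close>, and a change of tuple at the fixed time
  \<open>\<theta> (\<sigma> n)\<close>. For the latter, \<open>X (\<sigma> n)\<close> lies on the
  line through \<open>X t\<close> in the direction of the difference quotient \<open>q n\<close>;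
  the mean value inequality on this line and the continuity of \<open>G'\<close> in point and
  direction replace Frechet differentiability. With \<open>\<theta>\<close> constant the rule
  differentiates in space, with \<open>\<theta>\<close> the identity in time.\<close>

lemma chain_rule:
  assumes G: "seq_cont l G" "space_der l G G'" "seq_cont l G'"
    and \<theta>: "\<And>s. s \<in> S \<Longrightarrow> \<theta> s \<in> I" "\<And>\<sigma>. (\<And>n. \<sigma> n \<in> S) \<Longrightarrow> \<sigma> \<longlonglongrightarrow> t \<Longrightarrow> (\<lambda>n. \<theta> (\<sigma> n)) \<longlonglongrightarrow> \<theta> t"
    and X: "\<And>i. der (K + l) S (\<lambda>s. X s i) t (Y i)"
    and Z: "der K S (\<lambda>s. G (\<theta> s) (X t)) t Z"
  shows "der K S (\<lambda>s. G (\<theta> s) (X s)) t (Z + G' (\<theta> t) (mix (X t) Y))"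
proof (rule derI)
  have t: "t \<in> S" and Y: "\<And>i. Y i \<in> H (K + l)" and Xi: "\<And>s i. s \<in> S \<Longrightarrow> X s i \<in> H (K + l)"
    using derD[OF X] by blast+
  show "t \<in> S" by (rule t)
  let ?V = "G' (\<theta> t) (mix (X t) Y)"
  have V: "?V \<in> H K"
    by (rule seq_cont_in[OF G(3) \<theta>(1)[OF t]]) (use Xi t Y in \<open>auto simp: mix_def\<close>)
  then show "Z + ?V \<in> H K" using derD(3)[OF Z] by blast
  show GH: "G (\<theta> s) (X s) \<in> H K" if "s \<in> S" for s
    by (rule seq_cont_in[OF G(1) \<theta>(1)[OF that]]) (use Xi that in auto)
  fix \<sigma> assume \<sigma>: "\<And>n. \<sigma> n \<in> S" "\<And>n. \<sigma> n \<noteq> t" "\<sigma> \<longlonglongrightarrow> t"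
  define q where "q n i = (1 / (\<sigma> n - t)) *\<^sub>R (X (\<sigma> n) i - X t i)" for n i
  have q: "cv (K + l) (\<lambda>n. q n i) (Y i)" for i
    unfolding q_def by (rule derD(4)[OF X \<sigma>])
  have XX: "X (\<sigma> n) = (\<lambda>i. X t i + (\<sigma> n - t) *\<^sub>R q n i)" for n
    using \<sigma>(2)[of n] by (auto simp: q_def)
  have line: "der K UNIV (\<lambda>e. G (\<theta> (\<sigma> n)) (\<lambda>i. X t i + e *\<^sub>R q n i)) e
      (G' (\<theta> (\<sigma> n)) (mix (\<lambda>i. X t i + e *\<^sub>R q n i) (q n)))" for n e
    by (rule space_der_line[OF G(2)]) (use \<theta> \<sigma> Xi[OF t] cv_in(1)[OF q] in auto)
  obtain \<xi> where \<xi>0: "\<xi> \<longlonglongrightarrow> 0"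
    and le: "\<And>n. N K (G (\<theta> (\<sigma> n)) (\<lambda>i. X t i + (\<sigma> n - t) *\<^sub>R q n i) - G (\<theta> (\<sigma> n)) (\<lambda>i. X t i + 0 *\<^sub>R q n i) - (\<sigma> n - t) *\<^sub>R ?V)
      \<le> \<bar>\<sigma> n - t\<bar> * N K (G' (\<theta> (\<sigma> n)) (mix (\<lambda>i. X t i + \<xi> n *\<^sub>R q n i) (q n)) - ?V)"
    by (rule mean_value_sequence[where f = "\<lambda>n e. G (\<theta> (\<sigma> n)) (\<lambda>i. X t i + e *\<^sub>R q n i)"
      and f' = "\<lambda>n e. G' (\<theta> (\<sigma> n)) (mix (\<lambda>i. X t i + e *\<^sub>R q n i) (q n))"
      and \<tau> = "\<lambda>n. \<sigma> n - t", OF line V LIM_zero[OF \<sigma>(3)]]) (rule that)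
  have le: "N K (G (\<theta> (\<sigma> n)) (X (\<sigma> n)) - G (\<theta> (\<sigma> n)) (X t) - (\<sigma> n - t) *\<^sub>R ?V)
      \<le> \<bar>\<sigma> n - t\<bar> * N K (G' (\<theta> (\<sigma> n)) (mix (\<lambda>i. X t i + \<xi> n *\<^sub>R q n i) (q n)) - ?V)" for n
    using le[of n] unfolding XX[symmetric] scaleR_zero_left add_0_right .
  have "cv K (\<lambda>n. G' (\<theta> (\<sigma> n)) (mix (\<lambda>i. X t i + \<xi> n *\<^sub>R q n i) (q n))) ?V"
  proof (rule seq_contD[OF G(3)])
    fix i
    have "cv (K + l) (\<lambda>n. X t i + \<xi> n *\<^sub>R q n i) (X t i + 0 *\<^sub>R Y i)" for i
      using Xi[OF t] by (intro cv_add cv_scale q \<xi>0) auto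
    then show "cv (K + l) (\<lambda>n. mix (\<lambda>i. X t i + \<xi> n *\<^sub>R q n i) (q n) i) (mix (X t) Y i)"
      using q by (simp add: mix_def)
  qed (use \<theta> \<sigma> t in auto)
  then have "cv K (\<lambda>n. (1 / (\<sigma> n - t)) *\<^sub>R (G (\<theta> (\<sigma> n)) (X (\<sigma> n)) - G (\<theta> (\<sigma> n)) (X t))) ?V"
    by (rule cv_quotient[rotated]) (use le \<sigma> GH derD(1)[OF Z] in auto)
  moreover have "cv K (\<lambda>n. (1 / (\<sigma> n - t)) *\<^sub>R (G (\<theta> (\<sigma> n)) (X t) - G (\<theta> t) (X t))) Z"
    by (rule derD(4)[OF Z \<sigma>])
  ultimately have "cv K (\<lambda>n. (1 / (\<sigma> n - t)) *\<^sub>R (G (\<theta> (\<sigma> n)) (X t) - G (\<theta> t) (X t))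
      + (1 / (\<sigma> n - t)) *\<^sub>R (G (\<theta> (\<sigma> n)) (X (\<sigma> n)) - G (\<theta> (\<sigma> n)) (X t))) (Z + ?V)"
    by (intro cv_add)
  then show "cv K (\<lambda>n. (1 / (\<sigma> n - t)) *\<^sub>R (G (\<theta> (\<sigma> n)) (X (\<sigma> n)) - G (\<theta> t) (X t))) (Z + ?V)"
    by (simp add: scaleR_add_right[symmetric])
qed

end

section \<open>Smooth maps on the scale\<close>

locale compatible_flows = hilbert_scale_time H ip T
  for H :: "nat \<Rightarrow> 'a::{real_inner, complete_space} set" and ip T +
  fixes Fs :: "(real \<Rightarrow> 'a \<Rightarrow> 'a) set"
  assumes compat: "f \<in> Fs \<Longrightarrow> compatible T H ip f"
    and flow_0: "f \<in> Fs \<Longrightarrow> f 0 u = u"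
    and flow_add: "f \<in> Fs \<Longrightarrow> 0 \<le> t \<Longrightarrow> 0 \<le> t' \<Longrightarrow> t + t' < T \<Longrightarrow> f (t + t') u = f t (f t' u)"
begin

text \<open>The maps \<open>(h, x) \<mapsto> G h x\<close> which are smooth from \<open>H (K + l)\<close> to \<open>H K\<close> for all \<open>K\<close> and lose one
  further level with each derivative in \<open>h\<close>. The class is closed under both kinds of derivatives, and
  the derivative in the tuple \<open>x\<close> is again a map of a tuple, in which the point and the direction
  are interleaved.\<close>

inductive Cl :: "nat \<Rightarrow> (real \<Rightarrow> (nat \<Rightarrow> 'a) \<Rightarrow> 'a) \<Rightarrow> bool" where
  proj: "Cl 0 (\<lambda>h x. x i)"
| base: "f \<in> Fs \<Longrightarrow> Cl j (td f j i)"
| zero: "Cl 0 (\<lambda>h x. 0)"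
| add: "Cl l G \<Longrightarrow> Cl l G' \<Longrightarrow> Cl l (\<lambda>h x. G h x + G' h x)"
| scale: "Cl l G \<Longrightarrow> Cl l (\<lambda>h x. c *\<^sub>R G h x)"
| comp: "Cl l G \<Longrightarrow> (\<And>i. Cl m (B i)) \<Longrightarrow> Cl (l + m) (\<lambda>h x. G h (\<lambda>i. B i h x))"
| weaken: "Cl l G \<Longrightarrow> l \<le> m \<Longrightarrow> Cl m G"
| time: "Cl l G \<Longrightarrow> 0 \<le> c \<Longrightarrow> c \<le> 1 \<Longrightarrow> Cl l (\<lambda>h x. G (c * h) x)"
| eq_on: "Cl l G \<Longrightarrow> (\<And>h x. h \<in> I \<Longrightarrow> (\<And>i. x i \<in> H l) \<Longrightarrow> G h x = G' h x) \<Longrightarrow> Cl l G'"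

lemma Cl_sum: "(\<And>r. r < (n::nat) \<Longrightarrow> Cl l (G r)) \<Longrightarrow> Cl l (\<lambda>h x. \<Sum>r<n. G r h x)"
proof (induction n)
  case 0
  show ?case using weaken[OF zero, of l] by simp
next
  case (Suc n)
  then show ?case using add[of l "\<lambda>h x. \<Sum>r<n. G r h x" "G n"] by simp
qed

lemma Cl_reindex: "Cl l G \<Longrightarrow> Cl l (\<lambda>h x. G h (\<lambda>i. x (\<rho> i)))"
  using comp[OF _ proj, of l G "\<rho>"] by simp

lemma scaled_time_in: "0 \<le> c \<Longrightarrow> c \<le> 1 \<Longrightarrow> h \<in> I \<Longrightarrow> c * h \<in> I"
  using mult_right_mono[of c 1 h] by auto

lemma Cl_seq_cont:
  assumes "Cl l G"
  shows "seq_cont l G"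
  using assms
proof (induction rule: Cl.induct)
  case (proj i)
  show ?case by (auto simp: seq_cont_def)
next
  case (base f j i)
  show ?case unfolding seq_cont_def using td_cont[OF compat[OF base]] by blast
next
  case zero
  show ?case by (auto simp: seq_cont_def)
next
  case (add l G G')
  show ?case
    unfolding seq_cont_def
  proof (intro allI impI)
    fix K h h0 and X :: "nat \<Rightarrow> nat \<Rightarrow> 'a" and x
    assume "\<forall>n. h n \<in> I" "h0 \<in> I" "h \<longlonglongrightarrow> h0" "\<forall>i. cv (K + l) (\<lambda>n. X n i) (x i)"
    then show "cv K (\<lambda>n. G (h n) (X n) + G' (h n) (X n)) (G h0 x + G' h0 x)"
      by (intro cv_add seq_contD[OF add.IH(1)] seq_contD[OF add.IH(2)]) auto
  qed
next
  case (scale l G c)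
  show ?case
    unfolding seq_cont_def
    by (intro allI impI cv_scaleR seq_contD[OF scale.IH]; blast)
next
  case (comp l G m B)
  show ?case
    unfolding seq_cont_def
  proof (intro allI impI)
    fix K h h0 and X :: "nat \<Rightarrow> nat \<Rightarrow> 'a" and x
    assume h: "\<forall>n. h n \<in> I" "h0 \<in> I" "h \<longlonglongrightarrow> h0" and X: "\<forall>i. cv (K + (l + m)) (\<lambda>n. X n i) (x i)"
    have "cv (K + l) (\<lambda>n. B i (h n) (X n)) (B i h0 x)" for i
      by (rule seq_contD[OF comp.IH(2)]) (use h X in \<open>auto simp: add.assoc\<close>)
    then show "cv K (\<lambda>n. G (h n) (\<lambda>i. B i (h n) (X n))) (G h0 (\<lambda>i. B i h0 x))"
      by (intro seq_contD[OF comp.IH(1)]) (use h in auto)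
  qed
next
  case (weaken l G m)
  show ?case
    unfolding seq_cont_def
  proof (intro allI impI)
    fix K h h0 and X :: "nat \<Rightarrow> nat \<Rightarrow> 'a" and x
    assume h: "\<forall>n. h n \<in> I" "h0 \<in> I" "h \<longlonglongrightarrow> h0" and X: "\<forall>i. cv (K + m) (\<lambda>n. X n i) (x i)"
    show "cv K (\<lambda>n. G (h n) (X n)) (G h0 x)"
      by (rule seq_contD[OF weaken.IH]) (use h X weaken.hyps cv_lower[of "K + l" "K + m"] in auto)
  qed
next
  case (time l G c)
  show ?case
    unfolding seq_cont_def
  proof (intro allI impI)
    fix K h h0 and X :: "nat \<Rightarrow> nat \<Rightarrow> 'a" and x
    assume h: "\<forall>n. h n \<in> I" "h0 \<in> I" "h \<longlonglongrightarrow> h0" and X: "\<forall>i. cv (K + l) (\<lambda>n. X n i) (x i)"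
    show "cv K (\<lambda>n. G (c * h n) (X n)) (G (c * h0) x)"
      by (rule seq_contD[OF time.IH])
        (use h X scaled_time_in[OF time.hyps(2,3)] in \<open>blast intro: tendsto_mult_left\<close>)+
  qed
next
  case (eq_on l G G')
  show ?case
    unfolding seq_cont_def
  proof (intro allI impI)
    fix K h h0 and X :: "nat \<Rightarrow> nat \<Rightarrow> 'a" and x
    assume h: "\<forall>n. h n \<in> I" "h0 \<in> I" "h \<longlonglongrightarrow> h0" and X: "\<forall>i. cv (K + l) (\<lambda>n. X n i) (x i)"
    have m: "X n i \<in> H l" "x i \<in> H l" for n i
      using X cv_in H_antimono[of l "K + l"] by (meson le_add2)+
    have "G (h n) (X n) = G' (h n) (X n)" for n by (rule eq_on.hyps(2)) (use h m in auto)
    moreover have "G h0 x = G' h0 x" by (rule eq_on.hyps(2)) (use h m in auto)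
    moreover have "cv K (\<lambda>n. G (h n) (X n)) (G h0 x)"
      by (rule seq_contD[OF eq_on.IH]) (use h X in auto)
    ultimately show "cv K (\<lambda>n. G' (h n) (X n)) (G' h0 x)" by (simp only:)
  qed
qed

text \<open>Every constructor of \<open>Cl\<close> comes with its own differentiation rule. In a
  composition, time enters through the outer map, at cost \<open>Suc l + m\<close>, and through the
  inner maps, at cost \<open>l + Suc m\<close>; both equal \<open>Suc (l + m)\<close>.\<close>

lemma Cl_differentiable:
  assumes "Cl l G"
  shows "(\<exists>G'. Cl l G' \<and> space_der l G G') \<and> (\<exists>G'. Cl (Suc l) G' \<and> time_der l G G')"
  using assms
proof (induction rule: Cl.induct)
  case (proj i)
  have "space_der 0 (\<lambda>h x. x i) (\<lambda>h x. x (Suc (2 * i)))"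
    by (auto simp: space_der_def intro!: der_affine)
  moreover have "time_der 0 (\<lambda>h x. x i) (\<lambda>h x. 0)"
    by (auto simp: time_der_def intro!: der_const intro: H_antimono[of K "Suc K" for K])
  moreover have "Cl (Suc 0) (\<lambda>h x. 0)" by (rule weaken[OF zero]) simp
  ultimately show ?case using Cl.proj by blast
next
  case (base f j i)
  \<comment> \<open>In the interleaved tuple, index \<open>2 * k\<close> holds entry
    \<open>k\<close> of the point tuple and index \<open>Suc (2 * k)\<close> its direction. Index 1
    thus picks the direction of the base point, and \<open>Suc (2 * k)\<close> with
    \<open>k = Suc r\<close> that of slot \<open>Suc r\<close>, as in
    \<open>td_total\<close>.\<close>
  let ?S = "\<lambda>h x. td f j (Suc i) h (\<lambda>k. x (if k \<le> i then 2 * k else 1)) +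
      (\<Sum>r<i. td f j i h (\<lambda>k. x (if k = Suc r then Suc (2 * k) else 2 * k)))"
  have "Cl j (\<lambda>h x. td f j i h (\<lambda>k. x (if k = Suc r then Suc (2 * k) else 2 * k)))" for r
    by (rule Cl_reindex[OF Cl.base[OF base], where \<rho> = "\<lambda>k. if k = Suc r then Suc (2 * k) else 2 * k"])
  then have "Cl j ?S"
    by (rule Cl.add[OF Cl_reindex[OF Cl.base[OF base], where \<rho> = "\<lambda>k. if k \<le> i then 2 * k else 1"] Cl_sum])
  moreover have "space_der j (td f j i) ?S"
    unfolding space_der_def
  proof (intro allI impI)
    fix K h and x y :: "nat \<Rightarrow> 'a"
    assume h: "h \<in> I" and x: "\<forall>i. x i \<in> H (K + j)" and y: "\<forall>i. y i \<in> H (K + j)"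
    have "(\<lambda>k. mix x y (if k \<le> i then 2 * k else 1)) = (\<lambda>r. if r \<le> i then x r else y 0)"
      using mix_simps(2)[of x y 0] by auto
    moreover have "(\<lambda>k. mix x y (if k = Suc r then Suc (2 * k) else 2 * k)) = x(Suc r := y (Suc r))" for r
      using mix_simps(2)[of x y "Suc r"] by auto
    ultimately show "der K UNIV (\<lambda>e. td f j i h (\<lambda>i. x i + e *\<^sub>R y i)) 0 (?S h (mix x y))"
      using td_total[OF compat[OF base] h, of i x K j y] x y by (simp only: simp_thms)
  qed
  moreover have "time_der j (td f j i) (td f (Suc j) i)"
    unfolding time_der_def using td_time[OF compat[OF base]] by blast
  ultimately show ?case using Cl.base[OF base] by blast
next
  case zero
  have "space_der 0 (\<lambda>h x. 0) (\<lambda>h x. 0)" "time_der 0 (\<lambda>h x. 0) (\<lambda>h x. 0)"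
    by (auto simp: space_der_def time_der_def intro!: der_const)
  moreover have "Cl (Suc 0) (\<lambda>h x. 0)" by (rule weaken[OF Cl.zero]) simp
  ultimately show ?case using Cl.zero by blast
next
  case (add l G G')
  from add.IH obtain S S' D D' where S: "Cl l S" "space_der l G S" "Cl l S'" "space_der l G' S'"
    and D: "Cl (Suc l) D" "time_der l G D" "Cl (Suc l) D'" "time_der l G' D'" by blast
  have "space_der l (\<lambda>h x. G h x + G' h x) (\<lambda>h x. S h x + S' h x)"
    unfolding space_der_def
    by (intro allI impI der_add space_derD[OF S(2)] space_derD[OF S(4)]; blast)
  moreover have "time_der l (\<lambda>h x. G h x + G' h x) (\<lambda>h x. D h x + D' h x)"
    unfolding time_der_def
    by (intro allI impI der_add time_derD[OF D(2)] time_derD[OF D(4)]; blast)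
  ultimately show ?case using Cl.add[OF S(1,3)] Cl.add[OF D(1,3)] by blast
next
  case (scale l G c)
  from scale.IH obtain S D where S: "Cl l S" "space_der l G S"
    and D: "Cl (Suc l) D" "time_der l G D" by blast
  have "space_der l (\<lambda>h x. c *\<^sub>R G h x) (\<lambda>h x. c *\<^sub>R S h x)"
    unfolding space_der_def
    by (intro allI impI der_scaleR space_derD[OF S(2)]; blast)
  moreover have "time_der l (\<lambda>h x. c *\<^sub>R G h x) (\<lambda>h x. c *\<^sub>R D h x)"
    unfolding time_der_def
    by (intro allI impI der_scaleR time_derD[OF D(2)]; blast)
  ultimately show ?case using Cl.scale[OF S(1)] Cl.scale[OF D(1)] by blast
next
  case (comp l G m B)
  from comp.IH(1) obtain S D where S: "Cl l S" "space_der l G S"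
    and D: "Cl (Suc l) D" "time_der l G D" by blast
  from comp.IH(2) have "\<forall>i. \<exists>S D. Cl m S \<and> space_der m (B i) S \<and> Cl (Suc m) D \<and> time_der m (B i) D" by blast
  then obtain BS BD where BS: "\<And>i. Cl m (BS i)" "\<And>i. space_der m (B i) (BS i)"
    and BD: "\<And>i. Cl (Suc m) (BD i)" "\<And>i. time_der m (B i) (BD i)" by metis
  note G = Cl_seq_cont[OF comp.hyps(1)] S(2) Cl_seq_cont[OF S(1)]
  \<comment> \<open>The inner maps see the even entries \<open>z (2 * k)\<close>, their derivatives
    all of \<open>z\<close>; the results are interleaved again for the outer derivative.\<close>
  let ?S = "\<lambda>h z. S h (\<lambda>i. if even i then B (i div 2) h (\<lambda>k. z (2 * k)) else BS (i div 2) h z)"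
  let ?D = "\<lambda>h x. D h (\<lambda>i. B i h x) + S h (\<lambda>i. if even i then B (i div 2) h x else BD (i div 2) h x)"
  have "Cl (l + m) ?S"
  proof (rule Cl.comp[OF S(1), of m "\<lambda>i h z. if even i then B (i div 2) h (\<lambda>k. z (2 * k)) else BS (i div 2) h z"])
    show "Cl m (\<lambda>h z. if even i then B (i div 2) h (\<lambda>k. z (2 * k)) else BS (i div 2) h z)" for i
      using Cl_reindex[OF comp.hyps(2), of "i div 2" "\<lambda>k. 2 * k"] BS(1) by (cases "even i") auto
  qed
  moreover have "space_der (l + m) (\<lambda>h x. G h (\<lambda>i. B i h x)) ?S"
    unfolding space_der_def
  proof (intro allI impI)
    fix K h and x y :: "nat \<Rightarrow> 'a"
    assume h: "h \<in> I" and "\<forall>i. x i \<in> H (K + (l + m))" and "\<forall>i. y i \<in> H (K + (l + m))"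
    then have x: "x i \<in> H (K + l + m)" "y i \<in> H (K + l + m)" for i by (simp_all add: add.assoc)
    have X: "der (K + l) UNIV (\<lambda>e. B i h (\<lambda>k. x k + e *\<^sub>R y k)) 0 (BS i h (mix x y))" for i
      by (rule space_derD[OF BS(2) h]) (use x in auto)
    have Z: "der K UNIV (\<lambda>e. G h (\<lambda>i. B i h (\<lambda>k. x k + 0 *\<^sub>R y k))) 0 0"
      by (rule der_const[OF seq_cont_in[OF G(1) h]]) (use derD(1)[OF X, of 0] in auto)
    have "der K UNIV (\<lambda>e. G h (\<lambda>i. B i h (\<lambda>k. x k + e *\<^sub>R y k))) 0
        (0 + S h (mix (\<lambda>i. B i h (\<lambda>k. x k + 0 *\<^sub>R y k)) (\<lambda>i. BS i h (mix x y))))"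
      by (rule chain_rule[OF G, where \<theta> = "\<lambda>_. h" and X = "\<lambda>e i. B i h (\<lambda>k. x k + e *\<^sub>R y k)", OF h _ X Z]) simp
    moreover have "mix (\<lambda>i. B i h x) (\<lambda>i. BS i h (mix x y)) =
        (\<lambda>i. if even i then B (i div 2) h (\<lambda>k. mix x y (2 * k)) else BS (i div 2) h (mix x y))"
      by (auto simp: mix_def)
    ultimately show "der K UNIV (\<lambda>e. G h (\<lambda>i. B i h (\<lambda>i. x i + e *\<^sub>R y i))) 0 (?S h (mix x y))"
      by simp
  qed
  moreover have "Cl (Suc (l + m)) ?D"
  proof (rule Cl.add)
    show "Cl (Suc (l + m)) (\<lambda>h x. D h (\<lambda>i. B i h x))"
      using Cl.comp[OF D(1) comp.hyps(2)] by simp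
    have "Cl (l + Suc m) (\<lambda>h x. S h (\<lambda>i. if even i then B (i div 2) h x else BD (i div 2) h x))"
    proof (rule Cl.comp[OF S(1), of "Suc m" "\<lambda>i h x. if even i then B (i div 2) h x else BD (i div 2) h x"])
      show "Cl (Suc m) (\<lambda>h x. if even i then B (i div 2) h x else BD (i div 2) h x)" for i
        using Cl.weaken[OF comp.hyps(2), of "Suc m" "i div 2"] BD(1) by (cases "even i") auto
    qed
    then show "Cl (Suc (l + m)) (\<lambda>h x. S h (\<lambda>i. if even i then B (i div 2) h x else BD (i div 2) h x))" by simp
  qed
  moreover have "time_der (l + m) (\<lambda>h x. G h (\<lambda>i. B i h x)) ?D"
    unfolding time_der_def
  proof (intro allI impI)
    fix K h and x :: "nat \<Rightarrow> 'a"
    assume h: "h \<in> I" and "\<forall>i. x i \<in> H (K + Suc (l + m))"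
    then have x: "x i \<in> H (K + l + Suc m)" "x i \<in> H (K + Suc l + m)" for i by (simp_all add: add.assoc)
    have X: "der (K + l) I (\<lambda>h. B i h x) h (BD i h x)" for i
      by (rule time_derD[OF BD(2) h]) (use x in auto)
    have "B i h x \<in> H (K + Suc l)" for i
      by (rule seq_cont_in[OF Cl_seq_cont[OF comp.hyps(2)] h]) (use x in auto)
    then have Z: "der K I (\<lambda>s. G s (\<lambda>i. B i h x)) h (D h (\<lambda>i. B i h x))"
      by (rule time_derD[OF D(2) h])
    have "der K I (\<lambda>s. G s (\<lambda>i. B i s x)) h (D h (\<lambda>i. B i h x) + S h (mix (\<lambda>i. B i h x) (\<lambda>i. BD i h x)))"
      by (rule chain_rule[OF G, where \<theta> = "\<lambda>s. s" and X = "\<lambda>s i. B i s x", OF _ _ X Z]) auto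
    then show "der K I (\<lambda>h. G h (\<lambda>i. B i h x)) h (?D h x)"
      by (simp add: mix_def)
  qed
  ultimately show ?case by blast
next
  case (weaken l G m)
  from weaken.IH obtain S D where S: "Cl l S" "space_der l G S"
    and D: "Cl (Suc l) D" "time_der l G D" by blast
  have "space_der m G S"
    using S(2) H_antimono[of "K + l" "K + m" for K] weaken.hyps(2) unfolding space_der_def by (meson add_le_cancel_left)
  moreover have "time_der m G D"
    using D(2) H_antimono[of "K + Suc l" "K + Suc m" for K] weaken.hyps(2) unfolding time_der_def by (meson Suc_le_mono add_le_cancel_left)
  moreover have "Cl m S" "Cl (Suc m) D"
    using Cl.weaken[OF S(1), of m] Cl.weaken[OF D(1), of "Suc m"] weaken.hyps(2) by simp_all
  ultimately show ?case by blast
next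
  case (time l G c)
  from time.IH obtain S D where S: "Cl l S" "space_der l G S"
    and D: "Cl (Suc l) D" "time_der l G D" by blast
  note c = scaled_time_in[OF time.hyps(2,3)]
  have "space_der l (\<lambda>h. G (c * h)) (\<lambda>h. S (c * h))"
    using S(2) c unfolding space_der_def by blast
  moreover have "time_der l (\<lambda>h. G (c * h)) (\<lambda>h x. c *\<^sub>R D (c * h) x)"
    unfolding time_der_def
    by (intro allI impI der_time_scale[of _ I _ c] time_derD[OF D(2)]) (use c in auto)
  ultimately show ?case
    using Cl.time[OF S(1) time.hyps(2,3)] Cl.scale[OF Cl.time[OF D(1) time.hyps(2,3)], of c] by blast
next
  case (eq_on l G G')
  from eq_on.IH obtain S D where S: "Cl l S" "space_der l G S"
    and D: "Cl (Suc l) D" "time_der l G D" by blast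
  have "space_der l G' S"
    unfolding space_der_def
  proof (intro allI impI)
    fix K h and x y :: "nat \<Rightarrow> 'a"
    assume h: "h \<in> I" and x: "\<forall>i. x i \<in> H (K + l)" and y: "\<forall>i. y i \<in> H (K + l)"
    then have m: "x i \<in> H l" "y i \<in> H l" for i by (auto intro: H_antimono[of l "K + l"])
    have eq: "G h (\<lambda>i. x i + e *\<^sub>R y i) = G' h (\<lambda>i. x i + e *\<^sub>R y i)" for e
      by (rule eq_on.hyps(2)[OF h]) (use m in auto)
    have "der K UNIV (\<lambda>e. G h (\<lambda>i. x i + e *\<^sub>R y i)) 0 (S h (mix x y))"
      by (rule space_derD[OF S(2) h]) (use x y in auto)
    then show "der K UNIV (\<lambda>e. G' h (\<lambda>i. x i + e *\<^sub>R y i)) 0 (S h (mix x y))" by (simp only: eq)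
  qed
  moreover have "time_der l G' D"
    unfolding time_der_def
  proof (intro allI impI)
    fix K h and x :: "nat \<Rightarrow> 'a"
    assume h: "h \<in> I" and x: "\<forall>i. x i \<in> H (K + Suc l)"
    then have m: "x i \<in> H l" for i by (auto intro: H_antimono[of l "K + Suc l"])
    have "der K I (\<lambda>h. G h x) h (D h x)"
      by (rule time_derD[OF D(2) h]) (use x in auto)
    then show "der K I (\<lambda>h. G' h x) h (D h x)"
      by (rule der_cong) (rule eq_on.hyps(2)[OF _ m])
  qed
  ultimately show ?case using S(1) D(1) by blast
qed

section \<open>Derivatives along a flow\<close>

lemma Cl_flow: "f \<in> Fs \<Longrightarrow> Cl 0 (\<lambda>h x. f h (x 0))"
  by (rule eq_on[OF base[of f 0 0]]) (auto simp: td_flow[OF compat])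

lemma Cl_flow_comp: "Cl l (\<lambda>h x. g h (x 0)) \<Longrightarrow> f \<in> Fs \<Longrightarrow> Cl l (\<lambda>h x. g h (f h (x 0)))"
  using comp[OF _ Cl_flow, of l "\<lambda>h x. g h (x 0)" "\<lambda>_. f"] by simp

lemma flow_cv:
  assumes "f \<in> Fs" "\<And>n. \<tau> n \<in> I" "t \<in> I" "\<tau> \<longlonglongrightarrow> t" "cv k y u"
  shows "cv k (\<lambda>n. f (\<tau> n) (y n)) (f t u)"
  using seq_contD[OF Cl_seq_cont[OF Cl_flow[OF assms(1)]] assms(2-4), where X = "\<lambda>n _. y n" and x = "\<lambda>_. u"] assms(5) by simp

lemma flow_in: "f \<in> Fs \<Longrightarrow> h \<in> I \<Longrightarrow> u \<in> H k \<Longrightarrow> f h u \<in> H k"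
  using flow_cv[of f "\<lambda>_. h" h k "\<lambda>_. u" u] by simp

text \<open>The time derivative of the composition is a map of \<open>h\<close> and a tuple. It is
  frozen at time 0 by the rescaling rule with factor 0, and its tuple is collapsed to the entry
  \<open>x 0\<close>; both operations stay in the class, and one \<open>g'\<close> serves all levels
  \<open>K\<close>.\<close>

lemma Lie_derivative_exists:
  assumes f: "f \<in> Fs" and g: "Cl m (\<lambda>h x. g (x 0))"
  shows "\<exists>g'. Cl (Suc m) (\<lambda>h x. g' (x 0)) \<and> (\<forall>K. \<forall>u\<in>H (K + Suc m). der K I (\<lambda>h. g (f h u)) 0 (g' u))"
proof -
  obtain D where D: "Cl (Suc m) D" "time_der m (\<lambda>h x. g (f h (x 0))) D"
    using Cl_differentiable[OF Cl_flow_comp[OF g f]] by blast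
  have "Cl (Suc m) (\<lambda>h x. D (0 * h) x)" by (rule time[OF D(1)]) auto
  then have "Cl (Suc m) (\<lambda>h x. D (0 * h) (\<lambda>i. x 0))" by (rule Cl_reindex)
  moreover have "der K I (\<lambda>h. g (f h u)) 0 (D 0 (\<lambda>i. u))" if "u \<in> H (K + Suc m)" for K u
    using time_derD[OF D(2), of 0 "\<lambda>_. u" K] that T by simp
  ultimately show ?thesis by (intro exI[of _ "\<lambda>u. D 0 (\<lambda>i. u)"]) simp
qed

text \<open>The flow property moves the derivative from time 0 to time \<open>h\<close>, but only
  for increments to the right. A derivative in \<open>I\<close> at \<open>h\<close> exists since the
  composed map belongs to the class, so a sequence from the right determines its value.\<close>

lemma der_along_flow:
  assumes f: "f \<in> Fs" and g: "Cl m (\<lambda>h x. g (x 0))"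
    and g': "\<And>u. u \<in> H (K + Suc m) \<Longrightarrow> der K I (\<lambda>h. g (f h u)) 0 (g' u)"
    and h: "h \<in> I" and u: "u \<in> H (K + Suc m)"
  shows "der K I (\<lambda>h. g (f h u)) h (g' (f h u))"
proof -
  obtain D where D: "time_der m (\<lambda>h x. g (f h (x 0))) D"
    using Cl_differentiable[OF Cl_flow_comp[OF g f]] by blast
  have d: "der K I (\<lambda>h. g (f h u)) h (D h (\<lambda>_. u))"
    using time_derD[OF D h, of "\<lambda>_. u" K] u by simp
  have d0: "der K I (\<lambda>t. g (f t (f h u))) 0 (g' (f h u))"
    by (rule g') (rule flow_in[OF f h u])
  \<comment> \<open>Half the distance to \<open>T\<close> keeps \<open>\<tau> n + h\<close> below
    \<open>T\<close>, where the flow property holds.\<close>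
  define \<tau> where "\<tau> n = (T - h) / 2 * inverse (real (Suc n))" for n
  have Th: "0 < T - h" "0 \<le> h" using h by auto
  have "(\<lambda>n. (T - h) / 2 * inverse (real (Suc n))) \<longlonglongrightarrow> (T - h) / 2 * 0"
    by (intro tendsto_intros LIMSEQ_inverse_real_of_nat)
  then have \<tau>0: "\<tau> \<longlonglongrightarrow> 0" by (simp add: \<tau>_def[abs_def])
  have \<tau>: "0 < \<tau> n" "\<tau> n + h < T" for n
  proof -
    show "0 < \<tau> n" using Th by (simp add: \<tau>_def)
    have "inverse (real (Suc n)) \<le> 1" by (simp add: inverse_le_1_iff)
    then have "\<tau> n \<le> (T - h) / 2 * 1" unfolding \<tau>_def using Th by (intro mult_left_mono) auto
    then show "\<tau> n + h < T" using Th by simp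
  qed
  have "(\<lambda>n. \<tau> n + h) \<longlonglongrightarrow> 0 + h" by (intro tendsto_intros \<tau>0)
  then have "cv K (\<lambda>n. (1 / ((\<tau> n + h) - h)) *\<^sub>R (g (f (\<tau> n + h) u) - g (f h u))) (D h (\<lambda>_. u))"
    using \<tau> Th by (intro derD(4)[OF d]) (auto simp: less_imp_neq[symmetric] less_imp_le add_nonneg_nonneg)
  moreover have "f (\<tau> n + h) u = f (\<tau> n) (f h u)" for n
    by (rule flow_add[OF f]) (use \<tau>[of n] Th in auto)
  ultimately have "cv K (\<lambda>n. (1 / \<tau> n) *\<^sub>R (g (f (\<tau> n) (f h u)) - g (f h u))) (D h (\<lambda>_. u))"
    by simp
  moreover have "cv K (\<lambda>n. (1 / (\<tau> n - 0)) *\<^sub>R (g (f (\<tau> n) (f h u)) - g (f 0 (f h u)))) (g' (f h u))"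
  proof (rule derD(4)[OF d0])
    fix n
    show "\<tau> n \<noteq> 0" using \<tau>(1)[of n] by simp
    show "\<tau> n \<in> I" using \<tau>[of n] Th by simp
  qed (rule \<tau>0)
  ultimately have "D h (\<lambda>_. u) = g' (f h u)"
    by (intro cv_unique) (simp_all add: flow_0[OF f])
  then show ?thesis using d by simp
qed

text \<open>The derivative of \<open>g\<close> along a flow depends on the flow through its initial
  velocity alone, and additively. This transfers the addition of velocities to all iterated Lie
  derivatives.\<close>

lemma directional_derivative:
  assumes g: "Cl m (\<lambda>h x. g (x 0))"
  obtains \<delta> where "\<And>u a b. u \<in> H m \<Longrightarrow> a \<in> H m \<Longrightarrow> b \<in> H m \<Longrightarrow> \<delta> u (a + b) = \<delta> u a + \<delta> u b"
    and "\<And>f u a. f \<in> Fs \<Longrightarrow> der m I (\<lambda>h. f h u) 0 a \<Longrightarrow> der 0 I (\<lambda>h. g (f h u)) 0 (\<delta> u a)"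
proof -
  obtain S where S: "Cl m S" "space_der m (\<lambda>h x. g (x 0)) S"
    using Cl_differentiable[OF g] by blast
  note c = Cl_seq_cont[OF g] S(2) Cl_seq_cont[OF S(1)]
  have zero_I: "0 \<in> I" using T by simp
  define \<delta> where "\<delta> u a = S 0 (mix (\<lambda>_. u) (\<lambda>_. a))" for u a
  have line: "der 0 UNIV (\<lambda>e. g (u + e *\<^sub>R a)) e (\<delta> (u + e *\<^sub>R a) a)" if "u \<in> H m" "a \<in> H m" for u a e
    unfolding \<delta>_def using space_der_line[OF S(2) zero_I, of "\<lambda>_. u" 0 "\<lambda>_. a" e] that by simp
  have line0: "der 0 UNIV (\<lambda>e. g (u + e *\<^sub>R a)) 0 (\<delta> u a)" if "u \<in> H m" "a \<in> H m" for u a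
    using line[OF that, of 0] by simp
  have "\<delta> u (a + b) = \<delta> u a + \<delta> u b" if u: "u \<in> H m" "a \<in> H m" "b \<in> H m" for u a b
  proof -
    have "der 0 UNIV (\<lambda>e. g (u + e *\<^sub>R a + e *\<^sub>R b)) 0 (\<delta> u a + \<delta> (u + 0 *\<^sub>R a + 0 *\<^sub>R b) b)"
    proof (rule der_diagonal[where G = "\<lambda>e t. g (u + e *\<^sub>R a + t *\<^sub>R b)" and dG = "\<lambda>e t. \<delta> (u + e *\<^sub>R a + t *\<^sub>R b) b"])
      show "der 0 UNIV (\<lambda>t. g (u + e *\<^sub>R a + t *\<^sub>R b)) t (\<delta> (u + e *\<^sub>R a + t *\<^sub>R b) b)" for e t
        by (rule line) (use u in auto)
      show "der 0 UNIV (\<lambda>e. g (u + e *\<^sub>R a + 0 *\<^sub>R b)) 0 (\<delta> u a)"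
        using line0[OF u(1,2)] by simp
      fix e t :: "nat \<Rightarrow> real" assume et: "e \<longlonglongrightarrow> 0" "t \<longlonglongrightarrow> 0"
      have *: "cv m (\<lambda>n. u + e n *\<^sub>R a + t n *\<^sub>R b) (u + 0 *\<^sub>R a + 0 *\<^sub>R b)"
        by (intro cv_add cv_scale et) (use u in auto)
      show "cv 0 (\<lambda>n. \<delta> (u + e n *\<^sub>R a + t n *\<^sub>R b) b) (\<delta> (u + 0 *\<^sub>R a + 0 *\<^sub>R b) b)"
        unfolding \<delta>_def
      proof (rule seq_contD[OF c(3), where h = "\<lambda>_. 0"])
        show "cv (0 + m) (\<lambda>n. mix (\<lambda>_. u + e n *\<^sub>R a + t n *\<^sub>R b) (\<lambda>_. b) i)
            (mix (\<lambda>_. u + 0 *\<^sub>R a + 0 *\<^sub>R b) (\<lambda>_. b) i)" for i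
          using * u by (cases "even i") (simp_all add: mix_def)
      qed (use zero_I in auto)
    qed
    moreover have "u + e *\<^sub>R a + e *\<^sub>R b = u + e *\<^sub>R (a + b)" for e
      by (simp add: scaleR_add_right add.assoc)
    ultimately have "der 0 UNIV (\<lambda>e. g (u + e *\<^sub>R (a + b))) 0 (\<delta> u a + \<delta> u b)" by simp
    with line0 show ?thesis by (rule der_unique) (use u in \<open>auto simp: islimpt_UNIV\<close>)
  qed
  moreover have "der 0 I (\<lambda>h. g (f h u)) 0 (\<delta> u a)" if f: "f \<in> Fs" and d: "der m I (\<lambda>h. f h u) 0 a" for f u a
  proof -
    have "f 0 u \<in> H m" by (rule derD(1)[OF d zero_I])
    then have u: "u \<in> H m" by (simp add: flow_0[OF f])
    have Z: "der 0 I (\<lambda>s. g (f 0 u)) 0 0" by (rule der_const) (use zero_I in auto)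
    have "der 0 I (\<lambda>s. g (f s u)) 0 (0 + S 0 (mix (\<lambda>_. f 0 u) (\<lambda>_. a)))"
      by (rule chain_rule[OF c, where \<theta> = "\<lambda>_. 0" and X = "\<lambda>s _. f s u"]) (use d Z zero_I in auto)
    then show ?thesis by (simp add: \<delta>_def flow_0[OF f])
  qed
  ultimately show ?thesis using that by blast
qed

text \<open>The remainder is measured by the oscillation of the derivative of order \<open>r\<close>
  itself, as one more derivative would cost another level of the scale. The derivative of the
  remainder is the remainder of the shifted sequence of derivatives, which drives the
  induction.\<close>

lemma taylor_remainder:
  assumes D: "\<And>j t. j < r \<Longrightarrow> t \<in> I \<Longrightarrow> der 0 I (D j) t (D (Suc j) t)" and \<tau>: "\<tau> \<in> I"
  shows "\<exists>\<xi>\<in>{0..\<tau>}. norm (D 0 \<tau> - (\<Sum>j\<le>r. (\<tau> ^ j / fact j) *\<^sub>R D j 0)) \<le> \<tau> ^ r * norm (D r \<xi> - D r 0)"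
  using assms
proof (induction r arbitrary: D \<tau>)
  case 0
  then show ?case by (intro bexI[of _ \<tau>]) auto
next
  case (Suc r)
  define R where "R t = D 0 t - (\<Sum>j\<le>Suc r. (t ^ j / fact j) *\<^sub>R D j 0)" for t
  define R' where "R' t = D (Suc 0) t - (\<Sum>j\<le>r. (t ^ j / fact j) *\<^sub>R D (Suc j) 0)" for t
  have "((\<lambda>t. (t ^ Suc j / fact (Suc j)) *\<^sub>R D (Suc j) 0) has_vector_derivative (t ^ j / fact j) *\<^sub>R D (Suc j) 0) (at t within I)" for j t
  proof -
    have "((\<lambda>t. t ^ Suc j / fact (Suc j)) has_real_derivative (t ^ j / fact j)) (at t within I)"
      by (rule derivative_eq_intros refl | simp add: field_simps del: of_nat_Suc)+
    then show ?thesis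
      using has_vector_derivative_scaleR[OF _ has_vector_derivative_const] by fastforce
  qed
  then have p: "((\<lambda>t. D 0 0 + (\<Sum>j\<le>r. (t ^ Suc j / fact (Suc j)) *\<^sub>R D (Suc j) 0)) has_vector_derivative
      0 + (\<Sum>j\<le>r. (t ^ j / fact j) *\<^sub>R D (Suc j) 0)) (at t within I)" for t
    by (intro has_vector_derivative_add has_vector_derivative_sum has_vector_derivative_const)
  have "(R has_vector_derivative R' t) (at t within I)" if "t \<in> I" for t
  proof -
    have "(D 0 has_vector_derivative D (Suc 0) t) (at t within I)"
      using Suc.prems(1)[of 0 t] that by (simp add: der_0_iff)
    from has_vector_derivative_diff[OF this p[of t]] show ?thesis
      unfolding R_def[abs_def] R'_def sum.atMost_Suc_shift by simp
  qed
  then have dR: "der 0 I R t (R' t)" if "t \<in> I" for t using that by (simp add: der_0_iff)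
  have seg: "closed_segment 0 \<tau> = {0..\<tau>}" "{0..\<tau>} \<subseteq> I"
    using Suc.prems(2) by (auto simp: closed_segment_eq_real_ivl)
  obtain \<eta> where \<eta>: "\<eta> \<in> {0..\<tau>}" "norm (R \<tau> - R 0) \<le> \<tau> * norm (R' \<eta>)"
    using mean_value[of 0 \<tau> I 0 R R' 0] dR seg Suc.prems(2) by (auto simp: subset_iff)
  have "R 0 = 0" unfolding R_def sum.atMost_Suc_shift by simp
  have "\<exists>\<xi>\<in>{0..\<eta>}. norm (R' \<eta>) \<le> \<eta> ^ r * norm (D (Suc r) \<xi> - D (Suc r) 0)"
    unfolding R'_def using Suc.IH[of "\<lambda>j. D (Suc j)" \<eta>] Suc.prems \<eta> by auto
  then obtain \<xi> where \<xi>: "\<xi> \<in> {0..\<eta>}" "norm (R' \<eta>) \<le> \<eta> ^ r * norm (D (Suc r) \<xi> - D (Suc r) 0)" by blast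
  have "norm (R \<tau>) \<le> \<tau> * (\<eta> ^ r * norm (D (Suc r) \<xi> - D (Suc r) 0))"
    using \<eta> \<xi> \<open>R 0 = 0\<close> by (intro order_trans[OF _ mult_left_mono[OF \<xi>(2)]]) auto
  also have "\<dots> \<le> \<tau> * (\<tau> ^ r * norm (D (Suc r) \<xi> - D (Suc r) 0))"
    using \<eta> by (intro mult_left_mono mult_right_mono power_mono) auto
  finally show ?case
    using \<xi> \<eta> unfolding R_def by (intro bexI[of _ \<xi>]) (auto simp: mult.assoc)
qed

end

section \<open>Expansions along sequences\<close>

text \<open>Little-o of \<open>\<tau> n ^ r\<close> along a sequence, with the null factor
  \<open>\<epsilon>\<close> given explicitly so that nothing is divided by
  \<open>\<tau> n\<close>.\<close>

definition small :: "(nat \<Rightarrow> real) \<Rightarrow> nat \<Rightarrow> (nat \<Rightarrow> 'a::real_normed_vector) \<Rightarrow> bool" where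
  "small \<tau> r e \<longleftrightarrow> (\<exists>\<epsilon>. \<epsilon> \<longlonglongrightarrow> 0 \<and> (\<forall>n. norm (e n) \<le> \<tau> n ^ r * \<epsilon> n))"

lemma smallI: "\<epsilon> \<longlonglongrightarrow> 0 \<Longrightarrow> (\<And>n. norm (e n) \<le> \<tau> n ^ r * \<epsilon> n) \<Longrightarrow> small \<tau> r e"
  unfolding small_def by blast

lemma small_zero: "small \<tau> r (\<lambda>n. 0)"
  by (rule smallI[of "\<lambda>_. 0"]) auto

lemma small_add:
  assumes "small \<tau> r d" "small \<tau> r e"
  shows "small \<tau> r (\<lambda>n. d n + e n)"
proof -
  obtain \<delta> \<epsilon> where "\<delta> \<longlonglongrightarrow> 0" "\<epsilon> \<longlonglongrightarrow> 0" and le: "\<And>n. norm (d n) \<le> \<tau> n ^ r * \<delta> n" "\<And>n. norm (e n) \<le> \<tau> n ^ r * \<epsilon> n"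
    using assms unfolding small_def by blast
  then have "(\<lambda>n. \<delta> n + \<epsilon> n) \<longlonglongrightarrow> 0" by (auto intro: tendsto_add_zero)
  then show ?thesis
    by (rule smallI) (use le in \<open>auto simp: distrib_left intro: norm_triangle_le add_mono\<close>)
qed

lemma small_sum: "finite A \<Longrightarrow> (\<And>a. a \<in> A \<Longrightarrow> small \<tau> r (e a)) \<Longrightarrow> small \<tau> r (\<lambda>n. \<Sum>a\<in>A. e a n)"
  by (induction A rule: finite_induct) (auto intro: small_zero small_add)

lemma small_scale:
  assumes "small \<tau> r e" "\<And>n. 0 \<le> \<tau> n"
  shows "small \<tau> (k + r) (\<lambda>n. (\<tau> n ^ k * c) *\<^sub>R e n)"
proof -
  obtain \<epsilon> where "\<epsilon> \<longlonglongrightarrow> 0" and le: "\<And>n. norm (e n) \<le> \<tau> n ^ r * \<epsilon> n"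
    using assms(1) unfolding small_def by blast
  then have "(\<lambda>n. \<bar>c\<bar> * \<epsilon> n) \<longlonglongrightarrow> 0" by (auto intro: tendsto_mult_right_zero)
  then show ?thesis
  proof (rule smallI)
    fix n
    have "norm ((\<tau> n ^ k * c) *\<^sub>R e n) = \<tau> n ^ k * \<bar>c\<bar> * norm (e n)"
      using assms(2) by (simp add: abs_mult power_abs)
    also have "\<dots> \<le> \<tau> n ^ k * \<bar>c\<bar> * (\<tau> n ^ r * \<epsilon> n)"
      using assms(2) by (intro mult_left_mono le) auto
    finally show "norm ((\<tau> n ^ k * c) *\<^sub>R e n) \<le> \<tau> n ^ (k + r) * (\<bar>c\<bar> * \<epsilon> n)"
      by (simp add: power_add mult_ac)
  qed
qed

lemma small_time_scale: "small (\<lambda>n. c * \<tau> n) r e \<Longrightarrow> small \<tau> r e"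
proof -
  assume "small (\<lambda>n. c * \<tau> n) r e"
  then obtain \<epsilon> where "\<epsilon> \<longlonglongrightarrow> 0" and le: "\<And>n. norm (e n) \<le> (c * \<tau> n) ^ r * \<epsilon> n"
    unfolding small_def by blast
  then have "(\<lambda>n. c ^ r * \<epsilon> n) \<longlonglongrightarrow> 0" by (auto intro: tendsto_mult_right_zero)
  then show ?thesis
    by (rule smallI) (use le in \<open>simp add: power_mult_distrib mult_ac\<close>)
qed

lemma small_diff: "small \<tau> r d \<Longrightarrow> small \<tau> r e \<Longrightarrow> small \<tau> r (\<lambda>n. d n - e n)"
  using small_add[of \<tau> r d "\<lambda>n. - e n"] by (simp add: small_def)

text \<open>The limit removes the constant coefficient; a factor \<open>\<tau> n > 0\<close> is then
  cancelled and the degree drops.\<close>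

lemma small_polynomial:
  assumes "small \<tau> q (\<lambda>n. \<Sum>k\<le>q. \<tau> n ^ k *\<^sub>R c k)" "\<tau> \<longlonglongrightarrow> 0" "\<And>n. 0 < \<tau> n" "k \<le> q"
  shows "c k = 0"
  using assms(1,4)
proof (induction q arbitrary: c k)
  case 0
  then obtain \<epsilon> where "\<epsilon> \<longlonglongrightarrow> 0" "\<And>n. norm (c 0) \<le> \<epsilon> n" by (auto simp: small_def)
  then have "norm (c 0) \<le> 0" by (intro LIMSEQ_le_const[of \<epsilon>]) auto
  then show ?case using 0 by simp
next
  case (Suc q)
  obtain \<epsilon> where \<epsilon>: "\<epsilon> \<longlonglongrightarrow> 0" and le: "\<And>n. norm (\<Sum>k\<le>Suc q. \<tau> n ^ k *\<^sub>R c k) \<le> \<tau> n ^ Suc q * \<epsilon> n"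
    using Suc.prems(1) unfolding small_def by blast
  have "(\<lambda>n. \<tau> n ^ Suc q * \<epsilon> n) \<longlonglongrightarrow> 0 ^ Suc q * 0"
    by (intro tendsto_mult tendsto_power assms(2) \<epsilon>)
  then have "(\<lambda>n. \<tau> n ^ Suc q * \<epsilon> n) \<longlonglongrightarrow> 0" by simp
  then have lim0: "(\<lambda>n. \<Sum>k\<le>Suc q. \<tau> n ^ k *\<^sub>R c k) \<longlonglongrightarrow> 0"
    by (rule Lim_null_comparison[OF always_eventually[OF allI[OF le]]])
  have "(\<lambda>n. \<Sum>k\<le>Suc q. \<tau> n ^ k *\<^sub>R c k) \<longlonglongrightarrow> (\<Sum>k\<le>Suc q. 0 ^ k *\<^sub>R c k)"
    by (intro tendsto_sum tendsto_scaleR tendsto_power tendsto_const assms(2))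
  then have "(\<Sum>k\<le>Suc q. 0 ^ k *\<^sub>R c k) = 0" by (rule LIMSEQ_unique[OF _ lim0])
  then have c0: "c 0 = 0" unfolding sum.atMost_Suc_shift by simp
  have "small \<tau> q (\<lambda>n. \<Sum>k\<le>q. \<tau> n ^ k *\<^sub>R c (Suc k))"
  proof (rule smallI[OF \<epsilon>])
    fix n
    have "(\<Sum>k\<le>Suc q. \<tau> n ^ k *\<^sub>R c k) = \<tau> n *\<^sub>R (\<Sum>k\<le>q. \<tau> n ^ k *\<^sub>R c (Suc k))"
      unfolding sum.atMost_Suc_shift by (simp add: c0 scaleR_sum_right)
    then have "\<tau> n * norm (\<Sum>k\<le>q. \<tau> n ^ k *\<^sub>R c (Suc k)) \<le> \<tau> n * (\<tau> n ^ q * \<epsilon> n)"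
      using le[of n] assms(3)[of n] by (simp add: mult.assoc)
    then show "norm (\<Sum>k\<le>q. \<tau> n ^ k *\<^sub>R c (Suc k)) \<le> \<tau> n ^ q * \<epsilon> n"
      using assms(3)[of n] by simp
  qed
  then have "c (Suc k) = 0" if "k \<le> q" for k using Suc.IH[of "\<lambda>k. c (Suc k)"] that by blast
  then show ?case using c0 Suc.prems(2) by (cases k) auto
qed

text \<open>A function on words stands for a formal power series in noncommuting letters.\<close>

definition conv :: "('b list \<Rightarrow> real) \<Rightarrow> ('b list \<Rightarrow> real) \<Rightarrow> 'b list \<Rightarrow> real" where
  "conv f g w = (\<Sum>k\<le>length w. f (take k w) * g (drop k w))"

definition delta :: "'b list \<Rightarrow> real" where
  "delta w = (if w = [] then 1 else 0)"

definition exp_letter :: "'b \<Rightarrow> 'b list \<Rightarrow> real" where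
  "exp_letter i w = (if w = replicate (length w) i then 1 / fact (length w) else 0)"

text \<open>A product of exponentials of letters. The leftmost letter belongs to the flow that is
  applied first, since composition with flows reverses the order of the operators.\<close>

primrec exp_letters :: "'b list \<Rightarrow> 'b list \<Rightarrow> real" where
  "exp_letters [] = delta"
| "exp_letters (i # is) = conv (exp_letter i) (exp_letters is)"

lemma finite_words: "finite {v::'b::finite list. length v \<le> r}" "finite {v::'b list. length v = k}"
  using finite_lists_length_le[of "UNIV :: 'b set" r] finite_lists_length_eq[of "UNIV :: 'b set" k] by simp_all

text \<open>A pair of a word \<open>v\<close> and an exponent \<open>j\<close> corresponds to a word
  together with a prefix of \<open>j\<close> copies of \<open>i\<close>; all other prefixes have
  coefficient zero in \<open>exp_letter i\<close>. The truncations agree because the lengths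
  add.\<close>

lemma sum_exp_letter_conv:
  fixes F :: "'b::finite list \<Rightarrow> 'a::real_vector"
  shows "(\<Sum>v | length v \<le> r. \<Sum>j\<le>r - length v. (c v / fact j) *\<^sub>R F (replicate j i @ v))
       = (\<Sum>v | length v \<le> r. conv (exp_letter i) c v *\<^sub>R F v)"
proof -
  let ?W = "{v::'b list. length v \<le> r}"
  let ?A = "SIGMA v:?W. {..r - length v}"
  let ?B = "SIGMA v:?W. {..length v}"
  let ?B' = "{p \<in> ?B. take (snd p) (fst p) = replicate (snd p) i}"
  have "(\<Sum>v\<in>?W. \<Sum>j\<le>r - length v. (c v / fact j) *\<^sub>R F (replicate j i @ v))
      = (\<Sum>p\<in>?A. (c (fst p) / fact (snd p)) *\<^sub>R F (replicate (snd p) i @ fst p))"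
    by (simp add: sum.Sigma finite_words case_prod_beta)
  also have "\<dots> = (\<Sum>p\<in>?B'. (exp_letter i (take (snd p) (fst p)) * c (drop (snd p) (fst p))) *\<^sub>R F (fst p))"
  proof (rule sum.reindex_bij_witness[where j = "\<lambda>p. (replicate (snd p) i @ fst p, snd p)" and i = "\<lambda>p. (drop (snd p) (fst p), snd p)"])
    fix p assume "p \<in> ?B'"
    then have p: "take (snd p) (fst p) = replicate (snd p) i" "snd p \<le> length (fst p)" "length (fst p) \<le> r"
      by auto
    show "(replicate (snd (drop (snd p) (fst p), snd p)) i @ fst (drop (snd p) (fst p), snd p), snd (drop (snd p) (fst p), snd p)) = p"
      using append_take_drop_id[of "snd p" "fst p"] p(1) by (simp add: prod_eq_iff)
    show "(drop (snd p) (fst p), snd p) \<in> ?A" using p by auto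
  qed (auto simp: exp_letter_def)
  also have "\<dots> = (\<Sum>p\<in>?B. (exp_letter i (take (snd p) (fst p)) * c (drop (snd p) (fst p))) *\<^sub>R F (fst p))"
  proof (rule sum.mono_neutral_left)
    show "finite ?B" by (intro finite_SigmaI finite_words) auto
  qed (auto simp: exp_letter_def min_def)
  also have "\<dots> = (\<Sum>v\<in>?W. \<Sum>k\<le>length v. (exp_letter i (take k v) * c (drop k v)) *\<^sub>R F v)"
    by (simp add: sum.Sigma finite_words case_prod_beta)
  finally show ?thesis by (simp add: conv_def scaleR_sum_left)
qed

lemma sum_words_Suc: "(\<Sum>v | length v = Suc k. F v) = (\<Sum>v | length v = k. F (False # v) + F (True # v))"
proof -
  have "{v. length v = Suc k} = (#) False ` {v. length v = k} \<union> (#) True ` {v. length v = k}"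
  proof (intro set_eqI iffI)
    fix v :: "bool list" assume "v \<in> {v. length v = Suc k}"
    then obtain i w where "v = i # w" "length w = k" by (auto simp: length_Suc_conv)
    then show "v \<in> (#) False ` {v. length v = k} \<union> (#) True ` {v. length v = k}" by (cases i) auto
  qed auto
  moreover have "(\<Sum>v\<in>(#) False ` {v. length v = k} \<union> (#) True ` {v. length v = k}. F v)
      = (\<Sum>v\<in>(#) False ` {v. length v = k}. F v) + (\<Sum>v\<in>(#) True ` {v. length v = k}. F v)"
    by (rule sum.union_disjoint) (auto intro: finite_words)
  ultimately show ?thesis by (simp add: sum.reindex sum.distrib)
qed

section \<open>Lie derivatives along the two flows\<close>

text \<open>The assumption \<open>generator_add\<close> is the whole link between
  \<open>\<phi>\<close> and the two partial flows. It concerns the norm of \<open>H 0\<close>, where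
  the mild formula can supply it.\<close>

locale splitting = compatible_flows H ip T "{\<phi>, \<phi>0, \<phi>1}"
  for H :: "nat \<Rightarrow> 'a::{real_inner, complete_space} set" and ip T \<phi> \<phi>0 \<phi>1 +
  assumes generator_add: "u \<in> H (Suc 0) \<Longrightarrow> der 0 I (\<lambda>h. \<phi>0 h u) 0 a \<Longrightarrow> der 0 I (\<lambda>h. \<phi>1 h u) 0 b
    \<Longrightarrow> der 0 I (\<lambda>h. \<phi> h u) 0 (a + b)"
begin

definition fl :: "bool \<Rightarrow> real \<Rightarrow> 'a \<Rightarrow> 'a" where
  "fl i = (if i then \<phi>1 else \<phi>0)"

definition Lie :: "(real \<Rightarrow> 'a \<Rightarrow> 'a) \<Rightarrow> nat \<Rightarrow> ('a \<Rightarrow> 'a) \<Rightarrow> 'a \<Rightarrow> 'a" where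
  "Lie f m g = (SOME g'. Cl (Suc m) (\<lambda>h x. g' (x 0)) \<and>
     (\<forall>K. \<forall>u\<in>H (K + Suc m). der K I (\<lambda>h. g (f h u)) 0 (g' u)))"

text \<open>Iterated Lie derivatives of the identity; the first letter of the word is the derivative taken last.\<close>

primrec L :: "bool list \<Rightarrow> 'a \<Rightarrow> 'a" where
  "L [] = (\<lambda>u. u)"
| "L (i # w) = Lie (fl i) (length w) (L w)"

lemma fl_in: "fl i \<in> {\<phi>, \<phi>0, \<phi>1}"
  by (simp add: fl_def)

declare T [simp]

lemma zero_in_I: "0 \<in> I"
  by simp

lemma L_Cl: "Cl (length w) (\<lambda>h x. L w (x 0))"
  and L_der_0: "u \<in> H (K + Suc (length w)) \<Longrightarrow> der K I (\<lambda>h. L w (fl i h u)) 0 (L (i # w) u)"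
proof -
  have step: "Cl (Suc (length w)) (\<lambda>h x. L (i # w) (x 0)) \<and>
      (\<forall>K. \<forall>u\<in>H (K + Suc (length w)). der K I (\<lambda>h. L w (fl i h u)) 0 (L (i # w) u))"
    if "Cl (length w) (\<lambda>h x. L w (x 0))" for w i
    unfolding L.simps Lie_def by (rule someI_ex[OF Lie_derivative_exists[OF fl_in that]])
  have Cl: "Cl (length w) (\<lambda>h x. L w (x 0))" for w
  proof (induction w)
    case Nil
    show ?case using proj[of 0] by simp
  next
    case (Cons i w)
    then show ?case using step[of w i] by simp
  qed
  show "Cl (length w) (\<lambda>h x. L w (x 0))" by (rule Cl)
  show "u \<in> H (K + Suc (length w)) \<Longrightarrow> der K I (\<lambda>h. L w (fl i h u)) 0 (L (i # w) u)"
    using step[OF Cl] by blast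
qed

lemma L_der:
  assumes "h \<in> I" "u \<in> H (K + Suc (length w))"
  shows "der K I (\<lambda>h. L w (fl i h u)) h (L (i # w) (fl i h u))"
  by (rule der_along_flow[OF fl_in L_Cl L_der_0 assms])

lemma L_cv: "cv (K + length w) y u \<Longrightarrow> cv K (\<lambda>n. L w (y n)) (L w u)"
  using seq_contD[OF Cl_seq_cont[OF L_Cl[of w]], of "\<lambda>_. 0" 0 K "\<lambda>n _. y n" "\<lambda>_. u"] by simp

text \<open>The velocity of \<open>\<phi>\<close> exists in \<open>H (length w)\<close> by
  compatibility; its value is found in \<open>H 0\<close> from \<open>generator_add\<close> and
  transferred by uniqueness. The additive map \<open>\<delta> u\<close> then splits the derivative
  of \<open>L w\<close> into the contributions of the two letters.\<close>

lemma L_der_sum_0: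
  assumes u: "u \<in> H (Suc (length w))"
  shows "der 0 I (\<lambda>h. L w (\<phi> h u)) 0 (L (False # w) u + L (True # w) u)"
proof -
  let ?m = "length w"
  obtain \<delta> where add: "\<And>u a b. u \<in> H ?m \<Longrightarrow> a \<in> H ?m \<Longrightarrow> b \<in> H ?m \<Longrightarrow> \<delta> u (a + b) = \<delta> u a + \<delta> u b"
    and \<delta>: "\<And>f u a. f \<in> {\<phi>, \<phi>0, \<phi>1} \<Longrightarrow> der ?m I (\<lambda>h. f h u) 0 a \<Longrightarrow> der 0 I (\<lambda>h. L w (f h u)) 0 (\<delta> u a)"
    using directional_derivative[OF L_Cl[of w]] by blast
  have lim: "0 islimpt I" by (rule islimpt_I) simp
  have a: "der ?m I (\<lambda>h. fl i h u) 0 (L [i] u)" for i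
    using L_der_0[of u ?m "[]" i] u by simp
  obtain g' where g': "der ?m I (\<lambda>h. \<phi> h u) 0 (g' u)"
    using Lie_derivative_exists[of \<phi> 0 "\<lambda>u. u"] proj[of 0] u by force
  have u1: "u \<in> H (Suc 0)" by (rule H_antimono[OF _ u]) simp
  have "der 0 I (\<lambda>h. \<phi> h u) 0 (L [False] u + L [True] u)"
    using der_lower[OF _ a[of False], of 0] der_lower[OF _ a[of True], of 0] u1 by (intro generator_add) (simp_all add: fl_def)
  then have "g' u = L [False] u + L [True] u"
    by (rule der_unique[OF g' _ lim])
  then have "der 0 I (\<lambda>h. L w (\<phi> h u)) 0 (\<delta> u (L [False] u + L [True] u))"
    using \<delta>[of \<phi> u "g' u"] g' by simp
  moreover have "\<delta> u (L [False] u + L [True] u) = \<delta> u (L [False] u) + \<delta> u (L [True] u)"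
    by (rule add) (use derD(3)[OF a] H_antimono[OF _ u] in auto)
  moreover have "\<delta> u (L [i] u) = L (i # w) u" for i
    by (rule der_unique[OF \<delta>[of "fl i" u "L [i] u", OF fl_in a] _ lim]) (use L_der_0[of u 0 w i] u in simp)
  ultimately show ?thesis by simp
qed

lemma L_der_sum:
  assumes "h \<in> I" and u: "u \<in> H (Suc (length w))"
  shows "der 0 I (\<lambda>h. L w (\<phi> h u)) h (L (False # w) (\<phi> h u) + L (True # w) (\<phi> h u))"
  by (rule der_along_flow[of \<phi> "length w" "L w" 0 "\<lambda>u. L (False # w) u + L (True # w) u", OF _ L_Cl])
    (use assms L_der_sum_0 in auto)

lemma der_sum: "finite A \<Longrightarrow> t \<in> S \<Longrightarrow> (\<And>a. a \<in> A \<Longrightarrow> der k S (f a) t (y a)) \<Longrightarrow> der k S (\<lambda>s. \<Sum>a\<in>A. f a s) t (\<Sum>a\<in>A. y a)"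
  by (induction A rule: finite_induct) (auto intro: der_const der_add)

text \<open>Along \<open>\<phi>\<close> the Lie derivative is the sum of those of the two letters,
  and its powers expand into all words of a given length.\<close>

lemma flow_der:
  assumes "h \<in> I" "u \<in> H (Suc k)"
  shows "der 0 I (\<lambda>h. \<Sum>v | length v = k. L v (\<phi> h u)) h (\<Sum>v | length v = Suc k. L v (\<phi> h u))"
  unfolding sum_words_Suc
  by (rule der_sum[OF finite_words(2) assms(1)]) (use assms L_der_sum in auto)

text \<open>The functions may vary with \<open>n\<close>, because in a composition of flows the base
  point moves with the step. Continuity is demanded along every null sequence, to be applied to the
  intermediate points of the remainder.\<close>

lemma taylor_small:
  assumes D: "\<And>n j t. j < r \<Longrightarrow> t \<in> I \<Longrightarrow> der 0 I (D n j) t (D n (Suc j) t)"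
    and \<tau>: "\<And>n. \<tau> n \<in> I" "\<tau> \<longlonglongrightarrow> 0"
    and cont: "\<And>\<xi>. (\<And>n. \<xi> n \<in> I) \<Longrightarrow> \<xi> \<longlonglongrightarrow> 0 \<Longrightarrow> (\<lambda>n. D n r (\<xi> n) - D n r 0) \<longlonglongrightarrow> 0"
  shows "small \<tau> r (\<lambda>n. D n 0 (\<tau> n) - (\<Sum>j\<le>r. (\<tau> n ^ j / fact j) *\<^sub>R D n j 0))"
proof -
  define e where "e n = D n 0 (\<tau> n) - (\<Sum>j\<le>r. (\<tau> n ^ j / fact j) *\<^sub>R D n j 0)" for n
  define d where "d n \<xi> = norm (D n r \<xi> - D n r 0)" for n \<xi>
  have "\<exists>\<xi>\<in>{0..\<tau> n}. norm (e n) \<le> \<tau> n ^ r * d n \<xi>" for n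
    unfolding e_def d_def by (rule taylor_remainder[of r "D n", OF D \<tau>(1)])
  then obtain \<xi> where \<xi>: "\<And>n. \<xi> n \<in> {0..\<tau> n}" and le: "\<And>n. norm (e n) \<le> \<tau> n ^ r * d n (\<xi> n)"
    by metis
  have "\<xi> \<longlonglongrightarrow> 0"
    by (rule Lim_null_comparison[OF _ \<tau>(2)]) (use \<xi> in auto)
  moreover have "\<xi> n \<in> I" for n using \<xi>[of n] \<tau>(1)[of n] by auto
  ultimately have "(\<lambda>n. d n (\<xi> n)) \<longlonglongrightarrow> 0"
    unfolding d_def by (intro tendsto_norm_zero cont)
  then have "small \<tau> r e" by (rule smallI) (rule le)
  then show ?thesis by (simp only: e_def[abs_def])
qed

text \<open>Composition with a flow acts as the exponential of its letter, up to the order that the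
  level of \<open>y\<close> permits: each power of the letter spends one of the \<open>r\<close>
  spare levels.\<close>

lemma flow_expansion:
  assumes y: "cv (length w + r) y u" and \<tau>: "\<And>n. \<tau> n \<in> I" "\<tau> \<longlonglongrightarrow> 0"
  shows "small \<tau> r (\<lambda>n. L w (fl i (\<tau> n) (y n)) - (\<Sum>j\<le>r. (\<tau> n ^ j / fact j) *\<^sub>R L (replicate j i @ w) (y n)))"
proof -
  have "small \<tau> r (\<lambda>n. L (replicate 0 i @ w) (fl i (\<tau> n) (y n))
      - (\<Sum>j\<le>r. (\<tau> n ^ j / fact j) *\<^sub>R L (replicate j i @ w) (fl i 0 (y n))))"
  proof (rule taylor_small[where D = "\<lambda>n j t. L (replicate j i @ w) (fl i t (y n))", OF _ \<tau>])
    show "der 0 I (\<lambda>t. L (replicate j i @ w) (fl i t (y n))) t (L (replicate (Suc j) i @ w) (fl i t (y n)))"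
      if "j < r" "t \<in> I" for n j t
      using L_der[of t "y n" 0 "replicate j i @ w" i] that H_antimono[OF _ cv_in(1)[OF y], of "Suc (length (replicate j i @ w))"]
      by simp
    fix \<xi> assume \<xi>: "\<And>n. \<xi> n \<in> I" "\<xi> \<longlonglongrightarrow> 0"
    let ?W = "replicate r i @ w"
    have "cv (0 + length ?W) (\<lambda>n. fl i (\<xi> n) (y n)) (fl i 0 u)"
      using y \<xi> by (intro flow_cv[OF fl_in]) (auto simp: add.commute)
    then have "cv 0 (\<lambda>n. L ?W (fl i (\<xi> n) (y n)) - L ?W (y n)) (L ?W u - L ?W u)"
      using y by (intro cv_diff L_cv) (auto simp: add.commute flow_0[OF fl_in])
    then show "(\<lambda>n. L ?W (fl i (\<xi> n) (y n)) - L ?W (fl i 0 (y n))) \<longlonglongrightarrow> 0"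
      by (simp add: cv_0 flow_0[OF fl_in])
  qed
  then show ?thesis by (simp add: flow_0[OF fl_in])
qed

section \<open>Expansion of a composition of flows\<close>

primrec comp_flow :: "bool list \<Rightarrow> real \<Rightarrow> 'a \<Rightarrow> 'a" where
  "comp_flow [] t u = u"
| "comp_flow (i # is) t u = comp_flow is t (fl i t u)"

lemma comp_flow_Cl: "Cl 0 (\<lambda>h x. comp_flow is h (x 0))"
proof (induction "is")
  case Nil
  show ?case using proj[of 0] by simp
next
  case (Cons i "is")
  then show ?case using Cl_flow_comp[OF _ fl_in, of 0 "comp_flow is" i] by simp
qed

text \<open>The later flows are expanded at the moved point \<open>fl i (\<tau> n) (y n)\<close>,
  and each resulting term \<open>L (v @ w)\<close> is expanded at \<open>y n\<close> up to order
  \<open>r - length v\<close>. The prefactor of order \<open>length v\<close> brings the error back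
  to order \<open>r\<close>, while \<open>v\<close> has used up just \<open>length v\<close> of the
  spare levels.\<close>

lemma comp_flow_expansion:
  assumes y: "cv (length w + r) y u" and \<tau>: "\<And>n. \<tau> n \<in> I" "\<tau> \<longlonglongrightarrow> 0"
  shows "small \<tau> r (\<lambda>n. L w (comp_flow is (\<tau> n) (y n))
      - (\<Sum>v | length v \<le> r. (\<tau> n ^ length v * exp_letters is v) *\<^sub>R L (v @ w) (y n)))"
  using y
proof (induction "is" arbitrary: y)
  case Nil
  have "(\<Sum>v | length v \<le> r. (\<tau> n ^ length v * delta v) *\<^sub>R L (v @ w) (y n)) = L w (y n)" for n
  proof -
    have "(\<Sum>v\<in>{v::bool list. length v \<le> r}. (\<tau> n ^ length v * delta v) *\<^sub>R L (v @ w) (y n))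
        = (\<Sum>v\<in>{[]}. (\<tau> n ^ length v * delta v) *\<^sub>R L (v @ w) (y n))"
      by (rule sum.mono_neutral_right) (auto simp: finite_words delta_def)
    then show ?thesis by (simp add: delta_def)
  qed
  then show ?case by (simp add: small_zero)
next
  case (Cons i "is")
  let ?c = "exp_letters is" and ?y = "\<lambda>n. fl i (\<tau> n) (y n)"
  have \<tau>0: "0 \<le> \<tau> n" for n using \<tau>(1)[of n] by simp
  have "cv (length w + r) ?y (fl i 0 u)"
    by (rule flow_cv[OF fl_in \<tau>(1) _ \<tau>(2) Cons.prems]) simp
  then have 1: "small \<tau> r (\<lambda>n. L w (comp_flow is (\<tau> n) (?y n))
      - (\<Sum>v | length v \<le> r. (\<tau> n ^ length v * ?c v) *\<^sub>R L (v @ w) (?y n)))"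
    by (intro Cons.IH) (simp add: flow_0[OF fl_in])
  have 2: "small \<tau> r (\<lambda>n. \<Sum>v | length v \<le> r. (\<tau> n ^ length v * ?c v) *\<^sub>R (L (v @ w) (?y n)
      - (\<Sum>j\<le>r - length v. (\<tau> n ^ j / fact j) *\<^sub>R L (replicate j i @ v @ w) (y n))))"
  proof (rule small_sum[OF finite_words(1)])
    fix v :: "bool list" assume "v \<in> {v. length v \<le> r}"
    then have v: "length v \<le> r" by simp
    have "cv (length (v @ w) + (r - length v)) y u"
      using Cons.prems v by (simp add: add.commute)
    then have "small \<tau> (length v + (r - length v)) (\<lambda>n. (\<tau> n ^ length v * ?c v) *\<^sub>R (L (v @ w) (?y n)
      - (\<Sum>j\<le>r - length v. (\<tau> n ^ j / fact j) *\<^sub>R L (replicate j i @ v @ w) (y n))))"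
      by (intro small_scale[OF flow_expansion \<tau>0] \<tau>)
    then show "small \<tau> r (\<lambda>n. (\<tau> n ^ length v * ?c v) *\<^sub>R (L (v @ w) (?y n)
      - (\<Sum>j\<le>r - length v. (\<tau> n ^ j / fact j) *\<^sub>R L (replicate j i @ v @ w) (y n))))"
      using v by simp
  qed
  have 3: "(\<Sum>v | length v \<le> r. (\<tau> n ^ length v * ?c v) *\<^sub>R (\<Sum>j\<le>r - length v. (\<tau> n ^ j / fact j) *\<^sub>R L (replicate j i @ v @ w) (y n)))
      = (\<Sum>v | length v \<le> r. (\<tau> n ^ length v * exp_letters (i # is) v) *\<^sub>R L (v @ w) (y n))" for n
    using sum_exp_letter_conv[where r = r and c = ?c and F = "\<lambda>v. \<tau> n ^ length v *\<^sub>R L (v @ w) (y n)" and i = i]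
    by (simp add: scaleR_sum_right power_add mult_ac)
  have "small \<tau> r (\<lambda>n. (L w (comp_flow is (\<tau> n) (?y n))
      - (\<Sum>v | length v \<le> r. (\<tau> n ^ length v * ?c v) *\<^sub>R L (v @ w) (?y n)))
      + (\<Sum>v | length v \<le> r. (\<tau> n ^ length v * ?c v) *\<^sub>R (L (v @ w) (?y n)
      - (\<Sum>j\<le>r - length v. (\<tau> n ^ j / fact j) *\<^sub>R L (replicate j i @ v @ w) (y n)))))"
    by (rule small_add[OF 1 2])
  then show ?case
    unfolding scaleR_diff_right sum_subtractf 3 by simp
qed

end

section \<open>The order conditions\<close>

lemma conv_delta_left [simp]: "conv delta f = f"
proof
  fix w :: "'a list"
  have "conv delta f w = (\<Sum>k\<in>{0}. delta (take k w) * f (drop k w))"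
    unfolding conv_def by (rule sum.mono_neutral_right) (auto simp: delta_def)
  then show "conv delta f w = f w" by (simp add: delta_def)
qed

lemma conv_delta_right [simp]: "conv f delta = f"
proof
  fix w :: "'a list"
  have "conv f delta w = (\<Sum>k\<in>{length w}. f (take k w) * delta (drop k w))"
    unfolding conv_def by (rule sum.mono_neutral_right) (auto simp: delta_def)
  then show "conv f delta w = f w" by (simp add: delta_def)
qed

lemma conv_assoc: "conv (conv f g) h = conv f (conv g h)"
proof
  fix w :: "'a list"
  let ?n = "length w"
  have "conv (conv f g) h w = (\<Sum>k\<le>?n. \<Sum>j\<le>k. f (take j w) * g (drop j (take k w)) * h (drop k w))"
    unfolding conv_def sum_distrib_right
    by (intro sum.cong refl) (auto simp: min_def)
  also have "\<dots> = (\<Sum>(k, j)\<in>Sigma {..?n} (\<lambda>k. {..k}). f (take j w) * g (drop j (take k w)) * h (drop k w))"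
    by (rule sum.Sigma) auto
  also have "\<dots> = (\<Sum>(j, i)\<in>Sigma {..?n} (\<lambda>j. {..?n - j}). f (take j w) * g (take i (drop j w)) * h (drop i (drop j w)))"
    by (rule sum.reindex_bij_witness[where j = "\<lambda>(k, j). (j, k - j)" and i = "\<lambda>(j, i). (i + j, j)"])
      (auto simp: drop_take)
  also have "\<dots> = (\<Sum>j\<le>?n. \<Sum>i\<le>?n - j. f (take j w) * g (take i (drop j w)) * h (drop i (drop j w)))"
    by (rule sum.Sigma[symmetric]) auto
  also have "\<dots> = conv f (conv g h) w"
    unfolding conv_def sum_distrib_left by (simp add: mult.assoc)
  finally show "conv (conv f g) h w = conv f (conv g h) w" .
qed

section \<open>Powers of formal series and change of sign\<close>

primrec conv_power :: "('b list \<Rightarrow> real) \<Rightarrow> nat \<Rightarrow> 'b list \<Rightarrow> real" where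
  "conv_power f 0 = delta"
| "conv_power f (Suc m) = conv f (conv_power f m)"

lemma conv_power_add: "conv (conv_power f i) (conv_power f j) = conv_power f (i + j)"
  by (induction i) (simp_all add: conv_assoc)

lemma exp_letters_replicate:
  "exp_letters (concat (replicate m [a, b])) = conv_power (conv (exp_letter a) (exp_letter b)) m"
  by (induction m) (simp_all add: conv_assoc)

lemma conv_power_eq_0:
  assumes "f [] = 0" "length w < j"
  shows "conv_power f j w = 0"
  using assms(2)
proof (induction j arbitrary: w)
  case (Suc j)
  have "f (take k w) * conv_power f j (drop k w) = 0" if "k \<le> length w" for k
    using Suc assms(1) that by (cases "k = 0") auto
  then show ?case unfolding conv_power.simps conv_def by (intro sum.neutral) simp
qed simp

text \<open>In a product of \<open>length w\<close> series without constant term, each factor must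
  take a single letter of \<open>w\<close>.\<close>

lemma conv_power_eq_1:
  assumes "f [] = 0" "\<And>l. f [l] = 1"
  shows "conv_power f (length w) w = 1"
proof (induction w)
  case (Cons l w)
  have "conv f (conv_power f (length w)) (l # w)
      = (\<Sum>k\<in>{1}. f (take k (l # w)) * conv_power f (length w) (drop k (l # w)))"
    unfolding conv_def
  proof (rule sum.mono_neutral_right)
    show "\<forall>k\<in>{..length (l # w)} - {1}. f (take k (l # w)) * conv_power f (length w) (drop k (l # w)) = 0"
    proof
      fix k assume k: "k \<in> {..length (l # w)} - {1}"
      show "f (take k (l # w)) * conv_power f (length w) (drop k (l # w)) = 0"
      proof (cases "k = 0")
        case False
        then have "conv_power f (length w) (drop k (l # w)) = 0"
          using k by (intro conv_power_eq_0 assms) auto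
        then show ?thesis by simp
      qed (use assms in simp)
    qed
  qed auto
  then show ?case using Cons assms by simp
qed (simp add: delta_def)

text \<open>The substitution of each letter by its negative, which is compatible with products of
  series.\<close>

definition sign_flip :: "('b list \<Rightarrow> real) \<Rightarrow> 'b list \<Rightarrow> real" where
  "sign_flip f w = (- 1) ^ length w * f w"

lemma sign_flip_conv: "sign_flip (conv f g) = conv (sign_flip f) (sign_flip g)"
proof
  fix w :: "'a list"
  have "(- 1) ^ length w = (- 1) ^ length (take k w) * (- 1 :: real) ^ length (drop k w)" for k
    by (subst append_take_drop_id[of k w, symmetric]) (simp only: length_append power_add)
  then have "(- 1) ^ length w * (x * y) = ((- 1) ^ length (take k w) * x) * ((- 1) ^ length (drop k w) * y)"
    for k and x y :: real
    by (simp only: mult_ac)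
  then show "sign_flip (conv f g) w = conv (sign_flip f) (sign_flip g) w"
    unfolding sign_flip_def conv_def sum_distrib_left by (intro sum.cong refl) blast
qed

lemma sign_flip_power: "sign_flip (conv_power f m) = conv_power (sign_flip f) m"
proof (induction m)
  case 0
  show ?case by (auto simp: sign_flip_def delta_def)
qed (simp add: sign_flip_conv)

text \<open>On a power of the letter the coefficients form an alternating sum of binomial
  coefficients; any other word has no split into two powers of \<open>i\<close>.\<close>

lemma sign_flip_exp_letter: "conv (sign_flip (exp_letter i)) (exp_letter i) = delta"
proof
  fix w :: "'a list"
  let ?n = "length w"
  show "conv (sign_flip (exp_letter i)) (exp_letter i) w = delta w"
  proof (cases "w = replicate ?n i")
    case True
    have "sign_flip (exp_letter i) (take k w) * exp_letter i (drop k w) = (- 1) ^ k * of_nat (?n choose k) / fact ?n"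
      if "k \<le> ?n" for k
    proof -
      have "take k w = replicate k i" "drop k w = replicate (?n - k) i"
        using that by (subst True, simp add: min_def)+
      then show ?thesis
        using that by (simp add: sign_flip_def exp_letter_def binomial_fact field_simps)
    qed
    then have "conv (sign_flip (exp_letter i)) (exp_letter i) w = (\<Sum>k\<le>?n. (- 1) ^ k * of_nat (?n choose k)) / fact ?n"
      unfolding conv_def sum_divide_distrib by simp
    then show ?thesis
      by (cases "w = []") (simp_all add: delta_def choose_alternating_sum)
  next
    case False
    have "sign_flip (exp_letter i) (take k w) * exp_letter i (drop k w) = 0" if "k \<le> ?n" for k
    proof (rule ccontr)
      assume "sign_flip (exp_letter i) (take k w) * exp_letter i (drop k w) \<noteq> 0"
      then have "take k w = replicate (length (take k w)) i" "drop k w = replicate (length (drop k w)) i"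
        by (auto simp: sign_flip_def exp_letter_def split: if_splits)
      then have "w = replicate (length (take k w) + length (drop k w)) i"
        by (metis append_take_drop_id replicate_add)
      then show False using False that by simp
    qed
    moreover have "delta w = 0" using False by (auto simp: delta_def)
    ultimately show ?thesis unfolding conv_def by (simp add: sum.neutral)
  qed
qed

text \<open>The power \<open>(1 + f)\<^sup>x\<close> for real \<open>x\<close>, by the binomial series. It makes the \<open>m\<close>-fold product
  polynomial in \<open>m\<close>, and gives a meaning to negative \<open>m\<close>.\<close>

definition binomial_power :: "('b list \<Rightarrow> real) \<Rightarrow> real \<Rightarrow> 'b list \<Rightarrow> real" where
  "binomial_power f x w = (\<Sum>j\<le>length w. (x gchoose j) * conv_power f j w)"

text \<open>High powers of \<open>f\<close> vanish on short words, so both factors of a product can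
  be truncated at one common bound.\<close>

lemma binomial_power_bound:
  assumes "f [] = 0" "length w \<le> M"
  shows "binomial_power f x w = (\<Sum>j\<le>M. (x gchoose j) * conv_power f j w)"
  unfolding binomial_power_def
  by (rule sum.mono_neutral_left) (use assms in \<open>auto simp: conv_power_eq_0\<close>)

text \<open>The law of exponents. Once the pairs with \<open>i + j\<close> beyond the length are
  dropped, it reduces to Vandermonde's convolution for real arguments.\<close>

lemma binomial_power_add:
  assumes f: "f [] = 0"
  shows "conv (binomial_power f x) (binomial_power f y) = binomial_power f (x + y)"
proof
  fix w :: "'a list"
  let ?M = "length w"
  have "conv (binomial_power f x) (binomial_power f y) w
      = (\<Sum>k\<le>?M. (\<Sum>i\<le>?M. (x gchoose i) * conv_power f i (take k w)) * (\<Sum>j\<le>?M. (y gchoose j) * conv_power f j (drop k w)))"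
    unfolding conv_def by (intro sum.cong refl arg_cong2[of _ _ _ _ "(*)"] binomial_power_bound[of f, OF f]) auto
  also have "\<dots> = (\<Sum>k\<le>?M. \<Sum>i\<le>?M. \<Sum>j\<le>?M. (x gchoose i) * (y gchoose j) * (conv_power f i (take k w) * conv_power f j (drop k w)))"
    by (simp add: sum_product mult_ac)
  also have "\<dots> = (\<Sum>i\<le>?M. \<Sum>k\<le>?M. \<Sum>j\<le>?M. (x gchoose i) * (y gchoose j) * (conv_power f i (take k w) * conv_power f j (drop k w)))"
    by (rule sum.swap)
  also have "\<dots> = (\<Sum>i\<le>?M. \<Sum>j\<le>?M. \<Sum>k\<le>?M. (x gchoose i) * (y gchoose j) * (conv_power f i (take k w) * conv_power f j (drop k w)))"
    by (intro sum.cong refl sum.swap)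
  also have "\<dots> = (\<Sum>i\<le>?M. \<Sum>j\<le>?M. (x gchoose i) * (y gchoose j) * conv_power f (i + j) w)"
    by (simp add: conv_power_add[symmetric] conv_def sum_distrib_left)
  also have "\<dots> = (\<Sum>i\<le>?M. \<Sum>j\<le>?M - i. (x gchoose i) * (y gchoose j) * conv_power f (i + j) w)"
    by (intro sum.cong refl sum.mono_neutral_right) (auto simp: conv_power_eq_0[of f, OF f])
  also have "\<dots> = (\<Sum>(i, j)\<in>Sigma {..?M} (\<lambda>i. {..?M - i}). (x gchoose i) * (y gchoose j) * conv_power f (i + j) w)"
    by (rule sum.Sigma) auto
  also have "\<dots> = (\<Sum>(s, i)\<in>Sigma {..?M} (\<lambda>s. {..s}). (x gchoose i) * (y gchoose (s - i)) * conv_power f s w)"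
    by (rule sum.reindex_bij_witness[where i = "\<lambda>(s, i). (i, s - i)" and j = "\<lambda>(i, j). (i + j, i)"]) auto
  also have "\<dots> = (\<Sum>s\<le>?M. \<Sum>i\<le>s. (x gchoose i) * (y gchoose (s - i)) * conv_power f s w)"
    by (rule sum.Sigma[symmetric]) auto
  also have "\<dots> = (\<Sum>s\<le>?M. ((x + y) gchoose s) * conv_power f s w)"
    by (simp add: gbinomial_Vandermonde[symmetric] sum_distrib_right atMost_atLeast0)
  finally show "conv (binomial_power f x) (binomial_power f y) w = binomial_power f (x + y) w"
    by (simp add: binomial_power_def)
qed

lemma binomial_power_0: "binomial_power f 0 = delta"
proof
  fix w :: "'a list"
  have "binomial_power f 0 w = (\<Sum>j\<in>{0}. (0 gchoose j) * conv_power f j w)"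
    unfolding binomial_power_def by (rule sum.mono_neutral_right) (auto simp: gr0_conv_Suc)
  then show "binomial_power f 0 w = delta w" by simp
qed

lemma binomial_power_1:
  assumes "f [] = 0"
  shows "binomial_power f 1 = (\<lambda>w. delta w + f w)"
proof
  fix w :: "'a list"
  have z: "(1::real) gchoose j = 0" if "1 < j" for j
    using that binomial_gbinomial[of 1 j, where 'a = real, symmetric] binomial_eq_0[of 1 j] by simp
  have "binomial_power f 1 w = (\<Sum>j\<le>Suc (length w). (1 gchoose j) * conv_power f j w)"
    by (rule binomial_power_bound[of f, OF assms]) simp
  also have "\<dots> = (\<Sum>j\<in>{0, 1}. (1 gchoose j) * conv_power f j w)"
    by (rule sum.mono_neutral_right) (auto simp: z)
  finally show "binomial_power f 1 w = delta w + f w" by simp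
qed

lemma binomial_power_multiple:
  assumes "f [] = 0"
  shows "conv_power (binomial_power f x) m = binomial_power f (real m * x)"
  by (induction m) (simp_all add: binomial_power_0 binomial_power_add[of f, OF assms] algebra_simps)

text \<open>Reversing the order of the two factors amounts to inverting and changing the sign of both
  letters.\<close>

lemma exp_letters_polynomial:
  fixes w :: "bool list"
  assumes "a \<noteq> b"
  obtains c where "c (length w) = 1 / fact (length w)" "w \<noteq> [] \<Longrightarrow> c 0 = 0"
    "\<And>m. exp_letters (concat (replicate m [a, b])) w = (\<Sum>i\<le>length w. c i * real m ^ i)"
    "\<And>m. exp_letters (concat (replicate m [b, a])) w = (- 1) ^ length w * (\<Sum>i\<le>length w. c i * (- real m) ^ i)"
proof -
  define P where "P = conv (exp_letter a) (exp_letter b)"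
  define P' where "P' = conv (exp_letter b) (exp_letter a)"
  define f where "f w = P w - delta w" for w
  have f0: "f [] = 0"
    by (simp add: f_def P_def conv_def exp_letter_def delta_def)
  \<comment> \<open>Since \<open>a \<noteq> b\<close>, each of the two letters occurs in exactly one
    factor, whence the coefficient 1. This normalises the leading coefficient found below.\<close>
  have f1: "f [l] = 1" for l
    using assms by (cases a; cases b; cases l) (auto simp: f_def P_def conv_def exp_letter_def delta_def)
  have P: "P = binomial_power f 1"
    using binomial_power_1[of f, OF f0] by (simp add: f_def)
  have "conv (sign_flip P') P = conv (sign_flip (exp_letter b)) (conv (conv (sign_flip (exp_letter a)) (exp_letter a)) (exp_letter b))"
    unfolding P_def P'_def sign_flip_conv conv_assoc ..
  also have "\<dots> = delta" by (simp add: sign_flip_exp_letter)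
  \<comment> \<open>The series \<open>sign_flip P'\<close> is a left inverse of \<open>P\<close>;
    multiplication from the right by the power with exponent -1 identifies it with that
    power.\<close>
  finally have "conv (conv (sign_flip P') P) (binomial_power f (- 1)) = binomial_power f (- 1)" by simp
  then have P': "sign_flip P' = binomial_power f (- 1)"
    unfolding conv_assoc P binomial_power_add[of f, OF f0] by (simp add: binomial_power_0)
  have plus: "exp_letters (concat (replicate m [a, b])) w = binomial_power f (real m) w" for m
    unfolding exp_letters_replicate P_def[symmetric] P binomial_power_multiple[of f, OF f0] by simp
  have "sign_flip (exp_letters (concat (replicate m [b, a]))) w = binomial_power f (- real m) w" for m
    unfolding exp_letters_replicate P'_def[symmetric] sign_flip_power P' binomial_power_multiple[of f, OF f0] by simp
  moreover have "g w = (- 1) ^ length w * sign_flip g w" for g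
    unfolding sign_flip_def by (simp add: power_mult_distrib[symmetric] flip: mult.assoc)
  ultimately have minus: "exp_letters (concat (replicate m [b, a])) w = (- 1) ^ length w * binomial_power f (- real m) w" for m
    by metis
  \<comment> \<open>The binomial coefficient is a polynomial of degree at most \<open>j\<close> with
    coefficient \<open>1 / fact j\<close> at \<open>j\<close>, so the top coefficient of
    \<open>Q\<close> receives a contribution from the power \<open>j = length w\<close>
    alone.\<close>
  have "\<exists>q::real poly. (\<forall>x. poly q x = x gchoose j) \<and> degree q \<le> j \<and> coeff q j = 1 / fact j" for j
  proof (induction j)
    case 0
    show ?case by (rule exI[of _ 1]) simp
  next
    case (Suc j)
    then obtain q where q: "\<And>x::real. poly q x = x gchoose j" "degree q \<le> j" "coeff q j = 1 / fact j" by blast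
    let ?q = "smult (1 / real (Suc j)) ([:- real j, 1:] * q)"
    have "poly ?q x = x gchoose Suc j" for x
      using gbinomial_absorption'[of "Suc j" x] gbinomial_mult_1[of x j] q(1)[of x] by (simp add: field_simps del: of_nat_Suc)
    moreover have "degree ?q \<le> Suc j"
      using q(2) degree_mult_le[of "[:- real j, 1:]" q] by (auto intro: order_trans[OF degree_smult_le])
    moreover have "coeff ?q (Suc j) = 1 / real (Suc j) * coeff q j"
      using q(2) coeff_eq_0[of q "Suc j"] by simp
    then have "coeff ?q (Suc j) = 1 / fact (Suc j)"
      unfolding q(3) by simp
    ultimately show ?case by blast
  qed
  then obtain q where q: "\<And>j x::real. poly (q j) x = x gchoose j" "\<And>j. degree (q j) \<le> j" "\<And>j. coeff (q j) j = 1 / fact j"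
    by metis
  define Q where "Q = (\<Sum>j\<le>length w. smult (conv_power f j w) (q j))"
  have Q: "poly Q x = binomial_power f x w" for x
    by (simp add: Q_def poly_sum q binomial_power_def mult.commute)
  have deg: "degree Q \<le> length w"
    unfolding Q_def using q(2) by (intro degree_sum_le) (auto intro: order_trans[OF degree_smult_le] order_trans)
  have "coeff Q (length w) = (\<Sum>j\<le>length w. conv_power f j w * coeff (q j) (length w))"
    by (simp add: Q_def coeff_sum)
  also have "\<dots> = (\<Sum>j\<in>{length w}. conv_power f j w * coeff (q j) (length w))"
    by (rule sum.mono_neutral_right) (auto intro!: coeff_eq_0 le_less_trans[OF q(2)])
  also have "\<dots> = 1 / fact (length w)"
    using conv_power_eq_1[of f w] f0 f1 q(3) by simp
  finally have top: "coeff Q (length w) = 1 / fact (length w)" .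
  \<comment> \<open>At \<open>x = 0\<close> the binomial power is the unit series, which vanishes on
    nonempty words.\<close>
  have "coeff Q 0 = 0" if "w \<noteq> []"
    using Q[of 0] that by (simp add: poly_0_coeff_0 binomial_power_0 delta_def)
  moreover have "poly Q x = (\<Sum>i\<le>length w. coeff Q i * x ^ i)" for x
    unfolding poly_altdef by (rule sum.mono_neutral_left) (use deg in \<open>auto simp: coeff_eq_0\<close>)
  ultimately show ?thesis
    using that[of "coeff Q"] top plus minus Q by simp
qed

text \<open>With k the length of \<open>w\<close>, the coefficient \<open>c i\<close> meets the sum
  of \<gamma> m / m^(k - i), doubled if k - i is even and cancelled if it is odd. For i = k the
  doubling offsets the value 1/2 of the sum. For even k - i > 0 an order condition applies, except
  when k = 2 n and i = 0, and there \<open>c 0\<close> vanishes.\<close>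

lemma order_conditions:
  fixes w :: "bool list"
  assumes "a \<noteq> b" and len: "length w \<le> 2 * n"
    and half: "(\<Sum>m=1..s. \<gamma> m) = 1 / 2"
    and zero: "\<And>k. 1 \<le> k \<Longrightarrow> k < n \<Longrightarrow> (\<Sum>m=1..s. \<gamma> m / real m ^ (2 * k)) = 0"
  shows "(\<Sum>m=1..s. \<gamma> m / real m ^ length w *
      (exp_letters (concat (replicate m [a, b])) w + exp_letters (concat (replicate m [b, a])) w)) = 1 / fact (length w)"
proof -
  let ?k = "length w"
  obtain c where c: "c ?k = 1 / fact ?k" "w \<noteq> [] \<Longrightarrow> c 0 = 0"
    "\<And>m. exp_letters (concat (replicate m [a, b])) w = (\<Sum>i\<le>?k. c i * real m ^ i)"
    "\<And>m. exp_letters (concat (replicate m [b, a])) w = (- 1) ^ ?k * (\<Sum>i\<le>?k. c i * (- real m) ^ i)"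
    using exp_letters_polynomial[OF assms(1), of w] by blast
  have summand: "\<gamma> m / real m ^ ?k * (exp_letters (concat (replicate m [a, b])) w + exp_letters (concat (replicate m [b, a])) w)
      = (\<Sum>i\<le>?k. c i * (1 + (- 1) ^ (?k + i)) * (\<gamma> m / real m ^ (?k - i)))" if "1 \<le> m" for m
  proof -
    have "exp_letters (concat (replicate m [a, b])) w + exp_letters (concat (replicate m [b, a])) w
        = (\<Sum>i\<le>?k. c i * (1 + (- 1) ^ (?k + i)) * real m ^ i)"
      unfolding c(3,4) sum_distrib_left sum.distrib[symmetric]
      by (intro sum.cong refl) (simp add: power_add power_minus[of "real m"] algebra_simps)
    moreover have "\<gamma> m / real m ^ ?k * (x * real m ^ i) = x * (\<gamma> m / real m ^ (?k - i))" if "i \<le> ?k" for x i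
      using \<open>1 \<le> m\<close> that by (simp add: power_diff field_simps)
    ultimately show ?thesis by (simp add: sum_distrib_left)
  qed
  have coef: "c i * (1 + (- 1) ^ (?k + i)) * (\<Sum>m=1..s. \<gamma> m / real m ^ (?k - i)) = (if i = ?k then 1 / fact ?k else 0)"
    if i: "i \<le> ?k" for i
  proof -
    consider "i = ?k" | "i < ?k" "odd (?k + i)" | "i < ?k" "even (?k + i)" "i = 0" | "i < ?k" "even (?k + i)" "0 < i"
      using i by linarith
    then show ?thesis
    proof cases
      case 1
      have "even (?k + ?k)" by simp
      then have "(- 1 :: real) ^ (?k + ?k) = 1" by simp
      then show ?thesis using 1 c(1) half by simp
    next
      case 3
      then have "c i = 0" using c(2) by auto
      then show ?thesis using 3 by simp
    next
      case 4
      then have "even (?k - i)" by simp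
      then obtain l where l: "?k - i = 2 * l" by blast
      \<comment> \<open>Positivity of \<open>i\<close> is what makes \<open>2 * l\<close> strictly
        smaller than \<open>2 * n\<close>.\<close>
      then have "1 \<le> l" "l < n" using 4 len by linarith+
      then have "(\<Sum>m=1..s. \<gamma> m / real m ^ (?k - i)) = 0"
        unfolding l by (rule zero)
      then show ?thesis using 4 by simp
    qed simp
  qed
  have "(\<Sum>m=1..s. \<gamma> m / real m ^ ?k * (exp_letters (concat (replicate m [a, b])) w + exp_letters (concat (replicate m [b, a])) w))
      = (\<Sum>m=1..s. \<Sum>i\<le>?k. c i * (1 + (- 1) ^ (?k + i)) * (\<gamma> m / real m ^ (?k - i)))"
    by (intro sum.cong refl summand) simp
  also have "\<dots> = (\<Sum>i\<le>?k. c i * (1 + (- 1) ^ (?k + i)) * (\<Sum>m=1..s. \<gamma> m / real m ^ (?k - i)))"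
    unfolding sum_distrib_left by (rule sum.swap)
  also have "\<dots> = (\<Sum>i\<le>?k. if i = ?k then 1 / fact ?k else 0)"
    by (intro sum.cong refl coef) simp
  finally show ?thesis by simp
qed

section \<open>Order of the affine integrator\<close>

text \<open>\<open>vector_derivative\<close> is defined by choice; at limit points of
  \<open>S\<close> a known derivative determines it, so a chain of derivatives computes all the
  iterates.\<close>

lemma nth_deriv_eqI:
  assumes lim: "\<And>h. h \<in> S \<Longrightarrow> h islimpt S"
    and D: "\<And>j h. j < q \<Longrightarrow> h \<in> S \<Longrightarrow> (D j has_vector_derivative D (Suc j) h) (at h within S)"
  shows "times_differentiable_on q (D 0) S"
    and "k \<le> q \<Longrightarrow> h \<in> S \<Longrightarrow> nth_deriv S k (D 0) h = D k h"
proof -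
  have eq: "nth_deriv S k (D 0) h = D k h" if "k \<le> q" "h \<in> S" for k h
    using that
  proof (induction k arbitrary: h)
    case (Suc k)
    have "(nth_deriv S k (D 0) has_vector_derivative D (Suc k) h) (at h within S)"
      by (rule has_vector_derivative_transform[OF Suc.prems(2) _ D]) (use Suc in auto)
    then show ?case
      using lim[OF Suc.prems(2)] by (simp add: vector_derivative_within trivial_limit_within)
  qed simp
  have "nth_deriv S j (D 0) differentiable at h within S" if "j < q" "h \<in> S" for j h
  proof -
    have "(nth_deriv S j (D 0) has_vector_derivative D (Suc j) h) (at h within S)"
      by (rule has_vector_derivative_transform[OF that(2) _ D]) (use that eq in auto)
    then show ?thesis by (rule differentiableI_vector)
  qed
  then show "times_differentiable_on q (D 0) S" by (simp add: times_differentiable_on_def)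
  show "k \<le> q \<Longrightarrow> h \<in> S \<Longrightarrow> nth_deriv S k (D 0) h = D k h" by (rule eq)
qed

context splitting
begin

text \<open>\<open>comp_flow\<close> applies its first letter first, and \<open>False\<close> stands
  for \<open>\<phi>0\<close>: the composition of \<open>\<phi>1\<close> after \<open>\<phi>0\<close>
  belongs to the word \<open>[False, True]\<close>.\<close>

lemma lie_powers:
  "(lie_plus \<phi>0 \<phi>1 t ^^ m) u = comp_flow (concat (replicate m [False, True])) t u"
  "(lie_minus \<phi>0 \<phi>1 t ^^ m) u = comp_flow (concat (replicate m [True, False])) t u"
  by (induction m arbitrary: u) (simp_all add: lie_plus_def lie_minus_def fl_def funpow_Suc_right del: funpow.simps(2))

lemma Cl_time_derivatives:
  assumes "Cl 0 G"
  obtains D where "D 0 = G" "\<And>k. Cl k (D k)" "\<And>k. time_der k (D k) (D (Suc k))"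
proof -
  have "\<exists>D. \<forall>k. (Cl k (D k) \<and> (k = 0 \<longrightarrow> D k = G)) \<and> time_der k (D k) (D (Suc k))"
  proof (rule dependent_nat_choice)
    show "\<exists>D. Cl 0 D \<and> (0 = (0::nat) \<longrightarrow> D = G)" using assms by blast
    fix D and k :: nat assume "Cl k D \<and> (k = 0 \<longrightarrow> D = G)"
    then obtain D' where "Cl (Suc k) D'" "time_der k D D'" using Cl_differentiable by blast
    then show "\<exists>D'. (Cl (Suc k) D' \<and> (Suc k = 0 \<longrightarrow> D' = G)) \<and> time_der k D D'" by auto
  qed
  then show ?thesis using that by blast
qed

lemma sum_words_by_length:
  "(\<Sum>v | length v \<le> q. F v) = (\<Sum>k\<le>q. \<Sum>v | length v = k. F (v::bool list))"
proof -
  have "(\<Sum>k\<in>{..q}. \<Sum>v\<in>{v \<in> {v::bool list. length v \<le> q}. length v = k}. F v) = (\<Sum>v | length v \<le> q. F v)"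
    by (rule sum.group) (auto simp: finite_words)
  moreover have "{v \<in> {v::bool list. length v \<le> q}. length v = k} = {v. length v = k}" if "k \<le> q" for k
    using that by auto
  ultimately show ?thesis by simp
qed

text \<open>The substep \<open>\<tau> n / real m\<close> contributes a factor
  \<open>1 / real m ^ length v\<close> for each word \<open>v\<close>, so the coefficient of
  \<open>L v u\<close> contains exactly the sum evaluated in \<open>order_conditions\<close>. The
  target is e^(X+Y), in which every word of length k has coefficient 1/k!.\<close>

lemma affine_integrator_expansion:
  assumes u: "u \<in> H q" and q: "q = 2 * p"
    and half: "(\<Sum>m=1..s. \<gamma> m) = 1 / 2"
    and zero: "\<And>k. 1 \<le> k \<Longrightarrow> k < p \<Longrightarrow> (\<Sum>m=1..s. \<gamma> m / real m ^ (2 * k)) = 0"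
    and \<tau>: "\<And>n. \<tau> n \<in> I" "\<tau> \<longlonglongrightarrow> 0"
  shows "small \<tau> q (\<lambda>n. affine_integrator s \<gamma> \<phi>0 \<phi>1 (\<tau> n) u - (\<Sum>k\<le>q. (\<tau> n ^ k / fact k) *\<^sub>R (\<Sum>v | length v = k. L v u)))"
proof -
  let ?W = "{v::bool list. length v \<le> q}"
  \<comment> \<open>With \<open>i = False\<close> the word belongs to the power of
    \<open>lie_plus\<close>, with \<open>i = True\<close> to that of
    \<open>lie_minus\<close>.\<close>
  let ?w = "\<lambda>m i. concat (replicate m [i, \<not> i])"
  let ?E = "\<lambda>m i n. \<Sum>v\<in>?W. ((\<tau> n / real m) ^ length v * exp_letters (?w m i) v) *\<^sub>R L v u"
  have 1: "small \<tau> q (\<lambda>n. comp_flow (?w m i) (\<tau> n / real m) u - ?E m i n)" if m: "1 \<le> m" for m i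
  proof -
    have I: "1 / real m * \<tau> n \<in> I" for n
      by (rule scaled_time_in[OF _ _ \<tau>(1)]) (use m in auto)
    have lim: "(\<lambda>n. 1 / real m * \<tau> n) \<longlonglongrightarrow> 0" by (rule tendsto_mult_right_zero[OF \<tau>(2)])
    have "small (\<lambda>n. 1 / real m * \<tau> n) q (\<lambda>n. L [] (comp_flow (?w m i) (1 / real m * \<tau> n) u)
        - (\<Sum>v\<in>?W. ((1 / real m * \<tau> n) ^ length v * exp_letters (?w m i) v) *\<^sub>R L (v @ []) u))"
      by (rule comp_flow_expansion[where y = "\<lambda>_. u" and u = u and w = "[]" and \<tau> = "\<lambda>n. 1 / real m * \<tau> n", OF _ I lim])
        (use u in simp)
    then have "small \<tau> q (\<lambda>n. L [] (comp_flow (?w m i) (1 / real m * \<tau> n) u)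
        - (\<Sum>v\<in>?W. ((1 / real m * \<tau> n) ^ length v * exp_letters (?w m i) v) *\<^sub>R L (v @ []) u))"
      by (rule small_time_scale)
    then show ?thesis by simp
  qed
  have \<tau>0: "0 \<le> \<tau> n" for n using \<tau>(1)[of n] by simp
  have 2: "small \<tau> q (\<lambda>n. \<Sum>m\<in>{1..s}. \<gamma> m *\<^sub>R ((comp_flow (?w m False) (\<tau> n / real m) u - ?E m False n)
      + (comp_flow (?w m True) (\<tau> n / real m) u - ?E m True n)))"
  proof (rule small_sum)
    fix m assume "m \<in> {1..s}"
    then have m: "1 \<le> m" by simp
    show "small \<tau> q (\<lambda>n. \<gamma> m *\<^sub>R ((comp_flow (?w m False) (\<tau> n / real m) u - ?E m False n)
      + (comp_flow (?w m True) (\<tau> n / real m) u - ?E m True n)))"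
      using small_scale[OF small_add[OF 1[OF m, of False] 1[OF m, of True]] \<tau>0, of 0 "\<gamma> m"] by simp
  qed simp
  have "(\<Sum>m\<in>{1..s}. \<gamma> m *\<^sub>R (?E m False n + ?E m True n)) = (\<Sum>k\<le>q. (\<tau> n ^ k / fact k) *\<^sub>R (\<Sum>v | length v = k. L v u))" for n
  proof -
    let ?c = "\<lambda>m v. exp_letters (?w m False) v + exp_letters (?w m True) v"
    have "\<gamma> m *\<^sub>R (?E m False n + ?E m True n) = (\<Sum>v\<in>?W. (\<tau> n ^ length v * (\<gamma> m / real m ^ length v * ?c m v)) *\<^sub>R L v u)" for m
      unfolding sum.distrib[symmetric] scaleR_sum_right
      by (intro sum.cong refl) (simp add: scaleR_add_left[symmetric] power_divide distrib_left mult_ac)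
    then have "(\<Sum>m\<in>{1..s}. \<gamma> m *\<^sub>R (?E m False n + ?E m True n))
        = (\<Sum>v\<in>?W. \<Sum>m\<in>{1..s}. (\<tau> n ^ length v * (\<gamma> m / real m ^ length v * ?c m v)) *\<^sub>R L v u)"
      by (simp only: sum.swap[of _ ?W])
    also have "\<dots> = (\<Sum>v\<in>?W. (\<tau> n ^ length v * (\<Sum>m=1..s. \<gamma> m / real m ^ length v * ?c m v)) *\<^sub>R L v u)"
      by (simp add: scaleR_sum_left sum_distrib_left)
    also have "\<dots> = (\<Sum>v\<in>?W. (\<tau> n ^ length v / fact (length v)) *\<^sub>R L v u)"
    proof (intro sum.cong refl)
      fix v assume "v \<in> ?W"
      then have len: "length v \<le> 2 * p" using q by simp
      have "(\<Sum>m=1..s. \<gamma> m / real m ^ length v * ?c m v) = 1 / fact (length v)"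
        using order_conditions[OF _ len half zero, of False True] by simp
      then show "(\<tau> n ^ length v * (\<Sum>m=1..s. \<gamma> m / real m ^ length v * ?c m v)) *\<^sub>R L v u
          = (\<tau> n ^ length v / fact (length v)) *\<^sub>R L v u" by simp
    qed
    also have "\<dots> = (\<Sum>k\<le>q. \<Sum>v | length v = k. (\<tau> n ^ length v / fact (length v)) *\<^sub>R L v u)"
      by (rule sum_words_by_length)
    finally show ?thesis by (simp add: scaleR_sum_right)
  qed
  moreover have "affine_integrator s \<gamma> \<phi>0 \<phi>1 (\<tau> n) u =
      (\<Sum>m\<in>{1..s}. \<gamma> m *\<^sub>R (comp_flow (?w m False) (\<tau> n / real m) u + comp_flow (?w m True) (\<tau> n / real m) u))" for n
    by (simp add: affine_integrator_def lie_powers)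
  moreover have "(\<lambda>n. \<Sum>m\<in>{1..s}. \<gamma> m *\<^sub>R ((comp_flow (?w m False) (\<tau> n / real m) u - ?E m False n)
      + (comp_flow (?w m True) (\<tau> n / real m) u - ?E m True n)))
    = (\<lambda>n. (\<Sum>m\<in>{1..s}. \<gamma> m *\<^sub>R (comp_flow (?w m False) (\<tau> n / real m) u + comp_flow (?w m True) (\<tau> n / real m) u))
      - (\<Sum>m\<in>{1..s}. \<gamma> m *\<^sub>R (?E m False n + ?E m True n)))"
    unfolding sum_subtractf[symmetric] scaleR_diff_right[symmetric] by (simp add: algebra_simps)
  ultimately show ?thesis using 2 by (simp only:)
qed

text \<open>An expansion along sequences at 0 does not yield derivatives. Membership in the class
  does, at one level per derivative, hence up to order \<open>q\<close> on
  \<open>H q\<close>.\<close>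

lemma affine_integrator_Cl:
  "Cl 0 (\<lambda>h x. affine_integrator s \<gamma> \<phi>0 \<phi>1 h (x 0))"
proof -
  have c: "Cl 0 (\<lambda>h x. comp_flow w (h / real (Suc r)) (x 0))" for w r
    using time[OF comp_flow_Cl[of w], of "1 / real (Suc r)"] by simp
  have "Cl 0 (\<lambda>h x. \<Sum>r<s. \<gamma> (Suc r) *\<^sub>R (comp_flow (concat (replicate (Suc r) [False, True])) (h / real (Suc r)) (x 0)
      + comp_flow (concat (replicate (Suc r) [True, False])) (h / real (Suc r)) (x 0)))"
    by (rule Cl_sum, rule scale, rule add) (rule c)+
  then show ?thesis
    unfolding affine_integrator_def lie_powers One_nat_def sum.atLeast1_atMost_eq .
qed

text \<open>The integrator has two expansions of order \<open>q\<close>: Taylor's formula with its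
  own derivatives, and the expansion in words. Their difference is a polynomial in the step that is
  small to order \<open>q\<close>, so the coefficients agree. For \<open>\<phi>\<close> the
  derivatives at 0 are the same sums over words by \<open>flow_der\<close>.\<close>

lemma affine_integrator_order:
  assumes u: "u \<in> H q" and q: "q = 2 * n"
    and half: "(\<Sum>m=1..s. \<gamma> m) = 1 / 2"
    and zero: "\<And>k. 1 \<le> k \<Longrightarrow> k < n \<Longrightarrow> (\<Sum>m=1..s. \<gamma> m / real m ^ (2 * k)) = 0"
  shows "times_differentiable_on q (\<lambda>h. affine_integrator s \<gamma> \<phi>0 \<phi>1 h u) I"
    and "times_differentiable_on q (\<lambda>h. \<phi> h u) I"
    and "k \<le> q \<Longrightarrow> nth_deriv I k (\<lambda>h. affine_integrator s \<gamma> \<phi>0 \<phi>1 h u) 0 = nth_deriv I k (\<lambda>h. \<phi> h u) 0"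
proof -
  define E where "E k h = (\<Sum>v | length v = k. L v (\<phi> h u))" for k h
  have E0: "E 0 = (\<lambda>h. \<phi> h u)" by (simp add: E_def[abs_def])
  have dE: "der 0 I (E k) h (E (Suc k) h)" if "k < q" "h \<in> I" for k h
    unfolding E_def[abs_def] using that u by (intro flow_der) (auto intro: H_antimono[of "Suc k" q])
  then have "(E k has_vector_derivative E (Suc k) h) (at h within I)" if "k < q" "h \<in> I" for k h
    using that by (simp add: der_0_iff)
  note E = nth_deriv_eqI[where D = E and q = q, OF islimpt_I this, unfolded E0]
  obtain G where G0: "G 0 = (\<lambda>h x. affine_integrator s \<gamma> \<phi>0 \<phi>1 h (x 0))"
    and G: "\<And>k. Cl k (G k)" "\<And>k. time_der k (G k) (G (Suc k))"
    using Cl_time_derivatives[OF affine_integrator_Cl] by blast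
  define D where "D k h = G k h (\<lambda>_. u)" for k h
  have D0: "D 0 = (\<lambda>h. affine_integrator s \<gamma> \<phi>0 \<phi>1 h u)" by (simp add: D_def[abs_def] G0)
  have dD: "der 0 I (D k) h (D (Suc k) h)" if "k < q" "h \<in> I" for k h
    unfolding D_def[abs_def] using that u by (intro time_derD[OF G(2)]) (auto intro: H_antimono[of "Suc k" q])
  then have "(D k has_vector_derivative D (Suc k) h) (at h within I)" if "k < q" "h \<in> I" for k h
    using that by (simp add: der_0_iff)
  note D = nth_deriv_eqI[where D = D and q = q, OF islimpt_I this, unfolded D0]
  show "times_differentiable_on q (\<lambda>h. affine_integrator s \<gamma> \<phi>0 \<phi>1 h u) I" by (rule D(1))
  show "times_differentiable_on q (\<lambda>h. \<phi> h u) I" by (rule E(1))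
  \<comment> \<open>Any positive null sequence in \<open>I\<close> would do; positivity serves the
    comparison of coefficients.\<close>
  define \<tau> where "\<tau> n = T / 2 * inverse (real (Suc n))" for n
  have \<tau>pos: "0 < \<tau> n" for n by (simp add: \<tau>_def)
  have le: "\<tau> n \<le> T / 2 * 1" for n
    unfolding \<tau>_def by (intro mult_left_mono) (simp_all add: inverse_le_1_iff less_imp_le)
  have "\<tau> n < T" for n using le[of n] T by linarith
  then have \<tau>I: "\<tau> n \<in> I" for n using \<tau>pos[of n] by (simp add: less_imp_le)
  have "(\<lambda>n. T / 2 * inverse (real (Suc n))) \<longlonglongrightarrow> T / 2 * 0"
    by (intro tendsto_mult tendsto_const LIMSEQ_inverse_real_of_nat)
  then have \<tau>0: "\<tau> \<longlonglongrightarrow> 0" by (simp add: \<tau>_def[abs_def])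
  have "small \<tau> q (\<lambda>n. D 0 (\<tau> n) - (\<Sum>j\<le>q. (\<tau> n ^ j / fact j) *\<^sub>R D j 0))"
  proof (rule taylor_small[where D = "\<lambda>_. D", OF dD \<tau>I \<tau>0])
    fix \<xi> assume "\<And>n. \<xi> n \<in> I" "\<xi> \<longlonglongrightarrow> 0"
    then have "cv 0 (\<lambda>n. D q (\<xi> n)) (D q 0)"
      unfolding D_def using u by (intro seq_contD[OF Cl_seq_cont[OF G(1)]]) auto
    then show "(\<lambda>n. D q (\<xi> n) - D q 0) \<longlonglongrightarrow> 0" by (simp add: cv_0 LIM_zero)
  qed
  from small_diff[OF affine_integrator_expansion[OF assms \<tau>I \<tau>0] this]
  have "small \<tau> q (\<lambda>n. (\<Sum>j\<le>q. (\<tau> n ^ j / fact j) *\<^sub>R D j 0) - (\<Sum>j\<le>q. (\<tau> n ^ j / fact j) *\<^sub>R (\<Sum>v | length v = j. L v u)))"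
    unfolding D0 by (simp add: algebra_simps)
  then have "small \<tau> q (\<lambda>n. \<Sum>j\<le>q. \<tau> n ^ j *\<^sub>R ((1 / fact j) *\<^sub>R (D j 0 - (\<Sum>v | length v = j. L v u))))"
    by (simp add: sum_subtractf[symmetric] scaleR_diff_right)
  then have "(1 / fact k) *\<^sub>R (D k 0 - (\<Sum>v | length v = k. L v u)) = 0" if "k \<le> q" for k
    using small_polynomial[where c = "\<lambda>j. (1 / fact j) *\<^sub>R (D j 0 - (\<Sum>v | length v = j. L v u))", OF _ \<tau>0 \<tau>pos that] by blast
  moreover have "E k 0 = (\<Sum>v | length v = k. L v u)" for k
    by (simp add: E_def flow_0)
  ultimately show "k \<le> q \<Longrightarrow> nth_deriv I k (\<lambda>h. affine_integrator s \<gamma> \<phi>0 \<phi>1 h u) 0 = nth_deriv I k (\<lambda>h. \<phi> h u) 0"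
    using D(2)[of k 0] E(2)[of k 0] zero_in_I by simp
qed

end

section \<open>Initial velocities from the mild formula\<close>

lemma smooth_map_isCont:
  fixes F :: "'a::real_normed_vector \<Rightarrow> 'b::real_normed_vector"
  assumes "smooth_map F"
  shows "isCont F u"
  using assms unfolding smooth_map_def
proof (elim exE conjE)
  fix D :: "'a \<Rightarrow> 'a list \<Rightarrow> 'b"
  assume D0: "\<forall>u. D u [] = F u"
    and bd: "\<forall>u n. \<exists>C. \<forall>vs. length vs = n \<longrightarrow> norm (D u vs) \<le> C * prod_list (map norm vs)"
    and dif: "\<forall>u n. \<forall>e>0. \<exists>\<delta>>0. \<forall>w vs. norm w < \<delta> \<longrightarrow> length vs = n \<longrightarrow>
           norm (D (u + w) vs - D u vs - D u (w # vs)) \<le> e * norm w * prod_list (map norm vs)"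
  obtain C where C: "\<And>vs. length vs = 1 \<Longrightarrow> norm (D u vs) \<le> C * prod_list (map norm vs)"
    using bd[rule_format, of 1 u] by blast
  \<comment> \<open>Differentiability of the derivative of order zero, with \<open>e = 1\<close>,
    and the bound on the first derivative combine to a Lipschitz estimate at
    \<open>u\<close>.\<close>
  obtain \<delta> where \<delta>: "\<delta> > 0" "\<And>w. norm w < \<delta> \<Longrightarrow> norm (F (u + w) - F u - D u [w]) \<le> norm w"
    using dif[rule_format, of 1 0 u] D0 by auto
  have le: "norm (F (u + w) - F u) \<le> (1 + C) * norm w" if "norm w < \<delta>" for w
    using norm_triangle_ineq[of "F (u + w) - F u - D u [w]" "D u [w]"] \<delta>(2)[OF that] C[of "[w]"]
    by (simp add: distrib_right)
  have "((\<lambda>w. (1 + C) * norm w) \<longlongrightarrow> 0) (at 0)"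
    by (rule tendsto_mult_right_zero) (rule tendsto_norm_zero, rule tendsto_ident_at)
  then have "((\<lambda>w. F (u + w) - F u) \<longlongrightarrow> 0) (at 0)"
  proof (rule Lim_null_comparison[rotated])
    show "\<forall>\<^sub>F w in at 0. norm (F (u + w) - F u) \<le> (1 + C) * norm w"
      using \<delta>(1) le unfolding eventually_at by (intro exI[of _ \<delta>]) auto
  qed
  then show ?thesis
    unfolding isCont_iff by (rule LIM_zero_cancel)
qed

text \<open>By the mild formula \<open>f t u - S t u\<close> is the integral of a function that is
  close to \<open>F u\<close> for small times, so its average tends to \<open>F u\<close>.
  Subtracting \<open>S t u\<close> avoids differentiating the orbit of \<open>u\<close> under
  \<open>S\<close>, as \<open>u\<close> need not lie in the domain of the generator.\<close>

lemma mild_flow_tendsto: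
  fixes S :: "real \<Rightarrow> 'a::real_normed_vector \<Rightarrow> 'a"
  assumes T: "0 < T" and flow: "mild_flow T S F f" and F: "isCont F u"
    and S: "\<And>t v w. 0 \<le> t \<Longrightarrow> S t (v + w) = S t v + S t w" "\<And>v. S 0 v = v"
      "\<And>t v. 0 \<le> t \<Longrightarrow> t < T \<Longrightarrow> norm (S t v) \<le> M * norm v"
      "((\<lambda>t. S t (F u)) \<longlongrightarrow> F u) (at_right 0)"
    and M: "0 \<le> M"
  shows "((\<lambda>t. (1 / t) *\<^sub>R (f t u - S t u)) \<longlongrightarrow> F u) (at 0 within {0..<T})"
proof (rule tendstoI)
  fix e :: real assume e: "e > 0"
  have f0: "f 0 u = u" and cont: "continuous_on {0..<T} (\<lambda>t. f t u)"
    and int: "\<And>t. t \<in> {0..<T} \<Longrightarrow> ((\<lambda>s. S (t - s) (F (f s u))) has_integral (f t u - S t u)) {0..t}"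
    using flow unfolding mild_flow_def by blast+
  have "((\<lambda>t. f t u) \<longlongrightarrow> u) (at 0 within {0..<T})"
    using cont[unfolded continuous_on, rule_format, of 0] T f0 by simp
  then have "((\<lambda>t. F (f t u)) \<longlongrightarrow> F u) (at 0 within {0..<T})"
    by (rule isCont_tendsto_compose[OF F])
  \<comment> \<open>After multiplication by the bound \<open>M\<close> of the semigroup this is at
    most \<open>e / 4\<close>; adding 1 covers \<open>M = 0\<close>.\<close>
  then have "\<forall>\<^sub>F t in at 0 within {0..<T}. dist (F (f t u)) (F u) < e / (4 * (M + 1))"
    by (rule tendstoD) (use e M in simp)
  then obtain d1 where d1: "d1 > 0" "\<And>t. t \<in> {0..<T} \<Longrightarrow> t < d1 \<Longrightarrow> norm (F (f t u) - F u) \<le> e / (4 * (M + 1))"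
  proof -
    assume ev: "\<forall>\<^sub>F t in at 0 within {0..<T}. dist (F (f t u)) (F u) < e / (4 * (M + 1))"
      and th: "\<And>d1. d1 > 0 \<Longrightarrow> (\<And>t. t \<in> {0..<T} \<Longrightarrow> t < d1 \<Longrightarrow> norm (F (f t u) - F u) \<le> e / (4 * (M + 1))) \<Longrightarrow> thesis"
    obtain d where "d > 0" and d: "\<And>t. t \<in> {0..<T} \<Longrightarrow> t \<noteq> 0 \<Longrightarrow> dist t 0 < d \<Longrightarrow> dist (F (f t u)) (F u) < e / (4 * (M + 1))"
      using ev unfolding eventually_at by blast
    show thesis
    proof (rule th[OF \<open>d > 0\<close>])
      fix t assume "t \<in> {0..<T}" "t < d"
      then show "norm (F (f t u) - F u) \<le> e / (4 * (M + 1))"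
        using d[of t] f0 e M by (cases "t = 0") (auto simp: dist_norm less_imp_le)
    qed
  qed
  have "\<forall>\<^sub>F t in at_right 0. dist (S t (F u)) (F u) < e / 4"
    using S(4) by (rule tendstoD) (use e in simp)
  then obtain d2 where d2: "d2 > 0" "\<And>t. 0 < t \<Longrightarrow> t < d2 \<Longrightarrow> norm (S t (F u) - F u) < e / 4"
    unfolding eventually_at_right_field dist_norm by blast
  have main: "dist ((1 / t) *\<^sub>R (f t u - S t u)) (F u) < e" if t: "0 < t" "t < T" "t < d1" "t < d2" for t
  proof -
    have "((\<lambda>s. S (t - s) (F (f s u)) - F u) has_integral (f t u - S t u - t *\<^sub>R F u)) {0..t}"
      using has_integral_diff[OF int has_integral_const_real[of "F u" 0 t]] t by simp
    moreover have "norm (S (t - s) (F (f s u)) - F u) \<le> e / 2" if s: "s \<in> {0..t}" for s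
    proof -
      \<comment> \<open>Continuity of \<open>S\<close> at time 0 is strong and not in operator norm,
        so it is applied to the fixed vector \<open>F u\<close>; the variation of \<open>F\<close>
        along the flow is absorbed by the bound \<open>M\<close>.\<close>
      have "S (t - s) (F (f s u)) = S (t - s) (F (f s u) - F u) + S (t - s) (F u)"
        using S(1)[of "t - s" "F (f s u) - F u" "F u"] s by simp
      then have "norm (S (t - s) (F (f s u)) - F u) \<le> norm (S (t - s) (F (f s u) - F u)) + norm (S (t - s) (F u) - F u)"
        by (metis add_diff_eq norm_triangle_ineq)
      also have "norm (S (t - s) (F (f s u) - F u)) \<le> M * norm (F (f s u) - F u)"
        using s t by (intro S(3)) auto
      also have "\<dots> \<le> M * (e / (4 * (M + 1)))"
        using s t M by (intro mult_left_mono d1(2)) auto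
      also have "\<dots> \<le> e / 4" using M e by (simp add: field_simps)
      also have "norm (S (t - s) (F u) - F u) \<le> e / 4"
        using d2(2)[of "t - s"] S(2) s t e by (cases "s = t") (auto simp: less_imp_le)
      finally show ?thesis by simp
    qed
    ultimately have "norm (f t u - S t u - t *\<^sub>R F u) \<le> e / 2 * measure lborel {0..t}"
      using e by (intro has_integral_bound_real[where S = "{}"]) auto
    then have le: "norm (f t u - S t u - t *\<^sub>R F u) \<le> e / 2 * t" using t by simp
    have "(1 / t) *\<^sub>R (f t u - S t u) - F u = (1 / t) *\<^sub>R (f t u - S t u - t *\<^sub>R F u)"
      using t by (simp add: scaleR_diff_right)
    then have "norm ((1 / t) *\<^sub>R (f t u - S t u) - F u) = norm (f t u - S t u - t *\<^sub>R F u) / t"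
      using t by simp
    also have "\<dots> \<le> e / 2" using le t by (simp add: divide_le_eq)
    finally show ?thesis using e by (simp add: dist_norm)
  qed
  show "\<forall>\<^sub>F t in at 0 within {0..<T}. dist ((1 / t) *\<^sub>R (f t u - S t u)) (F u) < e"
    unfolding eventually_at
    by (rule exI[of _ "min d1 d2"]) (use d1 d2 main in auto)
qed

theorem theorem3p2:
  fixes H :: "nat \<Rightarrow> 'a::{real_inner, complete_space} set"
    and ip :: "nat \<Rightarrow> 'a \<Rightarrow> 'a \<Rightarrow> real"
    and D0 :: "'a set" and A0 A1 :: "'a \<Rightarrow> 'a" and \<kappa>0 hs :: real
    and \<phi> \<phi>0 \<phi>1 :: "real \<Rightarrow> 'a \<Rightarrow> 'a"
    and n q s :: nat and \<gamma> :: "nat \<Rightarrow> real"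
  assumes A0: "closed_densely_defined_linear D0 A0"
    and gen: "generates D0 A0 \<phi>0"
    and quasicontraction: "\<And>t u. t \<ge> 0 \<Longrightarrow> norm (\<phi>0 t u) \<le> exp (\<kappa>0 * t) * norm u"
    and A1: "smooth_map A1" "A1 0 = 0"
    and hs: "hs > 0"
    and flow: "mild_flow hs \<phi>0 A1 \<phi>"
    and flow1: "mild_flow hs (\<lambda>t u. u) A1 \<phi>1"
    and spaces: "hilbert_sequence H ip"
    and compat: "compatible hs H ip \<phi>" "compatible hs H ip \<phi>0" "compatible hs H ip \<phi>1"
    and q: "q = 2 * n"
    and sum_half: "(\<Sum>m=1..s. \<gamma> m) = 1 / 2"
    and sum_zero: "\<And>k. 1 \<le> k \<Longrightarrow> k < n \<Longrightarrow> (\<Sum>m=1..s. \<gamma> m / real m ^ (2 * k)) = 0"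
  shows "\<forall>u\<in>H q.
    times_differentiable_on q (\<lambda>h. affine_integrator s \<gamma> \<phi>0 \<phi>1 h u) {0..<hs} \<and>
    times_differentiable_on q (\<lambda>h. \<phi> h u) {0..<hs} \<and>
    (\<forall>k\<le>q. nth_deriv {0..<hs} k (\<lambda>h. affine_integrator s \<gamma> \<phi>0 \<phi>1 h u) 0
          = nth_deriv {0..<hs} k (\<lambda>h. \<phi> h u) 0)"
proof -
  have semigroup: "c0_semigroup \<phi>0" using gen by (simp add: generates_def)
  interpret flows: compatible_flows H ip hs "{\<phi>, \<phi>0, \<phi>1}"
  proof unfold_locales
    show "hilbert_sequence H ip" "0 < hs" by fact+
    fix f assume f: "f \<in> {\<phi>, \<phi>0, \<phi>1}"
    then show "compatible hs H ip f" using compat by blast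
    show "f 0 u = u" for u
      using f semigroup flow flow1 unfolding c0_semigroup_def mild_flow_def by blast
    show "f (t + t') u = f t (f t' u)" if "0 \<le> t" "0 \<le> t'" "t + t' < hs" for t t' u
      using f that semigroup flow flow1 unfolding c0_semigroup_def mild_flow_def by blast
  qed
  have der_iff: "flows.der 0 {0..<hs} f 0 y \<longleftrightarrow> ((\<lambda>t. (1 / t) *\<^sub>R (f t - f 0)) \<longlongrightarrow> y) (at 0 within {0..<hs})" for f y
    using hs LIM_zero_iff[of "\<lambda>t. (1 / t) *\<^sub>R (f t - f 0)"]
    by (simp add: flows.der_iff_tendsto tendsto_norm_zero_iff)
  have start: "\<phi> 0 u = u" "\<phi>0 0 u = u" "\<phi>1 0 u = u" for u
    using flows.flow_0 by auto
  have nontriv: "at 0 within {0..<hs} \<noteq> bot"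
    using flows.islimpt_I[of 0] hs by (simp add: trivial_limit_within)
  interpret splitting H ip hs \<phi> \<phi>0 \<phi>1
  proof unfold_locales
    fix u a b
    assume a: "flows.der 0 {0..<hs} (\<lambda>h. \<phi>0 h u) 0 a" and b: "flows.der 0 {0..<hs} (\<lambda>h. \<phi>1 h u) 0 b"
    have F: "isCont A1 u" by (rule smooth_map_isCont[OF A1(1)])
    \<comment> \<open>\<open>\<phi>1\<close> is the mild flow for the identity semigroup, whose
      operator bound is 1.\<close>
    have "((\<lambda>t. (1 / t) *\<^sub>R (\<phi>1 t u - u)) \<longlongrightarrow> A1 u) (at 0 within {0..<hs})"
      by (rule mild_flow_tendsto[OF hs flow1 F, of 1]) auto
    with b have "b = A1 u"
      unfolding der_iff start by (rule tendsto_unique[OF nontriv])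
    \<comment> \<open>The rate \<open>\<kappa>0\<close> may be negative; its absolute value gives
      one bound for all times below \<open>hs\<close>.\<close>
    have bd: "norm (\<phi>0 t v) \<le> exp (\<bar>\<kappa>0\<bar> * hs) * norm v" if "0 \<le> t" "t < hs" for t v
    proof -
      have "\<kappa>0 * t \<le> \<bar>\<kappa>0\<bar> * hs" using that by (intro mult_mono) auto
      then show ?thesis
        using quasicontraction[OF that(1), of v] by (meson exp_le_cancel_iff mult_right_mono norm_ge_zero order_trans)
    qed
    have "((\<lambda>t. (1 / t) *\<^sub>R (\<phi> t u - \<phi>0 t u)) \<longlongrightarrow> A1 u) (at 0 within {0..<hs})"
    proof (rule mild_flow_tendsto[OF hs flow F _ start(2) bd])
      show "\<phi>0 t (v + w) = \<phi>0 t v + \<phi>0 t w" if "0 \<le> t" for t v w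
        using semigroup that unfolding c0_semigroup_def by (blast intro: linear_add bounded_linear.linear)
      show "((\<lambda>t. \<phi>0 t (A1 u)) \<longlongrightarrow> A1 u) (at_right 0)"
        using semigroup unfolding c0_semigroup_def by blast
    qed auto
    \<comment> \<open>The velocity of \<open>\<phi>\<close> is that of \<open>\<phi>0\<close> plus
      the limit of the mild difference quotient, and this limit is the velocity \<open>b\<close> of
      \<open>\<phi>1\<close>.\<close>
    from tendsto_add[OF a[unfolded der_iff start] this]
    show "flows.der 0 {0..<hs} (\<lambda>h. \<phi> h u) 0 (a + b)"
      unfolding der_iff start \<open>b = A1 u\<close> by (simp add: scaleR_add_right[symmetric])
  qed
  show ?thesis
    using affine_integrator_order[OF _ q sum_half sum_zero] by blast
qed

end
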